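(* Let $H$ be a finite-dimensional Hopf algebra over a field $k$, let $R\subseteq H$ be a Hopf subalgebra, and let $Q = H/R^+H$, regarded as a right $R$-module. Let $n\geq 0$ be an integer. If $R\subseteq H$ has depth $2n+2$, then $$\mathrm{Ann}_R\, Q^{\otimes n}\ \subseteq\ \mathrm{Ann}_R\, Q^{\otimes (n+r)}$$ for all integers $r\geq 0$.
   Context: $R^+ = \ker \varepsilon|_R$ where $\varepsilon$ is the counit of $H$; $Q=H/R^+H$ is a right $H$-module (coalgebra), restricted to $R$. Tensor powers $Q^{\otimes n}$ are over $k$ with the diagonal action of $R$ via the coproduct, and $Q^{\otimes 0}=k$ is the trivial module given by $\varepsilon$. $\mathrm{Ann}_R\,W=\{r\in R: Wr=0\}$. Modules $X, Y$ are similar if $X$ is isomorphic to a direct summand of $q\cdot Y$ ($q$ copies of $Y$) and $Y$ is isomorphic to a direct summand of $q'\cdot X$ for some positive integers $q,q'$. For a unital subalgebra $B\subseteq A$, let $A^{\otimes_B n}$ be the $n$-fold tensor product of $A$ over $B$. For $m\geq 1$, $B\subseteq A$ has left (resp. right) depth $2m$ if $A^{\otimes_B(m+1)}$ and $A^{\otimes_B m}$ are similar as $B$-$A$-bimodules (resp. $A$-$B$-bimodules), and has depth $2m$ if it has left or right depth $2m$. *)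

theory Defs
  imports Complex_Main "HOL-Library.Poly_Mapping"
begin

section \<open>Quotients of additive groups and free vector spaces\<close>

definition modrel :: "'a::ab_group_add set \<Rightarrow> 'a set \<Rightarrow> ('a \<times> 'a) set"
  where "modrel U N = {(x, y). x \<in> U \<and> y \<in> U \<and> x - y \<in> N}"

text \<open>The quotient \<open>U/N\<close> is \<open>U // modrel U N\<close>, and \<open>qclass U N x\<close> is the coset of \<open>x\<close>.
  As in \<^theory>\<open>HOL.Equiv_Relations\<close>, an operation on cosets is written as the union of the
  cosets of its values on representatives; that union is a single coset whenever the
  operation is well defined.\<close>

definition qclass :: "'a::ab_group_add set \<Rightarrow> 'a set \<Rightarrow> 'a \<Rightarrow> 'a set"
  where "qclass U N x = modrel U N `` {x}"

text \<open>\<^typ>\<open>'x \<Rightarrow>\<^sub>0 'k\<close> is the free \<open>'k\<close>-vector space on \<open>'x\<close>.\<close>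

definition pscale :: "'k::field \<Rightarrow> ('x \<Rightarrow>\<^sub>0 'k) \<Rightarrow> ('x \<Rightarrow>\<^sub>0 'k)"
  where "pscale c = Poly_Mapping.map ((*) c)"

lemma lookup_pscale: "Poly_Mapping.lookup (pscale c f) x = c * Poly_Mapping.lookup f x"
  by (simp add: pscale_def Poly_Mapping.map.rep_eq when_def)

lemma vector_space_pscale: "vector_space pscale"
  by unfold_locales
    (simp_all add: poly_mapping_eq_iff fun_eq_iff lookup_pscale lookup_add algebra_simps)

definition free_on :: "'x set \<Rightarrow> ('x \<Rightarrow>\<^sub>0 'k::field) set"
  where "free_on X = {f. Poly_Mapping.keys f \<subseteq> X}"

text \<open>The linear extension of a map on the basis, into a space with scalar multiplication
  \<open>sc\<close>.\<close>

definition lin_ext :: "('k \<Rightarrow> 'b \<Rightarrow> 'b::comm_monoid_add) \<Rightarrow> ('x \<Rightarrow> 'b) \<Rightarrow> ('x \<Rightarrow>\<^sub>0 'k::field) \<Rightarrow> 'b"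
  where "lin_ext sc \<phi> f = (\<Sum>x\<in>Poly_Mapping.keys f. sc (Poly_Mapping.lookup f x) (\<phi> x))"

section \<open>Tensor powers\<close>

text \<open>A word \<open>[v\<^sub>1, \<dots>, v\<^sub>n]\<close> is the formal tensor \<open>v\<^sub>1 \<otimes> \<dots> \<otimes> v\<^sub>n\<close>. The tensor power of a space
  with carrier \<open>V\<close> is the free space on the words of length \<open>n\<close> over \<open>V\<close>, modulo the span of
  the multilinearity relations. For \<open>n = 0\<close> there are no relations and the result is \<open>'k\<close>.\<close>

definition words :: "'v set \<Rightarrow> nat \<Rightarrow> 'v list set"
  where "words V n = {xs. length xs = n \<and> set xs \<subseteq> V}"

definition multilin_rels ::
    "'v set \<Rightarrow> ('v \<Rightarrow> 'v \<Rightarrow> 'v) \<Rightarrow> ('k::field \<Rightarrow> 'v \<Rightarrow> 'v) \<Rightarrow> nat \<Rightarrow> ('v list \<Rightarrow>\<^sub>0 'k) set"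
  where "multilin_rels V add sc n =
    {Poly_Mapping.single (xs @ add a b # ys) 1
        - Poly_Mapping.single (xs @ a # ys) 1 - Poly_Mapping.single (xs @ b # ys) 1
      | xs a b ys. xs @ a # ys \<in> words V n \<and> b \<in> V}
    \<union> {Poly_Mapping.single (xs @ sc c a # ys) 1 - Poly_Mapping.single (xs @ a # ys) c
      | xs c a ys. xs @ a # ys \<in> words V n}"

text \<open>Concatenation of words, extended bilinearly: the product of the tensor algebra.\<close>

definition tconc :: "('v list \<Rightarrow>\<^sub>0 'k::field) \<Rightarrow> ('v list \<Rightarrow>\<^sub>0 'k) \<Rightarrow> ('v list \<Rightarrow>\<^sub>0 'k)"
  where "tconc f g =
    lin_ext pscale (\<lambda>xs. lin_ext pscale (\<lambda>ys. Poly_Mapping.single (xs @ ys) 1) g) f"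

text \<open>The tensor powers over \<open>'k\<close> of a whole type with scalar multiplication \<open>scale\<close>.\<close>

definition tclass ::
    "('k::field \<Rightarrow> 'h::ring_1 \<Rightarrow> 'h) \<Rightarrow> nat \<Rightarrow> ('h list \<Rightarrow>\<^sub>0 'k) \<Rightarrow> ('h list \<Rightarrow>\<^sub>0 'k) set"
  where "tclass scale n =
    qclass (free_on (words UNIV n)) (module.span pscale (multilin_rels UNIV (+) scale n))"

definition tpow :: "('k::field \<Rightarrow> 'h::ring_1 \<Rightarrow> 'h) \<Rightarrow> nat \<Rightarrow> ('h list \<Rightarrow>\<^sub>0 'k) set set"
  where "tpow scale n =
    free_on (words UNIV n) //
      modrel (free_on (words UNIV n)) (module.span pscale (multilin_rels UNIV (+) scale n))"

section \<open>Hopf algebras\<close>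

locale unital_algebra = vector_space scale
  for scale :: "'k::field \<Rightarrow> 'h::ring_1 \<Rightarrow> 'h" +
  assumes scale_mult_left: "scale c x * y = scale c (x * y)"
    and scale_mult_right: "x * scale c y = scale c (x * y)"

text \<open>Sweedler notation: \<open>sweedler \<Delta> h\<close> is a chosen representative of \<open>\<Delta> h\<close> as a formal sum of
  words \<open>[h\<^sub>1, h\<^sub>2]\<close>. It is only used in expressions that are linear in \<open>h\<^sub>1 \<otimes> h\<^sub>2\<close>, so that the
  choice does not matter.\<close>

definition sweedler :: "('h \<Rightarrow> ('h list \<Rightarrow>\<^sub>0 'k::field) set) \<Rightarrow> 'h \<Rightarrow> ('h list \<Rightarrow>\<^sub>0 'k)"
  where "sweedler \<Delta> h = (SOME f. f \<in> \<Delta> h)"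

text \<open>The product \<open>(x\<^sub>1 \<otimes> x\<^sub>2)(y\<^sub>1 \<otimes> y\<^sub>2) = x\<^sub>1y\<^sub>1 \<otimes> x\<^sub>2y\<^sub>2\<close> on representatives.\<close>

definition tmult ::
    "('h::ring_1 list \<Rightarrow>\<^sub>0 'k::field) \<Rightarrow> ('h list \<Rightarrow>\<^sub>0 'k) \<Rightarrow> ('h list \<Rightarrow>\<^sub>0 'k)"
  where "tmult f g =
    lin_ext pscale (\<lambda>xs. lin_ext pscale (\<lambda>ys. Poly_Mapping.single (map2 (*) xs ys) 1) g) f"

locale hopf_algebra = unital_algebra scale
  for scale :: "'k::field \<Rightarrow> 'h::ring_1 \<Rightarrow> 'h" +
  fixes \<Delta> :: "'h \<Rightarrow> ('h list \<Rightarrow>\<^sub>0 'k) set"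
    and \<epsilon> :: "'h \<Rightarrow> 'k"
    and S :: "'h \<Rightarrow> 'h"
  assumes comult_closed: "\<Delta> h \<in> tpow scale 2"
    and comult_add: "\<Delta> (x + y) = tclass scale 2 (sweedler \<Delta> x + sweedler \<Delta> y)"
    and comult_scale: "\<Delta> (scale c x) = tclass scale 2 (pscale c (sweedler \<Delta> x))"
    and counit_linear: "Vector_Spaces.linear scale (*) \<epsilon>"
    and coassoc:
      "tclass scale 3 (lin_ext pscale
          (\<lambda>xs. tconc (sweedler \<Delta> (xs ! 0)) (Poly_Mapping.single [xs ! 1] 1)) (sweedler \<Delta> h)) =
       tclass scale 3 (lin_ext pscale
          (\<lambda>xs. tconc (Poly_Mapping.single [xs ! 0] 1) (sweedler \<Delta> (xs ! 1))) (sweedler \<Delta> h))"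
    and counit_left: "lin_ext scale (\<lambda>xs. scale (\<epsilon> (xs ! 0)) (xs ! 1)) (sweedler \<Delta> h) = h"
    and counit_right: "lin_ext scale (\<lambda>xs. scale (\<epsilon> (xs ! 1)) (xs ! 0)) (sweedler \<Delta> h) = h"
    and comult_mult: "\<Delta> (x * y) = tclass scale 2 (tmult (sweedler \<Delta> x) (sweedler \<Delta> y))"
    and comult_one: "\<Delta> 1 = tclass scale 2 (Poly_Mapping.single [1, 1] 1)"
    and counit_mult: "\<epsilon> (x * y) = \<epsilon> x * \<epsilon> y"
    and counit_one: "\<epsilon> 1 = 1"
    and antipode_linear: "Vector_Spaces.linear scale scale S"
    and antipode_left: "lin_ext scale (\<lambda>xs. S (xs ! 0) * xs ! 1) (sweedler \<Delta> h) = scale (\<epsilon> h) 1"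
    and antipode_right: "lin_ext scale (\<lambda>xs. xs ! 0 * S (xs ! 1)) (sweedler \<Delta> h) = scale (\<epsilon> h) 1"

definition finite_dimensional :: "('k::field \<Rightarrow> 'h::ab_group_add \<Rightarrow> 'h) \<Rightarrow> bool"
  where "finite_dimensional scale \<longleftrightarrow> (\<exists>B. finite B \<and> module.span scale B = UNIV)"

definition unital_subalgebra :: "('k::field \<Rightarrow> 'h::ring_1 \<Rightarrow> 'h) \<Rightarrow> 'h set \<Rightarrow> bool"
  where "unital_subalgebra scale B \<longleftrightarrow>
    module.subspace scale B \<and> 1 \<in> B \<and> (\<forall>x\<in>B. \<forall>y\<in>B. x * y \<in> B)"

text \<open>The second conjunct says that \<open>\<Delta>(R)\<close> lies in the image of \<open>R \<otimes> R\<close> in \<open>H \<otimes> H\<close>.\<close>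

definition hopf_subalgebra ::
    "('k::field \<Rightarrow> 'h::ring_1 \<Rightarrow> 'h) \<Rightarrow> ('h \<Rightarrow> ('h list \<Rightarrow>\<^sub>0 'k) set) \<Rightarrow> ('h \<Rightarrow> 'h) \<Rightarrow> 'h set \<Rightarrow> bool"
  where "hopf_subalgebra scale \<Delta> S R \<longleftrightarrow>
    unital_subalgebra scale R \<and>
    (\<forall>r\<in>R. \<exists>f \<in> free_on (words R 2). \<Delta> r = tclass scale 2 f) \<and>
    S ` R \<subseteq> R"

section \<open>The quotient module \<open>Q = H / R\<^sup>+H\<close> and its tensor powers\<close>

definition RplusH :: "('k::field \<Rightarrow> 'h::ring_1 \<Rightarrow> 'h) \<Rightarrow> ('h \<Rightarrow> 'k) \<Rightarrow> 'h set \<Rightarrow> 'h set"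
  where "RplusH scale \<epsilon> R = module.span scale {r * h | r h. r \<in> R \<and> \<epsilon> r = 0}"

definition Q_class :: "('k::field \<Rightarrow> 'h::ring_1 \<Rightarrow> 'h) \<Rightarrow> ('h \<Rightarrow> 'k) \<Rightarrow> 'h set \<Rightarrow> 'h \<Rightarrow> 'h set"
  where "Q_class scale \<epsilon> R = qclass UNIV (RplusH scale \<epsilon> R)"

definition Q_carrier :: "('k::field \<Rightarrow> 'h::ring_1 \<Rightarrow> 'h) \<Rightarrow> ('h \<Rightarrow> 'k) \<Rightarrow> 'h set \<Rightarrow> 'h set set"
  where "Q_carrier scale \<epsilon> R = UNIV // modrel UNIV (RplusH scale \<epsilon> R)"

definition Q_add ::
    "('k::field \<Rightarrow> 'h::ring_1 \<Rightarrow> 'h) \<Rightarrow> ('h \<Rightarrow> 'k) \<Rightarrow> 'h set \<Rightarrow> 'h set \<Rightarrow> 'h set \<Rightarrow> 'h set"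
  where "Q_add scale \<epsilon> R X Y = (\<Union>x\<in>X. \<Union>y\<in>Y. Q_class scale \<epsilon> R (x + y))"

definition Q_scale ::
    "('k::field \<Rightarrow> 'h::ring_1 \<Rightarrow> 'h) \<Rightarrow> ('h \<Rightarrow> 'k) \<Rightarrow> 'h set \<Rightarrow> 'k \<Rightarrow> 'h set \<Rightarrow> 'h set"
  where "Q_scale scale \<epsilon> R c X = (\<Union>x\<in>X. Q_class scale \<epsilon> R (scale c x))"

definition Q_act ::
    "('k::field \<Rightarrow> 'h::ring_1 \<Rightarrow> 'h) \<Rightarrow> ('h \<Rightarrow> 'k) \<Rightarrow> 'h set \<Rightarrow> 'h set \<Rightarrow> 'h \<Rightarrow> 'h set"
  where "Q_act scale \<epsilon> R X h = (\<Union>x\<in>X. Q_class scale \<epsilon> R (x * h))"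

definition Qpow_rel ::
    "('k::field \<Rightarrow> 'h::ring_1 \<Rightarrow> 'h) \<Rightarrow> ('h \<Rightarrow> 'k) \<Rightarrow> 'h set \<Rightarrow> nat \<Rightarrow> ('h set list \<Rightarrow>\<^sub>0 'k) set"
  where "Qpow_rel scale \<epsilon> R n = module.span pscale
    (multilin_rels (Q_carrier scale \<epsilon> R) (Q_add scale \<epsilon> R) (Q_scale scale \<epsilon> R) n)"

definition Qpow_class ::
    "('k::field \<Rightarrow> 'h::ring_1 \<Rightarrow> 'h) \<Rightarrow> ('h \<Rightarrow> 'k) \<Rightarrow> 'h set \<Rightarrow> nat \<Rightarrow>
      ('h set list \<Rightarrow>\<^sub>0 'k) \<Rightarrow> ('h set list \<Rightarrow>\<^sub>0 'k) set"
  where "Qpow_class scale \<epsilon> R n =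
    qclass (free_on (words (Q_carrier scale \<epsilon> R) n)) (Qpow_rel scale \<epsilon> R n)"

definition Qpow_carrier ::
    "('k::field \<Rightarrow> 'h::ring_1 \<Rightarrow> 'h) \<Rightarrow> ('h \<Rightarrow> 'k) \<Rightarrow> 'h set \<Rightarrow> nat \<Rightarrow> ('h set list \<Rightarrow>\<^sub>0 'k) set set"
  where "Qpow_carrier scale \<epsilon> R n =
    free_on (words (Q_carrier scale \<epsilon> R) n) //
      modrel (free_on (words (Q_carrier scale \<epsilon> R) n)) (Qpow_rel scale \<epsilon> R n)"

text \<open>The diagonal action on formal tensors:
  \<open>(q\<^sub>1 \<otimes> \<dots> \<otimes> q\<^sub>n) h = q\<^sub>1 h\<^sub>1 \<otimes> (q\<^sub>2 \<otimes> \<dots> \<otimes> q\<^sub>n) h\<^sub>2\<close>, ending in \<open>1 h = \<epsilon> h\<close> on the empty tensor.\<close>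

primrec diag_act ::
    "('k::field \<Rightarrow> 'h::ring_1 \<Rightarrow> 'h) \<Rightarrow> ('h \<Rightarrow> ('h list \<Rightarrow>\<^sub>0 'k) set) \<Rightarrow> ('h \<Rightarrow> 'k) \<Rightarrow> 'h set \<Rightarrow>
      'h set list \<Rightarrow> 'h \<Rightarrow> ('h set list \<Rightarrow>\<^sub>0 'k)"
  where
    "diag_act scale \<Delta> \<epsilon> R [] h = Poly_Mapping.single [] (\<epsilon> h)"
  | "diag_act scale \<Delta> \<epsilon> R (q # qs) h =
      lin_ext pscale
        (\<lambda>xs. tconc (Poly_Mapping.single [Q_act scale \<epsilon> R q (xs ! 0)] 1)
                    (diag_act scale \<Delta> \<epsilon> R qs (xs ! 1)))
        (sweedler \<Delta> h)"

definition Qpow_act ::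
    "('k::field \<Rightarrow> 'h::ring_1 \<Rightarrow> 'h) \<Rightarrow> ('h \<Rightarrow> ('h list \<Rightarrow>\<^sub>0 'k) set) \<Rightarrow> ('h \<Rightarrow> 'k) \<Rightarrow> 'h set \<Rightarrow> nat \<Rightarrow>
      ('h set list \<Rightarrow>\<^sub>0 'k) set \<Rightarrow> 'h \<Rightarrow> ('h set list \<Rightarrow>\<^sub>0 'k) set"
  where "Qpow_act scale \<Delta> \<epsilon> R n W h =
    (\<Union>f\<in>W. Qpow_class scale \<epsilon> R n (lin_ext pscale (\<lambda>qs. diag_act scale \<Delta> \<epsilon> R qs h) f))"

definition Ann_Qpow ::
    "('k::field \<Rightarrow> 'h::ring_1 \<Rightarrow> 'h) \<Rightarrow> ('h \<Rightarrow> ('h list \<Rightarrow>\<^sub>0 'k) set) \<Rightarrow> ('h \<Rightarrow> 'k) \<Rightarrow> 'h set \<Rightarrow> nat \<Rightarrow>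
      'h set"
  where "Ann_Qpow scale \<Delta> \<epsilon> R n =
    {r \<in> R. \<forall>W \<in> Qpow_carrier scale \<epsilon> R n.
        Qpow_act scale \<Delta> \<epsilon> R n W r = Qpow_class scale \<epsilon> R n 0}"

section \<open>Bimodules and similarity\<close>

text \<open>The actions are given for all of a ring \<open>'a\<close>; the predicates below take the subrings
  \<open>L\<close> and \<open>R\<close> by which the bimodule is acted on from the left and from the right.\<close>

record ('a, 'm) bimod =
  bcarrier :: "'m set"
  bzero :: 'm
  badd :: "'m \<Rightarrow> 'm \<Rightarrow> 'm"
  blact :: "'a \<Rightarrow> 'm \<Rightarrow> 'm"
  bract :: "'m \<Rightarrow> 'a \<Rightarrow> 'm"

definition subbimod :: "'a set \<Rightarrow> 'a set \<Rightarrow> ('a, 'm) bimod \<Rightarrow> 'm set \<Rightarrow> bool"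
  where "subbimod L R Y U \<longleftrightarrow>
    U \<subseteq> bcarrier Y \<and> bzero Y \<in> U \<and> (\<forall>u\<in>U. \<forall>v\<in>U. badd Y u v \<in> U) \<and>
    (\<forall>a\<in>L. \<forall>u\<in>U. blact Y a u \<in> U) \<and> (\<forall>u\<in>U. \<forall>a\<in>R. bract Y u a \<in> U)"

definition bimod_hom ::
    "'a set \<Rightarrow> 'a set \<Rightarrow> ('a, 'm) bimod \<Rightarrow> ('a, 'n) bimod \<Rightarrow> ('m \<Rightarrow> 'n) \<Rightarrow> bool"
  where "bimod_hom L R X Y \<phi> \<longleftrightarrow>
    \<phi> ` bcarrier X \<subseteq> bcarrier Y \<and>
    (\<forall>x \<in> bcarrier X. \<forall>y \<in> bcarrier X. \<phi> (badd X x y) = badd Y (\<phi> x) (\<phi> y)) \<and>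
    (\<forall>a\<in>L. \<forall>x \<in> bcarrier X. \<phi> (blact X a x) = blact Y a (\<phi> x)) \<and>
    (\<forall>x \<in> bcarrier X. \<forall>a\<in>R. \<phi> (bract X x a) = bract Y (\<phi> x) a)"

text \<open>\<open>X\<close> is isomorphic to a submodule \<open>U\<close> of \<open>Y\<close> that has a complement \<open>W\<close>.\<close>

definition iso_direct_summand ::
    "'a set \<Rightarrow> 'a set \<Rightarrow> ('a, 'm) bimod \<Rightarrow> ('a, 'n) bimod \<Rightarrow> bool"
  where "iso_direct_summand L R X Y \<longleftrightarrow>
    (\<exists>U W \<phi>. subbimod L R Y U \<and> subbimod L R Y W \<and>
      U \<inter> W = {bzero Y} \<and> {badd Y u w | u w. u \<in> U \<and> w \<in> W} = bcarrier Y \<and>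
      bimod_hom L R X Y \<phi> \<and> bij_betw \<phi> (bcarrier X) U)"

text \<open>The direct sum \<open>q \<cdot> Y\<close> of \<open>q\<close> copies of \<open>Y\<close>, as lists of length \<open>q\<close>.\<close>

definition copies :: "nat \<Rightarrow> ('a, 'm) bimod \<Rightarrow> ('a, 'm list) bimod"
  where "copies q Y = \<lparr>
    bcarrier = words (bcarrier Y) q,
    bzero = replicate q (bzero Y),
    badd = map2 (badd Y),
    blact = (\<lambda>a. map (blact Y a)),
    bract = (\<lambda>ys a. map (\<lambda>y. bract Y y a) ys)\<rparr>"

definition similar :: "'a set \<Rightarrow> 'a set \<Rightarrow> ('a, 'm) bimod \<Rightarrow> ('a, 'n) bimod \<Rightarrow> bool"
  where "similar L R X Y \<longleftrightarrow>
    (\<exists>q>0. iso_direct_summand L R X (copies q Y)) \<and>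
    (\<exists>q>0. iso_direct_summand L R Y (copies q X))"

section \<open>Tensor powers over a subalgebra and depth\<close>

definition balanced_rels :: "'h::ring_1 set \<Rightarrow> nat \<Rightarrow> ('h list \<Rightarrow>\<^sub>0 'k::field) set"
  where "balanced_rels B n =
    {Poly_Mapping.single (xs @ (a * b) # a' # ys) 1 - Poly_Mapping.single (xs @ a # (b * a') # ys) 1
      | xs a b a' ys. b \<in> B \<and> xs @ a # a' # ys \<in> words UNIV n}"

definition tover_rel ::
    "('k::field \<Rightarrow> 'h::ring_1 \<Rightarrow> 'h) \<Rightarrow> 'h set \<Rightarrow> nat \<Rightarrow> ('h list \<Rightarrow>\<^sub>0 'k) set"
  where "tover_rel scale B n =
    module.span pscale (multilin_rels UNIV (+) scale n \<union> balanced_rels B n)"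

definition tover_class ::
    "('k::field \<Rightarrow> 'h::ring_1 \<Rightarrow> 'h) \<Rightarrow> 'h set \<Rightarrow> nat \<Rightarrow> ('h list \<Rightarrow>\<^sub>0 'k) \<Rightarrow> ('h list \<Rightarrow>\<^sub>0 'k) set"
  where "tover_class scale B n = qclass (free_on (words UNIV n)) (tover_rel scale B n)"

text \<open>The \<open>n\<close>-fold tensor product of the algebra over \<open>B\<close>, for \<open>n \<ge> 1\<close>, as a bimodule over
  the algebra: multiplication on the first factor and on the last factor.\<close>

definition tover ::
    "('k::field \<Rightarrow> 'h::ring_1 \<Rightarrow> 'h) \<Rightarrow> 'h set \<Rightarrow> nat \<Rightarrow> ('h, ('h list \<Rightarrow>\<^sub>0 'k) set) bimod"
  where "tover scale B n = \<lparr>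
    bcarrier = free_on (words UNIV n) // modrel (free_on (words UNIV n)) (tover_rel scale B n),
    bzero = tover_class scale B n 0,
    badd = (\<lambda>X Y. \<Union>f\<in>X. \<Union>g\<in>Y. tover_class scale B n (f + g)),
    blact = (\<lambda>a X. \<Union>f\<in>X. tover_class scale B n
      (lin_ext pscale (\<lambda>xs. Poly_Mapping.single ((a * hd xs) # tl xs) 1) f)),
    bract = (\<lambda>X a. \<Union>f\<in>X. tover_class scale B n
      (lin_ext pscale (\<lambda>xs. Poly_Mapping.single (butlast xs @ [last xs * a]) 1) f))\<rparr>"

definition left_depth_even :: "('k::field \<Rightarrow> 'h::ring_1 \<Rightarrow> 'h) \<Rightarrow> 'h set \<Rightarrow> nat \<Rightarrow> bool"
  where "left_depth_even scale B d \<longleftrightarrow>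
    (\<exists>m\<ge>1. d = 2 * m \<and> similar B UNIV (tover scale B (m + 1)) (tover scale B m))"

definition right_depth_even :: "('k::field \<Rightarrow> 'h::ring_1 \<Rightarrow> 'h) \<Rightarrow> 'h set \<Rightarrow> nat \<Rightarrow> bool"
  where "right_depth_even scale B d \<longleftrightarrow>
    (\<exists>m\<ge>1. d = 2 * m \<and> similar UNIV B (tover scale B (m + 1)) (tover scale B m))"

definition has_depth_even :: "('k::field \<Rightarrow> 'h::ring_1 \<Rightarrow> 'h) \<Rightarrow> 'h set \<Rightarrow> nat \<Rightarrow> bool"
  where "has_depth_even scale B d \<longleftrightarrow> left_depth_even scale B d \<or> right_depth_even scale B d"

end

theory Submission
  imports Defs
begin

text \<open>The map \<open>x \<otimes> y \<mapsto> x y\<^sub>1 \<otimes> y\<^sub>2\<close> gives an isomorphism \<open>H \<otimes>\<^sub>R H \<cong> H \<otimes> Q\<close>; iterating it and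
  applying \<open>k \<otimes>\<^sub>H -\<close> yields \<open>k \<otimes>\<^sub>H H\<^bsup>\<otimes>\<^sub>R(n+1)\<^esup> \<cong> Q\<^bsup>\<otimes>n\<^esup>\<close> as right modules. If \<open>H\<^bsup>\<otimes>\<^sub>R(n+2)\<^esup>\<close> is a direct summand of
  copies of \<open>H\<^bsup>\<otimes>\<^sub>R(n+1)\<^esup>\<close> as an \<open>H\<close>-\<open>R\<close>-bimodule, every \<open>r \<in> R\<close> that kills \<open>Q\<^bsup>\<otimes>n\<^esup>\<close> therefore kills
  \<open>Q\<^bsup>\<otimes>(n+1)\<^esup>\<close>. For the \<open>R\<close>-\<open>H\<close>-bimodule version one transports along the antipode, which is bijective
  because a finite-dimensional Hopf algebra has a nonzero left integral. Finally,
  \<open>r\<close> kills \<open>Q\<^bsup>\<otimes>(m+1)\<^esup>\<close> iff all \<open>\<Sum> f (h * r\<^sub>1) r\<^sub>2\<close>, with \<open>f \<in> Q\<^sup>*\<close> and \<open>h \<in> H\<close>, kill \<open>Q\<^bsup>\<otimes>m\<^esup>\<close>, so that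
  \<open>Ann Q\<^bsup>\<otimes>m\<^esup> \<subseteq> Ann Q\<^bsup>\<otimes>(m+1)\<^esup>\<close> implies the same inclusion for \<open>m + 1\<close>. The modules
  enter only through the multilinear forms on words that represent their functionals.\<close>

text \<open>The obstacle is that all tensor products are sets of cosets of formal sums, and a
  Sweedler expression is well defined only if it is multilinear in its legs. Everything is therefore
  tested against scalars: an identity in a tensor power of \<open>H\<close> becomes an equation
  between nested sums \<open>sw\<close> of scalar-valued forms, and arguments about representatives
  become linearity goals. Finite dimension enters through dual bases, which separate points and pull
  a vector out of a Sweedler sum. Duality also makes the hypothesis on summands usable. If the
  identity of \<open>X\<close> is a sum of maps that factor through \<open>Y\<close>, each invariant
  functional on \<open>X\<close> is a sum of pullbacks of invariant functionals on \<open>Y\<close>,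
  so vanishing passes from \<open>Y\<close> to \<open>X\<close> and no tensor product over
  \<open>H\<close> is ever formed. The isomorphism with the tensor powers of \<open>Q\<close> is not
  built either: the two families of annihilators have the same start and the same recursion. For the
  exchange of sides, bijectivity of \<open>S\<close> on \<open>H\<close> is not the whole story: an
  element of \<open>R\<close> has to be \<open>S r'\<close> with \<open>r'\<close> again in
  \<open>R\<close>, hence \<open>S R = R\<close>.\<close>

interpretation pm: vector_space "pscale :: 'k::field \<Rightarrow> ('x \<Rightarrow>\<^sub>0 'k) \<Rightarrow> ('x \<Rightarrow>\<^sub>0 'k)"
  by (rule vector_space_pscale)

lemma vector_space_mult: "vector_space ((*) :: 'k::field \<Rightarrow> 'k \<Rightarrow> 'k)"
  by unfold_locales (simp_all add: algebra_simps)

lemma lookup_sum_apply: "Poly_Mapping.lookup (\<Sum>x\<in>A. f x) i = (\<Sum>x\<in>A. Poly_Mapping.lookup (f x) i)"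
  by (induction A rule: infinite_finite_induct) (simp_all add: lookup_add)

lemma pscale_single: "pscale c (Poly_Mapping.single x d) = Poly_Mapping.single x (c * d)"
  by (rule poly_mapping_eqI) (simp add: lookup_pscale lookup_single when_def)

lemma poly_mapping_eq_sum:
  "f = (\<Sum>x\<in>Poly_Mapping.keys f. Poly_Mapping.single x (Poly_Mapping.lookup f x))"
  by (rule poly_mapping_eqI)
    (simp add: lookup_sum_apply lookup_single when_def in_keys_iff)

section \<open>Linear extensions\<close>

context vector_space
begin

lemma lin_ext_superset:
  assumes "finite A" "Poly_Mapping.keys f \<subseteq> A"
  shows "lin_ext scale \<phi> f = (\<Sum>x\<in>A. scale (Poly_Mapping.lookup f x) (\<phi> x))"
  unfolding lin_ext_def
  by (rule sum.mono_neutral_left) (use assms in \<open>auto simp: in_keys_iff\<close>)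

lemma lin_ext_zero [simp]: "lin_ext scale \<phi> 0 = 0"
  by (simp add: lin_ext_def)

lemma lin_ext_single [simp]: "lin_ext scale \<phi> (Poly_Mapping.single x c) = scale c (\<phi> x)"
  by (simp add: lin_ext_def)

lemma lin_ext_add: "lin_ext scale \<phi> (f + g) = lin_ext scale \<phi> f + lin_ext scale \<phi> g"
proof -
  let ?A = "Poly_Mapping.keys f \<union> Poly_Mapping.keys g"
  have "Poly_Mapping.keys (f + g) \<subseteq> ?A" by (rule Poly_Mapping.keys_add)
  then show ?thesis
    by (simp add: lin_ext_superset [where A = ?A] lookup_add scale_left_distrib sum.distrib)
qed

lemma lin_ext_pscale: "lin_ext scale \<phi> (pscale c f) = scale c (lin_ext scale \<phi> f)"
proof -
  have "Poly_Mapping.keys (pscale c f) \<subseteq> Poly_Mapping.keys f"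
    by (auto simp: in_keys_iff lookup_pscale)
  then show ?thesis
    by (simp add: lin_ext_superset [where A = "Poly_Mapping.keys f"] lookup_pscale scale_sum_right)
qed

lemma lin_ext_sum: "lin_ext scale \<phi> (\<Sum>i\<in>I. F i) = (\<Sum>i\<in>I. lin_ext scale \<phi> (F i))"
  by (induction I rule: infinite_finite_induct) (simp_all add: lin_ext_add)

lemma lin_ext_minus: "lin_ext scale \<phi> (- f) = - lin_ext scale \<phi> f"
  using lin_ext_add [of \<phi> f "- f"] by (simp add: eq_neg_iff_add_eq_0 add.commute)

lemma lin_ext_diff: "lin_ext scale \<phi> (f - g) = lin_ext scale \<phi> f - lin_ext scale \<phi> g"
  using lin_ext_add [of \<phi> f "- g"] by (simp add: lin_ext_minus)

lemma lin_ext_lin_ext: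
  "lin_ext scale \<phi> (lin_ext pscale F f) = lin_ext scale (\<lambda>x. lin_ext scale \<phi> (F x)) f"
proof -
  have "lin_ext scale \<phi> (lin_ext pscale F f) =
      (\<Sum>x\<in>Poly_Mapping.keys f. scale (Poly_Mapping.lookup f x) (lin_ext scale \<phi> (F x)))"
    unfolding lin_ext_def [of pscale] by (simp only: lin_ext_sum lin_ext_pscale)
  then show ?thesis by (simp only: lin_ext_def [of scale "\<lambda>x. lin_ext scale \<phi> (F x)"])
qed

lemma lin_ext_in_subspace:
  assumes "subspace U" "\<And>x. x \<in> Poly_Mapping.keys f \<Longrightarrow> \<phi> x \<in> U"
  shows "lin_ext scale \<phi> f \<in> U"
  unfolding lin_ext_def using assms by (intro subspace_sum subspace_scale)

lemma lin_ext_span_zero: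
  assumes "t \<in> module.span pscale G" "\<And>t. t \<in> G \<Longrightarrow> lin_ext scale \<phi> t \<in> U" "subspace U"
  shows "lin_ext scale \<phi> t \<in> U"
proof -
  have "pm.subspace {t. lin_ext scale \<phi> t \<in> U}"
    using assms(3)
    by (auto simp: pm.subspace_def lin_ext_add lin_ext_pscale subspace_0 subspace_add subspace_scale)
  from pm.span_induct [OF assms(1) this] show ?thesis using assms(2) by auto
qed

end

lemma lin_ext_cong:
  "(\<And>x. x \<in> Poly_Mapping.keys f \<Longrightarrow> \<phi> x = \<psi> x) \<Longrightarrow> lin_ext sc \<phi> f = lin_ext sc \<psi> f"
  by (simp add: lin_ext_def)

interpretation base_field: vector_space "(*) :: 'k::field \<Rightarrow> 'k \<Rightarrow> 'k"
  by (rule vector_space_mult)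

declare base_field.scale_scale [simp del] \<comment> \<open>as a simp rule it loops with \<open>mult.assoc\<close>\<close>

section \<open>Cosets\<close>

lemma equiv_modrel:
  assumes "\<And>x y. x \<in> N \<Longrightarrow> y \<in> N \<Longrightarrow> x + y \<in> N" "\<And>x. x \<in> N \<Longrightarrow> - x \<in> N" "0 \<in> N"
  shows "equiv U (modrel U N)"
proof (rule equivI)
  show "refl_on U (modrel U N)" using assms(3) by (auto simp: refl_on_def modrel_def)
  show "modrel U N \<subseteq> U \<times> U" by (auto simp: modrel_def)
  show "sym (modrel U N)"
    unfolding sym_def modrel_def
  proof clarsimp
    fix x y assume "x - y \<in> N"
    from assms(2)[OF this] show "y - x \<in> N" by simp
  qed
  show "trans (modrel U N)"
    unfolding trans_def modrel_def
  proof clarsimp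
    fix x y z assume "x - y \<in> N" "y - z \<in> N"
    from assms(1)[OF this] show "x - z \<in> N" by simp
  qed
qed

locale coset_quotient =
  fixes U N :: "'a::ab_group_add set"
  assumes U_0: "0 \<in> U" and N_0: "0 \<in> N"
    and N_add: "\<And>x y. x \<in> N \<Longrightarrow> y \<in> N \<Longrightarrow> x + y \<in> N"
    and N_minus: "\<And>x. x \<in> N \<Longrightarrow> - x \<in> N"
begin

lemma equiv: "equiv U (modrel U N)"
  by (rule equiv_modrel) (fact N_add N_minus N_0)+

lemma qclass_eq_iff:
  assumes "x \<in> U" "y \<in> U"
  shows "qclass U N x = qclass U N y \<longleftrightarrow> x - y \<in> N"
  using equiv_class_eq_iff [OF equiv, of x y] assms by (auto simp: qclass_def modrel_def)

lemma mem_qclass_iff: "x \<in> U \<Longrightarrow> y \<in> qclass U N x \<longleftrightarrow> y \<in> U \<and> x - y \<in> N"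
  by (auto simp: qclass_def modrel_def)

lemma qclass_self: "x \<in> U \<Longrightarrow> x \<in> qclass U N x"
  using N_0 by (simp add: mem_qclass_iff)

lemma qclass_in: "x \<in> U \<Longrightarrow> qclass U N x \<in> U // modrel U N"
  unfolding qclass_def by (rule quotientI)

lemma quotient_cases:
  assumes "X \<in> U // modrel U N"
  obtains x where "x \<in> U" "X = qclass U N x"
  using assms by (auto simp: quotient_def qclass_def)

lemma UN_qclass:
  assumes "x \<in> U" "\<And>y. y \<in> U \<Longrightarrow> x - y \<in> N \<Longrightarrow> F y = F x"
  shows "(\<Union>y\<in>qclass U N x. F y) = F x"
proof -
  have "F y = F x" if "y \<in> qclass U N x" for y
    using that assms(2) [of y] by (simp add: mem_qclass_iff [OF assms(1)])
  then show ?thesis using qclass_self [OF assms(1)] by blast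
qed

lemma some_qclass:
  assumes "x \<in> U"
  shows "(SOME y. y \<in> qclass U N x) \<in> U" "x - (SOME y. y \<in> qclass U N x) \<in> N"
proof -
  have "(SOME y. y \<in> qclass U N x) \<in> qclass U N x"
    by (rule someI) (rule qclass_self [OF assms])
  then show "(SOME y. y \<in> qclass U N x) \<in> U" "x - (SOME y. y \<in> qclass U N x) \<in> N"
    by (simp_all only: mem_qclass_iff [OF assms])
qed

end

lemma free_on_subspace: "module.subspace pscale (free_on X :: ('a \<Rightarrow>\<^sub>0 'b::field) set)"
proof (rule pm.subspaceI)
  fix f g :: "'a \<Rightarrow>\<^sub>0 'b"
  assume "f \<in> free_on X" "g \<in> free_on X"
  then show "f + g \<in> free_on X" using Poly_Mapping.keys_add [of f g] by (auto simp: free_on_def)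
next
  fix c and f :: "'a \<Rightarrow>\<^sub>0 'b"
  assume "f \<in> free_on X"
  then show "pscale c f \<in> free_on X" by (auto simp: free_on_def in_keys_iff lookup_pscale)
qed (simp add: free_on_def)

lemma single_in_free_on: "x \<in> X \<Longrightarrow> Poly_Mapping.single x c \<in> free_on X"
  by (auto simp: free_on_def)

lemma coset_quotient_free:
  "coset_quotient (free_on X) (module.span pscale (G :: ('x \<Rightarrow>\<^sub>0 'k::field) set))"
  by unfold_locales
    (simp_all add: pm.span_zero pm.span_add pm.span_neg pm.subspace_0 free_on_subspace)

section \<open>Linear functionals\<close>

context unital_algebra
begin

definition lin :: "('h \<Rightarrow> 'k) \<Rightarrow> bool"
  where "lin f \<longleftrightarrow> (\<forall>x y. f (x + y) = f x + f y) \<and> (\<forall>c x. f (scale c x) = c * f x)"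

definition lin_endo :: "('h \<Rightarrow> 'h) \<Rightarrow> bool"
  where "lin_endo f \<longleftrightarrow> (\<forall>x y. f (x + y) = f x + f y) \<and> (\<forall>c x. f (scale c x) = scale c (f x))"

definition multilin :: "('k \<Rightarrow> 'v::ab_group_add \<Rightarrow> 'v) \<Rightarrow> nat \<Rightarrow> ('h list \<Rightarrow> 'v) \<Rightarrow> bool"
  where "multilin sc n \<Phi> \<longleftrightarrow>
    (\<forall>xs a b ys. length xs + length ys + 1 = n \<longrightarrow>
      \<Phi> (xs @ (a + b) # ys) = \<Phi> (xs @ a # ys) + \<Phi> (xs @ b # ys)) \<and>
    (\<forall>xs c a ys. length xs + length ys + 1 = n \<longrightarrow>
      \<Phi> (xs @ scale c a # ys) = sc c (\<Phi> (xs @ a # ys)))"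

lemma linD:
  fixes f :: "'h \<Rightarrow> 'k" and h :: "'i \<Rightarrow> 'h" and x y :: 'h
  assumes "lin f"
  shows "f (x + y) = f x + f y" "f (scale c x) = c * f x" "f 0 = 0" "f (- x) = - f x"
    "f (x - y) = f x - f y" "f (sum h A) = (\<Sum>i\<in>A. f (h i))"
proof -
  have add: "f (x + y) = f x + f y" for x y using assms by (simp add: lin_def)
  have sc: "f (scale c x) = c * f x" for c x using assms by (simp add: lin_def)
  have 0: "f 0 = 0" using sc [of 0 0] by simp
  have m: "f (- x) = - f x" for x using sc [of "-1" x] by simp
  show "f (x + y) = f x + f y" "f (scale c x) = c * f x" "f 0 = 0" "f (- x) = - f x"
    by (fact add sc 0 m)+
  show "f (x - y) = f x - f y" using add [of x "- y"] m by simp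
  show "f (sum h A) = (\<Sum>i\<in>A. f (h i))"
    by (induction A rule: infinite_finite_induct) (simp_all add: add 0)
qed

lemma lin_mult_left: "lin f \<Longrightarrow> lin (\<lambda>x. f x * c)"
  by (simp add: lin_def algebra_simps)

lemma lin_mult_right: "lin f \<Longrightarrow> lin (\<lambda>x. c * f x)"
  by (simp add: lin_def algebra_simps)

lemma lin_sum: "(\<And>i. i \<in> A \<Longrightarrow> lin (f i)) \<Longrightarrow> lin (\<lambda>x. \<Sum>i\<in>A. f i x)"
  by (induction A rule: infinite_finite_induct) (auto simp: lin_def algebra_simps)

lemma lin_compose: "lin f \<Longrightarrow> lin_endo t \<Longrightarrow> lin (\<lambda>x. f (t x))"
  by (simp add: lin_def lin_endo_def)

lemma lin_endo_id: "lin_endo (\<lambda>x. x)"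
  by (simp add: lin_endo_def)

lemma lin_lin_ext: "lin f \<Longrightarrow> f (lin_ext scale \<phi> t) = lin_ext (*) (\<lambda>x. f (\<phi> x)) t"
  by (simp add: lin_ext_def linD)

lemma lin_iff_linear: "lin f \<longleftrightarrow> Vector_Spaces.linear scale (*) f"
  by (simp add: lin_def Vector_Spaces.linear_iff vector_space_axioms vector_space_mult)

lemma lin_lin_ext_mult: "lin (\<lambda>x. lin_ext (*) (\<phi> x) t)" if "\<And>y. lin (\<lambda>x. \<phi> x y)"
  unfolding lin_ext_def by (intro lin_sum lin_mult_right that)

text \<open>A basis of \<open>N\<close> is extended to a basis of the whole space; \<open>C\<close>
  consists of the added vectors and \<open>d\<close> of their coordinate functionals, so
  \<open>C\<close> lifts a basis of the quotient by \<open>N\<close>. Used with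
  \<open>N = {0}\<close> for \<open>H\<close> itself and with \<open>R^+ H\<close> for
  \<open>Q\<close>.\<close>

lemma dual_basis_mod:
  assumes "finite B" "span B = UNIV" "subspace N"
  obtains C d where "finite C" "\<And>c. lin (d c)" "\<And>c x. c \<in> C \<Longrightarrow> x \<in> N \<Longrightarrow> d c x = 0"
    "\<And>x. x - (\<Sum>c\<in>C. scale (d c x) c) \<in> N"
proof -
  obtain A where A: "A \<subseteq> N" "independent A" "N \<subseteq> span A"
    using basis_exists [of N] by metis
  have spanA: "span A = N" using A assms(3) by (simp add: span_subspace)
  define E where "E = extend_basis A"
  have E: "independent E" "A \<subseteq> E" "span E = UNIV"
    unfolding E_def using A(2)
    by (simp_all add: independent_extend_basis extend_basis_superset span_extend_basis)
  have finE: "finite E"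
    using independent_span_bound [OF assms(1) E(1)] assms(2) by simp
  define d where "d = (\<lambda>c x. representation E x c)"
  have xE: "x \<in> span E" for x using E(3) by simp
  show thesis
  proof
    show "finite (E - A)" using finE by simp
    show "lin (d c)" for c
      unfolding lin_def d_def
      using representation_add [OF E(1) xE xE] representation_scale [OF E(1) xE] by simp
    show "d c x = 0" if "c \<in> E - A" "x \<in> N" for c x
    proof -
      have "representation E x = representation A x"
        using representation_extend [OF E(1) _ E(2)] that spanA by simp
      moreover have "representation A x c = 0"
        using that representation_ne_zero [of A x c] by blast
      ultimately show ?thesis by (simp add: d_def)
    qed
    show "x - (\<Sum>c\<in>E - A. scale (d c x) c) \<in> N" for x
    proof -
      have "x = (\<Sum>c\<in>E. scale (d c x) c)"
        unfolding d_def using sum_representation_eq [OF E(1) xE finE order_refl] by simp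
      also have "\<dots> = (\<Sum>c\<in>E - A. scale (d c x) c) + (\<Sum>c\<in>A. scale (d c x) c)"
        by (rule sum.subset_diff) (fact E(2) finE)+
      finally have "x - (\<Sum>c\<in>E - A. scale (d c x) c) = (\<Sum>c\<in>A. scale (d c x) c)"
        by (simp add: algebra_simps)
      also have "\<dots> \<in> N" using A(1) assms(3) by (intro subspace_sum subspace_scale) auto
      finally show ?thesis .
    qed
  qed
qed

lemma lin_ext_multilin_span:
  assumes "vector_space sc" "multilin sc n \<Phi>"
    and "t \<in> module.span pscale (multilin_rels UNIV (+) scale n)"
  shows "lin_ext sc \<Phi> t = 0"
proof -
  interpret W: vector_space sc by fact
  have "lin_ext sc \<Phi> t \<in> {0}"
  proof (rule W.lin_ext_span_zero [OF assms(3)])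
    fix t assume "t \<in> multilin_rels UNIV (+) scale n"
    then show "lin_ext sc \<Phi> t \<in> {0}"
      using assms(2)
      by (auto simp: multilin_rels_def words_def multilin_def W.lin_ext_diff)
  qed (simp add: W.subspace_def)
  then show ?thesis by simp
qed

lemma lin_endo_mult_left: "lin_endo t \<Longrightarrow> lin_endo (\<lambda>x. t x * c)"
  by (simp add: lin_endo_def algebra_simps scale_mult_left)

lemma lin_endo_mult_right: "lin_endo t \<Longrightarrow> lin_endo (\<lambda>x. c * t x)"
  by (simp add: lin_endo_def algebra_simps scale_mult_right)

text \<open>This is what makes the choice in \<open>sweedler\<close> harmless: multilinear forms
  vanish on the relations, so any convenient representative of \<open>\<Delta> h\<close> may be used
  to evaluate them.\<close>

lemma tclass_eqD:
  assumes "vector_space sc" "multilin sc n \<Phi>" "tclass scale n f = tclass scale n g"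
    "f \<in> free_on (words UNIV n)" "g \<in> free_on (words UNIV n)"
  shows "lin_ext sc \<Phi> f = lin_ext sc \<Phi> g"
proof -
  interpret W: vector_space sc by fact
  have "f - g \<in> module.span pscale (multilin_rels UNIV (+) scale n)"
    using assms(3) unfolding tclass_def
    by (subst (asm) coset_quotient.qclass_eq_iff [OF coset_quotient_free assms(4,5)])
  from lin_ext_multilin_span [OF assms(1,2) this] show ?thesis by (simp add: W.lin_ext_diff)
qed

lemma multilin2I:
  fixes \<phi> :: "'h \<Rightarrow> 'h \<Rightarrow> 'k"
  assumes "\<And>b. lin (\<lambda>a. \<phi> a b)" "\<And>a. lin (\<phi> a)"
  shows "multilin (*) 2 (\<lambda>xs. \<phi> (xs ! 0) (xs ! 1))"
proof -
  have *: "(length xs = 0 \<and> length ys = 1) \<or> (length xs = 1 \<and> length ys = 0)"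
    if "length xs + length ys + 1 = 2" for xs ys :: "'h list"
    using that by arith
  show ?thesis
    unfolding multilin_def
    using * by (fastforce simp: length_Suc_conv linD(1,2)[OF assms(1)] linD(1,2)[OF assms(2)])
qed

lemma multilin3I:
  fixes \<phi> :: "'h \<Rightarrow> 'h \<Rightarrow> 'h \<Rightarrow> 'k"
  assumes "\<And>b c. lin (\<lambda>a. \<phi> a b c)" "\<And>a c. lin (\<lambda>b. \<phi> a b c)" "\<And>a b. lin (\<phi> a b)"
  shows "multilin (*) 3 (\<lambda>xs. \<phi> (xs ! 0) (xs ! 1) (xs ! 2))"
proof -
  have *: "(length xs = 0 \<and> length ys = 2) \<or> (length xs = 1 \<and> length ys = 1) \<or> (length xs = 2 \<and> length ys = 0)"
    if "length xs + length ys + 1 = 3" for xs ys :: "'h list"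
    using that by arith
  show ?thesis
    unfolding multilin_def
    using * by (fastforce simp: length_Suc_conv numeral_2_eq_2 linD(1,2)[OF assms(1)] linD(1,2)[OF assms(2)] linD(1,2)[OF assms(3)])
qed

end

section \<open>Sweedler sums of bilinear forms\<close>

context hopf_algebra
begin

text \<open>Scalar values and a curried form turn iterated coproducts into nested sums, and let an
  identity in a tensor power be tested one functional at a time.\<close>

definition sw :: "('h \<Rightarrow> 'h \<Rightarrow> 'k) \<Rightarrow> 'h \<Rightarrow> 'k"
  where "sw \<phi> h = lin_ext (*) (\<lambda>xs. \<phi> (xs ! 0) (xs ! 1)) (sweedler \<Delta> h)"

definition bilin :: "('h \<Rightarrow> 'h \<Rightarrow> 'k) \<Rightarrow> bool"
  where "bilin \<phi> \<longleftrightarrow> (\<forall>b. lin (\<lambda>a. \<phi> a b)) \<and> (\<forall>a. lin (\<lambda>b. \<phi> a b))"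

lemma bilinI: "(\<And>b. lin (\<lambda>a. \<phi> a b)) \<Longrightarrow> (\<And>a. lin (\<lambda>b. \<phi> a b)) \<Longrightarrow> bilin \<phi>"
  by (simp add: bilin_def)

lemma sweedler_free: "sweedler \<Delta> h \<in> free_on (words UNIV 2)"
  and tclass_sweedler: "tclass scale 2 (sweedler \<Delta> h) = \<Delta> h"
proof -
  interpret cq: coset_quotient "free_on (words UNIV 2)"
      "module.span pscale (multilin_rels UNIV (+) scale 2)"
    by (rule coset_quotient_free)
  obtain f where f: "f \<in> free_on (words UNIV 2)" "\<Delta> h = tclass scale 2 f"
    using cq.quotient_cases [OF comult_closed [of h, unfolded tpow_def]] unfolding tclass_def by metis
  have "f \<in> \<Delta> h" using cq.qclass_self [OF f(1)] f(2) by (simp add: tclass_def)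
  then have mem: "sweedler \<Delta> h \<in> \<Delta> h"
    unfolding sweedler_def by (rule someI)
  then show free: "sweedler \<Delta> h \<in> free_on (words UNIV 2)"
    using f cq.mem_qclass_iff [OF f(1)] by (auto simp: tclass_def)
  show "tclass scale 2 (sweedler \<Delta> h) = \<Delta> h"
    using mem f free cq.mem_qclass_iff [OF f(1)] cq.qclass_eq_iff [OF f(1) free]
    by (auto simp: tclass_def)
qed

lemma sweedler_keys: "xs \<in> Poly_Mapping.keys (sweedler \<Delta> h) \<Longrightarrow> xs = [xs ! 0, xs ! 1]"
  using sweedler_free [of h]
  by (auto simp: free_on_def words_def numeral_2_eq_2 length_Suc_conv dest!: subsetD)

lemma sw_eqI:
  assumes "bilin \<phi>" "\<Delta> h = tclass scale 2 f" "f \<in> free_on (words UNIV 2)"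
  shows "sw \<phi> h = lin_ext (*) (\<lambda>xs. \<phi> (xs ! 0) (xs ! 1)) f"
  unfolding sw_def
  by (rule tclass_eqD [OF vector_space_mult multilin2I])
    (use assms in \<open>auto simp: bilin_def tclass_sweedler sweedler_free\<close>)

lemma sw_add_fun: "sw (\<lambda>a b. \<phi> a b + \<psi> a b) h = sw \<phi> h + sw \<psi> h"
  by (simp add: sw_def lin_ext_def distrib_left sum.distrib)

lemma sw_cmult: "sw (\<lambda>a b. c * \<phi> a b) h = c * sw \<phi> h"
  by (simp add: sw_def lin_ext_def sum_distrib_left mult.left_commute)

lemma sw_multc: "sw (\<lambda>a b. \<phi> a b * c) h = sw \<phi> h * c"
  using sw_cmult [of c \<phi> h] by (simp add: mult.commute)

lemma sw_zero [simp]: "sw (\<lambda>a b. 0) h = 0"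
  by (simp add: sw_def lin_ext_def)

lemma sw_sum: "sw (\<lambda>a b. \<Sum>i\<in>I. \<phi> i a b) h = (\<Sum>i\<in>I. sw (\<phi> i) h)"
  by (induction I rule: infinite_finite_induct) (simp_all add: sw_add_fun)

lemma sw_commute: "sw (\<lambda>a b. sw (\<lambda>c d. \<phi> a b c d) y) x = sw (\<lambda>c d. sw (\<lambda>a b. \<phi> a b c d) x) y"
proof -
  have "sw (\<lambda>a b. sw (\<lambda>c d. \<phi> a b c d) y) x =
      (\<Sum>i\<in>Poly_Mapping.keys (sweedler \<Delta> x). \<Sum>j\<in>Poly_Mapping.keys (sweedler \<Delta> y).
        Poly_Mapping.lookup (sweedler \<Delta> y) j * (Poly_Mapping.lookup (sweedler \<Delta> x) i
          * \<phi> (i ! 0) (i ! 1) (j ! 0) (j ! 1)))"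
    by (simp add: sw_def lin_ext_def sum_distrib_left mult.left_commute)
  also have "\<dots> = sw (\<lambda>c d. sw (\<lambda>a b. \<phi> a b c d) x) y"
    by (subst sum.swap) (simp add: sw_def lin_ext_def sum_distrib_left)
  finally show ?thesis .
qed

lemma sw_add:
  assumes "bilin \<phi>"
  shows "sw \<phi> (x + y) = sw \<phi> x + sw \<phi> y"
  using sw_eqI [OF assms comult_add pm.subspace_add [OF free_on_subspace sweedler_free sweedler_free]]
  by (simp add: sw_def base_field.lin_ext_add)

lemma sw_scale:
  assumes "bilin \<phi>"
  shows "sw \<phi> (scale c x) = c * sw \<phi> x"
  using sw_eqI [OF assms comult_scale pm.subspace_scale [OF free_on_subspace sweedler_free]]
  by (simp add: sw_def base_field.lin_ext_pscale)

lemma lin_counit: "lin \<epsilon>"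
  using counit_linear by (simp add: lin_iff_linear)

lemma lin_endo_antipode: "lin_endo S"
  using antipode_linear by (simp add: lin_endo_def Vector_Spaces.linear_iff)

lemma lin_sw_fun: "(\<And>a b. lin (\<lambda>x. \<phi> x a b)) \<Longrightarrow> lin (\<lambda>x. sw (\<phi> x) h)"
  unfolding sw_def by (rule lin_lin_ext_mult)

lemma lin_sw_arg:
  "lin_endo t \<Longrightarrow> (\<And>b. lin (\<lambda>a. \<phi> a b)) \<Longrightarrow> (\<And>a. lin (\<lambda>b. \<phi> a b)) \<Longrightarrow> lin (\<lambda>x. sw \<phi> (t x))"
  unfolding lin_def [of "\<lambda>x. sw \<phi> (t x)"] lin_endo_def by (simp add: sw_add sw_scale bilinI)

lemma lin_endo_antipode_comp: "lin_endo t \<Longrightarrow> lin_endo (\<lambda>x. S (t x))"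
  using lin_endo_antipode by (simp add: lin_endo_def)

lemmas lin_endo_intros = lin_endo_mult_left lin_endo_mult_right lin_endo_antipode_comp lin_endo_id
text \<open>Closes the linearity side conditions of the Sweedler calculations. Inside a proof, the
  instances of \<open>lin_compose\<close> for the functionals at hand are added locally.\<close>

lemmas lin_intros = lin_mult_left lin_mult_right lin_sum lin_compose [OF lin_counit]
  lin_sw_fun lin_sw_arg lin_endo_intros

section \<open>The Hopf algebra axioms as scalar identities\<close>

lemma tconc_sweedler_left:
  "tconc (sweedler \<Delta> h) (Poly_Mapping.single [c] 1) =
    lin_ext pscale (\<lambda>xs. Poly_Mapping.single [xs ! 0, xs ! 1, c] 1) (sweedler \<Delta> h)"
proof -
  have "xs @ [c] = [xs ! 0, xs ! 1, c]" if "xs \<in> Poly_Mapping.keys (sweedler \<Delta> h)" for xs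
    by (subst sweedler_keys [OF that]) simp
  then have "Poly_Mapping.single (xs @ [c]) 1 = (Poly_Mapping.single [xs ! 0, xs ! 1, c] 1 :: 'h list \<Rightarrow>\<^sub>0 'k)"
    if "xs \<in> Poly_Mapping.keys (sweedler \<Delta> h)" for xs
    using that by metis
  then show ?thesis
    unfolding tconc_def by (intro lin_ext_cong) simp
qed

lemma tconc_sweedler_right:
  "tconc (Poly_Mapping.single [c] 1) (sweedler \<Delta> h) =
    lin_ext pscale (\<lambda>xs. Poly_Mapping.single [c, xs ! 0, xs ! 1] 1) (sweedler \<Delta> h)"
  unfolding tconc_def by simp (rule lin_ext_cong, use sweedler_keys in force)

text \<open>Both sides evaluate \<phi> on the three legs of the iterated coproduct; one splits the
  first leg and the other the second. Calculations with more legs apply this rule at successive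
  places, with \<open>sw_commute\<close> bringing independent sums into these shapes.\<close>

lemma sw_coassoc:
  assumes "\<And>b c. lin (\<lambda>a. \<phi> a b c)" "\<And>a c. lin (\<lambda>b. \<phi> a b c)" "\<And>a b. lin (\<lambda>c. \<phi> a b c)"
  shows "sw (\<lambda>a c. sw (\<lambda>a b. \<phi> a b c) a) h = sw (\<lambda>a b. sw (\<lambda>b c. \<phi> a b c) b) h"
proof -
  let ?l = "lin_ext pscale
          (\<lambda>xs. tconc (sweedler \<Delta> (xs ! 0)) (Poly_Mapping.single [xs ! 1] 1)) (sweedler \<Delta> h)"
  let ?r = "lin_ext pscale
          (\<lambda>xs. tconc (Poly_Mapping.single [xs ! 0] 1) (sweedler \<Delta> (xs ! 1))) (sweedler \<Delta> h)"
  let ?F = "\<lambda>xs. \<phi> (xs ! 0) (xs ! 1) (xs ! 2)"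
  have [simp]: "Poly_Mapping.single [a, b, c] 1 \<in> free_on (words UNIV 3)" for a b c :: 'h
    by (rule single_in_free_on) (simp add: words_def)
  have "lin_ext (*) ?F ?l = lin_ext (*) ?F ?r"
  proof (rule tclass_eqD [OF vector_space_mult multilin3I coassoc])
    show "?l \<in> free_on (words UNIV 3)" "?r \<in> free_on (words UNIV 3)"
      by (simp_all add: tconc_sweedler_left tconc_sweedler_right pm.lin_ext_in_subspace free_on_subspace)
  qed (fact assms)+
  then show ?thesis
    by (simp add: tconc_sweedler_left tconc_sweedler_right base_field.lin_ext_lin_ext sw_def)
qed

lemma sw_counit_left: "lin \<phi> \<Longrightarrow> sw (\<lambda>a b. \<epsilon> a * \<phi> b) h = \<phi> h"
  using arg_cong [OF counit_left [of h], of \<phi>] by (simp add: lin_lin_ext linD(2) sw_def)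

lemma sw_counit_right: "lin \<phi> \<Longrightarrow> sw (\<lambda>a b. \<epsilon> b * \<phi> a) h = \<phi> h"
  using arg_cong [OF counit_right [of h], of \<phi>] by (simp add: lin_lin_ext linD(2) sw_def)

lemma sw_antipode_left: "lin \<phi> \<Longrightarrow> sw (\<lambda>a b. \<phi> (S a * b)) h = \<epsilon> h * \<phi> 1"
  using arg_cong [OF antipode_left [of h], of \<phi>] by (simp add: lin_lin_ext linD(2) sw_def)

lemma sw_antipode_right: "lin \<phi> \<Longrightarrow> sw (\<lambda>a b. \<phi> (a * S b)) h = \<epsilon> h * \<phi> 1"
  using arg_cong [OF antipode_right [of h], of \<phi>] by (simp add: lin_lin_ext linD(2) sw_def)

lemma sw_one: "bilin \<phi> \<Longrightarrow> sw \<phi> 1 = \<phi> 1 1"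
  using sw_eqI [OF _ comult_one single_in_free_on] by (simp add: words_def)

lemma tmult_sweedler:
  "tmult (sweedler \<Delta> x) (sweedler \<Delta> y) =
    lin_ext pscale (\<lambda>xs. lin_ext pscale
      (\<lambda>ys. Poly_Mapping.single [xs ! 0 * ys ! 0, xs ! 1 * ys ! 1] 1) (sweedler \<Delta> y)) (sweedler \<Delta> x)"
  unfolding tmult_def
proof (intro lin_ext_cong)
  fix xs ys
  assume "xs \<in> Poly_Mapping.keys (sweedler \<Delta> x)" "ys \<in> Poly_Mapping.keys (sweedler \<Delta> y)"
  then have "map2 (*) xs ys = map2 (*) [xs ! 0, xs ! 1] [ys ! 0, ys ! 1]"
    using sweedler_keys by metis
  then show "Poly_Mapping.single (map2 (*) xs ys) 1 =
      (Poly_Mapping.single [xs ! 0 * ys ! 0, xs ! 1 * ys ! 1] 1 :: 'h list \<Rightarrow>\<^sub>0 'k)" by simp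
qed

lemma sw_mult:
  assumes "bilin \<phi>"
  shows "sw \<phi> (x * y) = sw (\<lambda>a b. sw (\<lambda>c d. \<phi> (a * c) (b * d)) y) x"
proof -
  have [simp]: "Poly_Mapping.single [a, b] 1 \<in> free_on (words UNIV 2)" for a b :: 'h
    by (rule single_in_free_on) (simp add: words_def)
  have "tmult (sweedler \<Delta> x) (sweedler \<Delta> y) \<in> free_on (words UNIV 2)"
    unfolding tmult_sweedler by (intro pm.lin_ext_in_subspace free_on_subspace) simp
  from sw_eqI [OF assms comult_mult this] show ?thesis
    by (simp add: tmult_sweedler base_field.lin_ext_lin_ext sw_def)
qed

end

section \<open>The antipode\<close>

text \<open>The way back from scalars to vectors: coordinates with respect to a basis are linear
  functionals, and they determine a vector.\<close>

lemma (in unital_algebra) eq_from_functionals: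
  assumes "finite_dimensional scale" "\<And>f. lin f \<Longrightarrow> f x = f y"
  shows "x = y"
proof -
  obtain B where B: "finite B" "span B = UNIV" using assms(1) by (auto simp: finite_dimensional_def)
  obtain C d where C: "\<And>c. lin (d c)" "\<And>x. x - (\<Sum>c\<in>C. scale (d c x) c) \<in> {0}"
    using dual_basis_mod [OF B subspace_single_0] by metis
  have "x = (\<Sum>c\<in>C. scale (d c x) c)" using C(2)[of x] by simp
  also have "\<dots> = (\<Sum>c\<in>C. scale (d c y) c)"
    using assms(2) [OF C(1)] by simp
  also have "\<dots> = y" using C(2)[of y] by simp
  finally show ?thesis .
qed

context hopf_algebra
begin

lemma antipode_one: "S 1 = 1"
proof -
  \<comment> \<open>The form takes values in \<open>H\<close>; on the representative
    \<open>[1, 1]\<close> of \<open>\<Delta> 1\<close> the antipode law reads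
    \<open>S 1 * 1 = 1\<close>.\<close>
  have "multilin scale 2 (\<lambda>xs. S (xs ! 0) * xs ! 1)"
  proof -
    have "(length xs = 0 \<and> length ys = 1) \<or> (length xs = 1 \<and> length ys = 0)"
      if "length xs + length ys + 1 = 2" for xs ys :: "'h list"
      using that by arith
    then show ?thesis
      unfolding multilin_def using lin_endo_antipode
      by (fastforce simp: length_Suc_conv lin_endo_def algebra_simps scale_mult_left scale_mult_right)
  qed
  then have "lin_ext scale (\<lambda>xs. S (xs ! 0) * xs ! 1) (sweedler \<Delta> 1) =
      lin_ext scale (\<lambda>xs. S (xs ! 0) * xs ! 1) (Poly_Mapping.single [1, 1] 1)"
    by (rule tclass_eqD [OF vector_space_axioms])
      (simp_all add: tclass_sweedler comult_one sweedler_free, simp add: single_in_free_on words_def)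
  then show ?thesis using antipode_left [of 1] by (simp add: counit_one)
qed

lemma counit_antipode: "\<epsilon> (S h) = \<epsilon> h"
proof -
  have "\<epsilon> h = sw (\<lambda>a b. \<epsilon> (S a * b)) h"
    using sw_antipode_left [OF lin_counit, of h] by (simp add: counit_one)
  also have "\<dots> = sw (\<lambda>a b. \<epsilon> b * \<epsilon> (S a)) h" by (simp add: counit_mult mult.commute)
  also have "\<dots> = \<epsilon> (S h)"
    by (rule sw_counit_right) (intro lin_intros)
  finally show ?thesis by simp
qed

text \<open>Uniqueness of convolution inverses: among linear maps from H \<otimes> H to H, the map x
  \<otimes> y \<mapsto> S(xy) is a left inverse of the multiplication and x \<otimes> y \<mapsto>
  S(y) S(x) is a right inverse. \<open>?T\<close> is the convolution of all three, tested by
  \<open>f\<close>; its two bracketings give the two sides.\<close>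

lemma lin_antipode_mult:
  assumes f: "lin f"
  shows "f (S (x * y)) = f (S y * S x)"
proof -
  note intros = lin_intros lin_compose [OF f]
  let ?T = "sw (\<lambda>x1 x'. sw (\<lambda>y1 y'. sw (\<lambda>x2 x3. sw (\<lambda>y2 y3.
      f (S (x1 * y1) * (x2 * y2) * (S y3 * S x3))) y') x') y) x"
  \<comment> \<open>Right bracketing: \<open>y2 * S y3\<close> collapses first, which brings
    \<open>x2\<close> next to \<open>S x3\<close>.\<close>
  have "sw (\<lambda>x2 x3. sw (\<lambda>y2 y3. f (u * (x2 * y2) * (S y3 * S x3))) y') x' = f u * \<epsilon> y' * \<epsilon> x'"
    for u x' y'
  proof -
    have "sw (\<lambda>y2 y3. f (u * (x2 * y2) * (S y3 * S x3))) y' = \<epsilon> y' * f (u * x2 * S x3)" for x2 x3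
    proof -
      have "lin (\<lambda>z. f (u * x2 * z * S x3))" by (intro intros)
      from sw_antipode_right [OF this, of y'] show ?thesis by (simp add: mult.assoc)
    qed
    then have "sw (\<lambda>x2 x3. sw (\<lambda>y2 y3. f (u * (x2 * y2) * (S y3 * S x3))) y') x'
        = \<epsilon> y' * sw (\<lambda>x2 x3. f (u * (x2 * S x3))) x'"
      by (simp add: sw_cmult mult.assoc)
    also have "\<dots> = \<epsilon> y' * (\<epsilon> x' * f (u * 1))"
      by (subst sw_antipode_right) (intro intros | simp)+
    finally show ?thesis by (simp add: algebra_simps)
  qed
  then have "?T = sw (\<lambda>x1 x'. sw (\<lambda>y1 y'. \<epsilon> y' * f (S (x1 * y1)) * \<epsilon> x') y) x"
    by (simp add: algebra_simps)
  also have "\<dots> = sw (\<lambda>x1 x'. \<epsilon> x' * f (S (x1 * y))) x"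
    by (simp only: sw_multc, subst sw_counit_right) (intro intros | simp add: mult.commute)+
  also have "\<dots> = f (S (x * y))"
    by (subst sw_counit_right) (intro intros | simp)+
  finally have 1: "?T = f (S (x * y))" .
  \<comment> \<open>Left bracketing: the first two legs of \<open>x\<close> and of \<open>y\<close>
    are regrouped into \<open>x'\<close> and \<open>y'\<close>, so that
    \<open>S (x1 * y1) * (x2 * y2)\<close> collapses by the antipode law for
    \<open>x' * y'\<close>.\<close>
  have "?T = sw (\<lambda>x1 x'. sw (\<lambda>x2 x3. sw (\<lambda>y1 y'. sw (\<lambda>y2 y3.
      f (S (x1 * y1) * (x2 * y2) * (S y3 * S x3))) y') y) x') x"
    by (subst sw_commute) (rule refl)
  also have "\<dots> = sw (\<lambda>x' x3. sw (\<lambda>x1 x2. sw (\<lambda>y1 y'. sw (\<lambda>y2 y3.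
      f (S (x1 * y1) * (x2 * y2) * (S y3 * S x3))) y') y) x') x"
    by (rule sw_coassoc [symmetric]) (intro intros)+
  also have "\<dots> = sw (\<lambda>x' x3. sw (\<lambda>x1 x2. sw (\<lambda>y' y3. sw (\<lambda>y1 y2.
      f (S (x1 * y1) * (x2 * y2) * (S y3 * S x3))) y') y) x') x"
    by (subst sw_coassoc [symmetric]) (intro intros refl)+
  also have "\<dots> = sw (\<lambda>x' x3. sw (\<lambda>y' y3. sw (\<lambda>x1 x2. sw (\<lambda>y1 y2.
      f (S (x1 * y1) * (x2 * y2) * (S y3 * S x3))) y') x') y) x"
    by (subst sw_commute) (rule refl)
  also have "\<dots> = sw (\<lambda>x' x3. sw (\<lambda>y' y3. \<epsilon> (x' * y') * f (S y3 * S x3)) y) x"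
  proof -
    have "sw (\<lambda>x1 x2. sw (\<lambda>y1 y2. f (S (x1 * y1) * (x2 * y2) * (S y3 * S x3))) y') x' =
        \<epsilon> (x' * y') * f (S y3 * S x3)" for x' x3 y' y3
    proof -
      have "lin (\<lambda>z. f (z * (S y3 * S x3)))" by (intro intros)
      from sw_antipode_left [OF this, of "x' * y'"] show ?thesis
        by (subst (asm) sw_mult) (intro bilinI intros | simp)+
    qed
    then show ?thesis by simp
  qed
  also have "\<dots> = sw (\<lambda>x' x3. \<epsilon> x' * sw (\<lambda>y' y3. \<epsilon> y' * f (S y3 * S x3)) y) x"
    by (simp add: counit_mult mult.assoc sw_cmult)
  also have "\<dots> = f (S y * S x)"
    by (subst sw_counit_left, intro intros)+ simp
  finally show ?thesis using 1 by simp
qed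

text \<open>Again uniqueness of convolution inverses, now among maps from H to H \<otimes> H: the
  coproduct has h \<mapsto> \<Delta>(S h) as a right inverse and h \<mapsto> S(h2) \<otimes> S(h1)
  as a left inverse. \<open>?T\<close> is the triple convolution.\<close>

lemma sw_antipode:
  assumes "bilin \<phi>"
  shows "sw \<phi> (S h) = sw (\<lambda>p q. \<phi> (S q) (S p)) h"
proof -
  have \<phi>1: "lin (\<lambda>a. \<phi> a b)" and \<phi>2: "lin (\<lambda>b. \<phi> a b)" for a b
    using assms by (simp_all add: bilin_def)
  note intros = lin_intros lin_compose [OF \<phi>1] lin_compose [OF \<phi>2]
  let ?T = "sw (\<lambda>a b. sw (\<lambda>b1 b2. sw (\<lambda>p q. sw (\<lambda>u v. sw (\<lambda>s t.
      \<phi> (S q * u * s) (S p * v * t)) (S b2)) b1) a) b) h"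
  have "sw (\<lambda>b1 b2. sw (\<lambda>p q. sw (\<lambda>u v. sw (\<lambda>s t.
      \<phi> (S q * u * s) (S p * v * t)) (S b2)) b1) a) b = \<epsilon> b * sw (\<lambda>p q. \<phi> (S q) (S p)) a" for a b
  proof -
    have "sw (\<lambda>b1 b2. sw (\<lambda>u v. sw (\<lambda>s t. \<phi> (S q * u * s) (S p * v * t)) (S b2)) b1) b
        = \<epsilon> b * \<phi> (S q) (S p)" for p q
    proof -
      have bil: "bilin (\<lambda>y z. \<phi> (S q * y) (S p * z))" by (intro bilinI intros)
      have "sw (\<lambda>b1 b2. sw (\<lambda>u v. sw (\<lambda>s t. \<phi> (S q * u * s) (S p * v * t)) (S b2)) b1) b
          = sw (\<lambda>b1 b2. sw (\<lambda>y z. \<phi> (S q * y) (S p * z)) (b1 * S b2)) b"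
        by (subst sw_mult [OF bil]) (simp add: mult.assoc)
      also have "\<dots> = \<epsilon> b * sw (\<lambda>y z. \<phi> (S q * y) (S p * z)) 1"
        by (rule sw_antipode_right) (intro intros)
      also have "\<dots> = \<epsilon> b * \<phi> (S q) (S p)" by (simp add: sw_one [OF bil])
      finally show ?thesis .
    qed
    then show ?thesis by (subst sw_commute) (simp add: sw_cmult)
  qed
  then have "?T = sw (\<lambda>a b. \<epsilon> b * sw (\<lambda>p q. \<phi> (S q) (S p)) a) h" by simp
  also have "\<dots> = sw (\<lambda>p q. \<phi> (S q) (S p)) h"
    by (rule sw_counit_right) (intro intros)
  finally have 1: "?T = sw (\<lambda>p q. \<phi> (S q) (S p)) h" .
  \<comment> \<open>The left inverse property: with c1, ..., c4 the legs of \<open>c\<close>, S(c2)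
    c3 \<otimes> S(c1) c4 collapses from the inside, since cancelling c2 against c3 leaves S(c1)
    next to c4.\<close>
  have 2: "sw (\<lambda>a b1. sw (\<lambda>p q. sw (\<lambda>u v. \<chi> (S q * u) (S p * v)) b1) a) c = \<epsilon> c * \<chi> 1 1"
    if \<chi>1: "\<And>b. lin (\<lambda>a. \<chi> a b)" and \<chi>2: "\<And>a. lin (\<lambda>b. \<chi> a b)" for \<chi> c
  proof -
    note intros = lin_intros lin_compose [OF \<chi>1] lin_compose [OF \<chi>2]
    have "sw (\<lambda>a b1. sw (\<lambda>p q. sw (\<lambda>u v. \<chi> (S q * u) (S p * v)) b1) a) c =
        sw (\<lambda>p w. sw (\<lambda>q b1. sw (\<lambda>u v. \<chi> (S q * u) (S p * v)) b1) w) c"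
      by (rule sw_coassoc) (intro intros)+
    also have "\<dots> = sw (\<lambda>p w. sw (\<lambda>d v. sw (\<lambda>q u. \<chi> (S q * u) (S p * v)) d) w) c"
      by (subst sw_coassoc) (intro intros refl)+
    also have "\<dots> = sw (\<lambda>p w. sw (\<lambda>d v. \<epsilon> d * \<chi> 1 (S p * v)) w) c"
      by (subst sw_antipode_left [OF \<chi>1]) (rule refl)
    also have "\<dots> = sw (\<lambda>p w. \<chi> 1 (S p * w)) c"
      by (subst sw_counit_left) (intro intros refl)+
    also have "\<dots> = \<epsilon> c * \<chi> 1 1"
      by (rule sw_antipode_left [OF \<chi>2])
    finally show ?thesis .
  qed
  have "?T = sw (\<lambda>c b2. sw (\<lambda>a b1. sw (\<lambda>p q. sw (\<lambda>u v. sw (\<lambda>s t.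
      \<phi> (S q * u * s) (S p * v * t)) (S b2)) b1) a) c) h"
    by (rule sw_coassoc [symmetric]) (intro intros)+
  also have "\<dots> = sw (\<lambda>c b2. \<epsilon> c * sw \<phi> (S b2)) h"
  proof -
    have "sw (\<lambda>a b1. sw (\<lambda>p q. sw (\<lambda>u v. sw (\<lambda>s t.
      \<phi> (S q * u * s) (S p * v * t)) (S b2)) b1) a) c = \<epsilon> c * sw (\<lambda>s t. \<phi> (1 * s) (1 * t)) (S b2)" for c b2
      by (rule 2) (intro intros)+
    then show ?thesis by simp
  qed
  also have "\<dots> = sw \<phi> (S h)"
    by (rule sw_counit_left) (intro intros \<phi>1 \<phi>2)
  finally show ?thesis using 1 by simp
qed

lemma antipode_mult:
  assumes "finite_dimensional scale"
  shows "S (x * y) = S y * S x"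
  using eq_from_functionals [OF assms lin_antipode_mult] .

end

section \<open>Integrals and bijectivity of the antipode\<close>

locale findim_hopf_algebra = hopf_algebra scale \<Delta> \<epsilon> S
  for scale :: "'k::field \<Rightarrow> 'h::ring_1 \<Rightarrow> 'h"
    and \<Delta> :: "'h \<Rightarrow> ('h list \<Rightarrow>\<^sub>0 'k) set"
    and \<epsilon> :: "'h \<Rightarrow> 'k"
    and S :: "'h \<Rightarrow> 'h" +
  assumes fd: "finite_dimensional scale"
begin

lemmas S_mult = antipode_mult [OF fd]

text \<open>A left integral in the dual Hopf algebra, whose product is convolution and whose counit
  is g \<mapsto> g(1). Since \<open>g\<close> is arbitrary, the condition says that the sum of l(x2)
  x1 equals l(x) 1.\<close>

definition left_integral :: "('h \<Rightarrow> 'k) \<Rightarrow> bool"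
  where "left_integral l \<longleftrightarrow> lin l \<and>
    (\<forall>g x. lin g \<longrightarrow> sw (\<lambda>a b. g a * l b) x = g 1 * l x)"

text \<open>The Hopf module compatibility for the dual space, on which \<open>h\<close> acts by
  \<open>(f \<cdot> h) x = f (x * S h)\<close>.\<close>

lemma sw_dual_action:
  assumes g: "lin g" and F: "lin F"
  shows "sw (\<lambda>a b. g a * F (b * S h)) x =
    sw (\<lambda>h1 h2. sw (\<lambda>a b. g (a * h2) * F b) (x * S h1)) h"
proof -
  note intros = lin_intros lin_compose [OF g] lin_compose [OF F]
  \<comment> \<open>The antipode swaps the legs of \<open>h1\<close>: the second one,
    \<open>q\<close>, ends up beside \<open>h2\<close>, where \<open>S q * h2\<close> collapses,
    while \<open>S p\<close> stays with \<open>b\<close>.\<close>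
  have "sw (\<lambda>h1 h2. sw (\<lambda>a b. g (a * h2) * F b) (x * S h1)) h =
      sw (\<lambda>h1 h2. sw (\<lambda>a b. sw (\<lambda>p q. g (a * S q * h2) * F (b * S p)) h1) x) h"
    by (subst sw_mult, intro bilinI intros, subst sw_antipode, intro bilinI intros, rule refl)
  also have "\<dots> = sw (\<lambda>a b. sw (\<lambda>h1 h2. sw (\<lambda>p q. g (a * S q * h2) * F (b * S p)) h1) h) x"
    by (rule sw_commute)
  also have "\<dots> = sw (\<lambda>a b. sw (\<lambda>p w. sw (\<lambda>q h2. g (a * S q * h2) * F (b * S p)) w) h) x"
    by (subst sw_coassoc) (intro intros refl)+
  also have "\<dots> = sw (\<lambda>a b. sw (\<lambda>p w. \<epsilon> w * (g a * F (b * S p))) h) x"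
  proof -
    have "sw (\<lambda>q h2. g (a * S q * h2)) w = \<epsilon> w * g a" for a w
      using sw_antipode_left [of "\<lambda>z. g (a * z)" w] by (simp add: mult.assoc lin_compose [OF g] lin_endo_intros)
    then show ?thesis by (simp add: sw_multc mult.assoc)
  qed
  also have "\<dots> = sw (\<lambda>a b. g a * F (b * S h)) x"
    by (subst sw_counit_right) (intro intros refl)+
  finally show ?thesis by simp
qed

lemma dual_basis:
  obtains E d where "finite E" "\<And>c. lin (d c)"
    "\<And>f x. lin f \<Longrightarrow> (\<Sum>i\<in>E. d i x * f i) = f x"
proof -
  obtain B where B: "finite B" "span B = UNIV" using fd by (auto simp: finite_dimensional_def)
  obtain E d where E: "finite E" "\<And>c. lin (d c)" "\<And>x. x - (\<Sum>c\<in>E. scale (d c x) c) \<in> {0}"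
    using dual_basis_mod [OF B subspace_single_0] by metis
  have "(\<Sum>i\<in>E. d i x * f i) = f x" if "lin f" for f x
  proof -
    have "f x = f (\<Sum>c\<in>E. scale (d c x) c)" using E(3) [of x] by simp
    then show ?thesis by (simp add: linD(2,6) [OF that])
  qed
  with E that show thesis by blast
qed

text \<open>Since \<open>\<Sum> l (x * S h\<^sub>1) * g h\<^sub>2 = \<Sum> g x\<^sub>1 * l (x\<^sub>2 * S h)\<close>, the left side vanishes when \<open>S h = 0\<close>;
  replacing \<open>x\<close> by \<open>x * S (S h\<^sub>2)\<close> collapses it to \<open>l x * g h\<close>.\<close>

lemma left_integral_cancel:
  assumes l: "left_integral l" and "l x \<noteq> 0" and Sh: "S h = 0"
  shows "h = 0"
proof (rule eq_from_functionals [OF fd])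
  fix g assume g: "lin g"
  have linl: "lin l" and int: "\<And>g x. lin g \<Longrightarrow> sw (\<lambda>a b. g a * l b) x = g 1 * l x"
    using l by (simp_all add: left_integral_def)
  note intros = lin_intros lin_compose [OF linl]
  have *: "sw (\<lambda>h1 h2. l (x * S h1) * g h2) h = 0" if g: "lin g" for g x
  proof -
    have "sw (\<lambda>h1 h2. l (x * S h1) * g h2) h = sw (\<lambda>h1 h2. sw (\<lambda>a b. g (a * h2) * l b) (x * S h1)) h"
      by (subst int) (intro lin_compose [OF g] lin_endo_intros | simp add: mult.commute)+
    also have "\<dots> = sw (\<lambda>a b. g a * l (b * S h)) x"
      by (rule sw_dual_action [OF g linl, symmetric])
    also have "\<dots> = 0" by (simp add: Sh linD(3) [OF linl])
    finally show ?thesis .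
  qed
  obtain E d where E: "finite E" "\<And>c. lin (d c)" and
    expand: "\<And>f x. lin f \<Longrightarrow> (\<Sum>i\<in>E. d i x * f i) = f x"
    using dual_basis by metis
  \<comment> \<open>Fact \<open>*\<close> holds at a fixed argument, whereas
    \<open>x * S (S b1)\<close> varies inside a Sweedler sum. The dual basis replaces it by the
    fixed vectors \<open>i\<close> with scalar coefficients that can be moved into the functional in
    the place of \<open>g\<close>.\<close>
  have "0 = (\<Sum>i\<in>E. sw (\<lambda>h1 b. l (i * S h1) * sw (\<lambda>b1 b2. d i (x * S (S b1)) * g b2) b) h)"
    by (intro sum.neutral [symmetric] ballI *) (intro intros lin_compose [OF E(2)] lin_compose [OF g])
  also have "\<dots> = sw (\<lambda>h1 b. sw (\<lambda>b1 b2. (\<Sum>i\<in>E. d i (x * S (S b1)) * l (i * S h1)) * g b2) b) h"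
    by (simp add: sw_sum sw_cmult [symmetric] sum_distrib_left sum_distrib_right mult_ac)
  also have "\<dots> = sw (\<lambda>h1 b. sw (\<lambda>b1 b2. l (x * S (S b1) * S h1) * g b2) b) h"
  proof -
    have "(\<Sum>i\<in>E. d i z * l (i * S h1)) = l (z * S h1)" for z h1
      using expand [of "\<lambda>z. l (z * S h1)" z] by (simp add: intros)
    then show ?thesis by simp
  qed
  also have "\<dots> = sw (\<lambda>c b2. sw (\<lambda>h1 b1. l (x * S (S b1) * S h1) * g b2) c) h"
    by (rule sw_coassoc [symmetric]) (intro intros lin_compose [OF g])+
  also have "\<dots> = sw (\<lambda>c b2. sw (\<lambda>h1 b1. l (x * S (h1 * S b1))) c * g b2) h"
    by (simp add: S_mult sw_multc mult.assoc)
  also have "\<dots> = sw (\<lambda>c b2. \<epsilon> c * (l x * g b2)) h"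
    by (subst sw_antipode_right) (intro intros | simp add: antipode_one mult.assoc)+
  also have "\<dots> = l x * g h"
    by (rule sw_counit_left) (intro intros g)
  finally show "g h = g 0" using assms(2) by (simp add: linD(3) [OF g])
qed

text \<open>In the Hopf module \<open>M = H\<^sup>*\<close>, the projection \<open>m \<mapsto> m\<^sub>0 \<cdot> S m\<^sub>1\<close> onto the coinvariants, which
  are the left integrals, is \<open>f \<mapsto> P f\<close> below. It cannot vanish identically, because
  \<open>m = (m\<^sub>0 \<cdot> S m\<^sub>1) \<cdot> m\<^sub>2\<close>.\<close>

lemma ex_left_integral: "\<exists>l x. left_integral l \<and> l x \<noteq> 0"
proof (rule ccontr)
  assume no: "\<not> ?thesis"
  obtain E d where E: "finite E" "\<And>c. lin (d c)" and
    expand: "\<And>f x. lin f \<Longrightarrow> (\<Sum>i\<in>E. d i x * f i) = f x"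
    using dual_basis by metis
  note intros = lin_intros lin_compose [OF E(2)]
  \<comment> \<open>The coaction dual to left convolution sends \<open>f\<close> to the sum over the
    basis of (\<open>d i\<close> convolved with \<open>f\<close>) \<otimes> \<open>i\<close>; acting
    by \<open>S i\<close> multiplies the argument by \<open>S (S i)\<close>.\<close>
  define P where "P = (\<lambda>f x. \<Sum>i\<in>E. sw (\<lambda>a b. d i a * f b) (x * S (S i)))"
  have linP: "lin (P f)" if f: "lin f" for f
    unfolding P_def by (intro intros lin_compose [OF f])
  have "left_integral (P f)" if f: "lin f" for f
    unfolding left_integral_def
  proof (intro conjI allI impI linP [OF f])
    fix g x assume g: "lin g"
    note intros = intros lin_compose [OF f] lin_compose [OF g]
    have "sw (\<lambda>a b. g a * P f b) x
        = (\<Sum>i\<in>E. sw (\<lambda>a b. g a * sw (\<lambda>u v. d i u * f v) (b * S (S i))) x)"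
      by (simp add: P_def sum_distrib_left sw_sum)
    also have "\<dots> = (\<Sum>i\<in>E. sw (\<lambda>h1 h2. sw (\<lambda>a b. g (a * h2) * sw (\<lambda>u v. d i u * f v) b) (x * S h1)) (S i))"
      by (intro sum.cong refl sw_dual_action g intros)
    also have "\<dots> = (\<Sum>i\<in>E. sw (\<lambda>p q. sw (\<lambda>a b. g (a * S p) * sw (\<lambda>u v. d i u * f v) b) (x * S (S q))) i)"
      by (intro sum.cong refl sw_antipode bilinI intros)
    \<comment> \<open>The dependence on \<open>q\<close> is expanded in the basis, so that the
      argument \<open>x * S (S j)\<close> is independent of \<open>i\<close> and the sum over
      \<open>i\<close> can be evaluated at \<open>u\<close>.\<close>
    also have "\<dots> = (\<Sum>i\<in>E. sw (\<lambda>p q. (\<Sum>j\<in>E. d j q * sw (\<lambda>a b. g (a * S p) * sw (\<lambda>u v. d i u * f v) b) (x * S (S j)))) i)"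
      by (subst expand) (intro intros refl)+
    also have "\<dots> = (\<Sum>j\<in>E. sw (\<lambda>a b. sw (\<lambda>u v. f v * (\<Sum>i\<in>E. d i u * sw (\<lambda>p q. d j q * g (a * S p)) i)) b) (x * S (S j)))"
    proof -
      have "sw (\<lambda>p q. d j q * sw (\<lambda>a b. g (a * S p) * sw (\<lambda>u v. d i u * f v) b) y) i =
          sw (\<lambda>a b. sw (\<lambda>u v. f v * (d i u * sw (\<lambda>p q. d j q * g (a * S p)) i)) b) y" for i j y
      proof -
        have "sw (\<lambda>p q. d j q * sw (\<lambda>a b. g (a * S p) * sw (\<lambda>u v. d i u * f v) b) y) i =
            sw (\<lambda>p q. sw (\<lambda>a b. d j q * g (a * S p) * sw (\<lambda>u v. d i u * f v) b) y) i"
          by (simp add: sw_cmult mult.assoc)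
        also have "\<dots> = sw (\<lambda>a b. sw (\<lambda>p q. d j q * g (a * S p) * sw (\<lambda>u v. d i u * f v) b) i) y"
          by (rule sw_commute)
        also have "\<dots> = sw (\<lambda>a b. sw (\<lambda>p q. sw (\<lambda>u v. f v * (d i u * (d j q * g (a * S p)))) b) i) y"
          by (simp add: sw_cmult [symmetric] mult_ac)
        also have "\<dots> = sw (\<lambda>a b. sw (\<lambda>u v. sw (\<lambda>p q. f v * (d i u * (d j q * g (a * S p)))) i) b) y"
          by (subst sw_commute) (rule refl)
        also have "\<dots> = sw (\<lambda>a b. sw (\<lambda>u v. f v * (d i u * sw (\<lambda>p q. d j q * g (a * S p)) i)) b) y"
          by (simp only: sw_cmult)
        finally show ?thesis .
      qed
      then show ?thesis
        by (simp add: sw_sum sum_distrib_left) (rule sum.swap)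
    qed
    also have "\<dots> = (\<Sum>j\<in>E. sw (\<lambda>a b. sw (\<lambda>u v. sw (\<lambda>p q. f v * (d j q * g (a * S p))) u) b) (x * S (S j)))"
      by (subst expand) (intro intros | simp add: sw_cmult)+
    also have "\<dots> = (\<Sum>j\<in>E. sw (\<lambda>a b. sw (\<lambda>p w. sw (\<lambda>q v. f v * (d j q * g (a * S p))) w) b) (x * S (S j)))"
      by (subst sw_coassoc) (intro intros refl)+
    also have "\<dots> = (\<Sum>j\<in>E. sw (\<lambda>c w. sw (\<lambda>a p. sw (\<lambda>q v. f v * (d j q * g (a * S p))) w) c) (x * S (S j)))"
      by (subst sw_coassoc) (intro intros refl)+
    also have "\<dots> = (\<Sum>j\<in>E. sw (\<lambda>c w. \<epsilon> c * (sw (\<lambda>q v. f v * (d j q * g 1)) w)) (x * S (S j)))"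
      by (subst sw_antipode_right) (intro intros refl)+
    also have "\<dots> = (\<Sum>j\<in>E. sw (\<lambda>q v. f v * (d j q * g 1)) (x * S (S j)))"
      by (subst sw_counit_left) (intro intros refl)+
    also have "\<dots> = g 1 * P f x"
      by (simp add: P_def sum_distrib_left sw_cmult [symmetric] mult_ac)
    finally show "sw (\<lambda>a b. g a * P f b) x = g 1 * P f x" .
  qed
  then have P0: "P f x = 0" if "lin f" for f x using no that by blast
  \<comment> \<open>The reconstruction formula of the Hopf module for the element \<epsilon> writes
    \<epsilon>(x) as a sum of values of \<open>P\<close>, all of which vanish. This is absurd at
    \<open>x = 1\<close>.\<close>
  have "\<epsilon> x = 0" for x
  proof -
    note intros = intros lin_counit
    have "\<epsilon> x = sw (\<lambda>c v. \<epsilon> c * \<epsilon> v) x"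
      by (rule sw_counit_left [symmetric]) (intro intros)
    also have "\<dots> = sw (\<lambda>c v. (\<Sum>l\<in>E. d l c * \<epsilon> l) * \<epsilon> v) x"
      by (subst expand) (intro intros refl)+
    also have "\<dots> = (\<Sum>l\<in>E. \<epsilon> l * sw (\<lambda>c v. d l c * \<epsilon> v) x)"
      by (simp add: sum_distrib_left sum_distrib_right sw_sum sw_cmult [symmetric] mult_ac)
    \<comment> \<open>The antipode law read backwards: \<open>\<epsilon> l\<close> is the collapse
      of \<open>S p * q\<close> over the legs of \<open>l\<close>, and \<open>S 1 = 1\<close> turns
      \<open>x * S 1\<close> into \<open>x\<close>.\<close>
    also have "\<dots> = (\<Sum>l\<in>E. sw (\<lambda>p q. sw (\<lambda>c v. d l c * \<epsilon> v) (x * S (S p * q))) l)"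
      by (subst sw_antipode_left) (intro intros | simp add: antipode_one)+
    also have "\<dots> = (\<Sum>l\<in>E. sw (\<lambda>p q. \<Sum>i\<in>E. \<Sum>j\<in>E. d i p * d j q * sw (\<lambda>c v. d l c * \<epsilon> v) (x * S (S i * j))) l)"
    proof -
      have "(\<Sum>i\<in>E. \<Sum>j\<in>E. d i p * d j q * sw (\<lambda>c v. d l c * \<epsilon> v) (x * S (S i * j))) =
          sw (\<lambda>c v. d l c * \<epsilon> v) (x * S (S p * q))" for l p q
      proof -
        have "(\<Sum>i\<in>E. \<Sum>j\<in>E. d i p * d j q * sw (\<lambda>c v. d l c * \<epsilon> v) (x * S (S i * j))) =
            (\<Sum>i\<in>E. d i p * (\<Sum>j\<in>E. d j q * sw (\<lambda>c v. d l c * \<epsilon> v) (x * S (S i * j))))"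
          by (simp add: sum_distrib_left mult.assoc)
        also have "\<dots> = (\<Sum>i\<in>E. d i p * sw (\<lambda>c v. d l c * \<epsilon> v) (x * S (S i * q)))"
          by (subst expand) (intro intros refl)+
        also have "\<dots> = sw (\<lambda>c v. d l c * \<epsilon> v) (x * S (S p * q))"
          by (rule expand) (intro intros)
        finally show ?thesis .
      qed
      then show ?thesis by simp
    qed
    also have "\<dots> = (\<Sum>l\<in>E. \<Sum>i\<in>E. \<Sum>j\<in>E. sw (\<lambda>c v. \<epsilon> v * (d l c * sw (\<lambda>p q. d i p * d j q) l)) (x * S (S i * j)))"
    proof -
      have "sw (\<lambda>p q. d i p * d j q * sw (\<lambda>c v. d l c * \<epsilon> v) y) l =
          sw (\<lambda>c v. \<epsilon> v * (d l c * sw (\<lambda>p q. d i p * d j q) l)) y" for i j l y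
        by (simp add: sw_cmult [symmetric] mult_ac) (rule sw_commute)
      then show ?thesis by (simp add: sw_sum)
    qed
    also have "\<dots> = (\<Sum>i\<in>E. \<Sum>l\<in>E. \<Sum>j\<in>E. sw (\<lambda>c v. \<epsilon> v * (d l c * sw (\<lambda>p q. d i p * d j q) l)) (x * S (S i * j)))"
      by (rule sum.swap)
    also have "\<dots> = (\<Sum>i\<in>E. \<Sum>j\<in>E. \<Sum>l\<in>E. sw (\<lambda>c v. \<epsilon> v * (d l c * sw (\<lambda>p q. d i p * d j q) l)) (x * S (S i * j)))"
      by (intro sum.cong refl sum.swap)
    also have "\<dots> = (\<Sum>i\<in>E. \<Sum>j\<in>E. sw (\<lambda>c v. \<epsilon> v * (\<Sum>l\<in>E. d l c * sw (\<lambda>p q. d i p * d j q) l)) (x * S (S i * j)))"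
      by (simp add: sum_distrib_left sw_sum)
    also have "\<dots> = (\<Sum>i\<in>E. \<Sum>j\<in>E. sw (\<lambda>c v. sw (\<lambda>p q. \<epsilon> v * (d i p * d j q)) c) (x * S (S i * j)))"
      by (subst expand) (intro intros | simp add: sw_cmult)+
    also have "\<dots> = (\<Sum>i\<in>E. \<Sum>j\<in>E. sw (\<lambda>p w. sw (\<lambda>q v. \<epsilon> v * (d i p * d j q)) w) (x * S (S i * j)))"
      by (subst sw_coassoc) (intro intros refl)+
    also have "\<dots> = (\<Sum>j\<in>E. P (sw (\<lambda>q v. d j q * \<epsilon> v)) (x * S j))"
      unfolding P_def
      by (subst sum.swap) (simp add: S_mult mult.assoc sw_cmult [symmetric] mult.left_commute mult.commute)
    also have "\<dots> = 0"
      by (intro sum.neutral ballI P0) (intro intros)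
    finally show ?thesis .
  qed
  from this [of 1] show False by (simp add: counit_one)
qed

section \<open>Bijectivity of the antipode\<close>

lemma inj_antipode: "inj S"
proof (rule injI)
  fix x y assume "S x = S y"
  then have "S (x - y) = 0"
    using lin_endo_antipode unfolding lin_endo_def
    by (metis add_diff_cancel_left' diff_add_cancel eq_iff_diff_eq_0)
  with ex_left_integral left_integral_cancel show "x = y" by fastforce
qed

text \<open>An injective linear map that sends a finite-dimensional subspace into itself is onto it,
  by dimension. Applied to \<open>R\<close> it gives \<open>S R = R\<close>, applied to all of
  \<open>H\<close> it gives surjectivity.\<close>

lemma antipode_image_eq:
  assumes "subspace V" "S ` V \<subseteq> V"
  shows "S ` V = V"
proof -
  obtain B where B: "finite B" "span B = UNIV" using fd by (auto simp: finite_dimensional_def)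
  define E where "E = extend_basis {}"
  have E: "independent E" "span E = UNIV"
    unfolding E_def
    by (rule independent_extend_basis span_extend_basis, rule independent_empty)+
  interpret F: finite_dimensional_vector_space scale E
    using E independent_span_bound [OF B(1) E(1)] B(2) by unfold_locales auto
  have lin: "Vector_Spaces.linear scale scale S" by (rule antipode_linear)
  interpret FF: finite_dimensional_vector_space_pair_1 scale E scale
    by unfold_locales
  have "dim (S ` V) = dim V"
    using FF.dim_image_eq [OF lin] inj_antipode by (auto intro: inj_on_subset)
  moreover have "subspace (S ` V)"
    using Vector_Spaces.linear.axioms(3) [OF lin] assms(1) by (rule module_hom.subspace_image)
  ultimately show ?thesis
    using F.subspace_dim_equal [OF _ assms(1,2)] by simp
qed

end

section \<open>Balanced multilinear forms and coefficients of tensor powers\<close>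

text \<open>Extending a form by one letter affects only the last two letters, so the position of a
  slot matters only up to these three cases.\<close>

lemma snoc2_cases:
  obtains "ys = []" | y where "ys = [y]" | zs z y where "ys = zs @ [z, y]"
proof (cases ys rule: rev_cases)
  case (snoc us y)
  then show thesis using that by (cases us rule: rev_cases) auto
qed (use that in blast)

locale hopf_subalgebra_pair = findim_hopf_algebra scale \<Delta> \<epsilon> S
  for scale :: "'k::field \<Rightarrow> 'h::ring_1 \<Rightarrow> 'h"
    and \<Delta> :: "'h \<Rightarrow> ('h list \<Rightarrow>\<^sub>0 'k) set"
    and \<epsilon> :: "'h \<Rightarrow> 'k"
    and S :: "'h \<Rightarrow> 'h" +
  fixes R :: "'h set"
  assumes sub: "hopf_subalgebra scale \<Delta> S R"
begin

lemma subspace_R: "subspace R" and one_R: "1 \<in> R"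
  and S_R: "S ` R = R"
  using sub antipode_image_eq by (auto simp: hopf_subalgebra_def unital_subalgebra_def)

lemma comult_R:
  assumes "r \<in> R"
  obtains f where "f \<in> free_on (words R 2)" "f \<in> free_on (words UNIV 2)" "\<Delta> r = tclass scale 2 f"
proof -
  obtain f where "f \<in> free_on (words R 2)" "\<Delta> r = tclass scale 2 f"
    using sub assms by (auto simp: hopf_subalgebra_def)
  moreover then have "f \<in> free_on (words UNIV 2)" by (auto simp: free_on_def words_def)
  ultimately show thesis using that by blast
qed

text \<open>\<open>sweedler\<close> may pick a representative of \<open>\<Delta> r\<close> with
  letters outside \<open>R\<close>; bilinearity of both forms permits the change to a representative
  over \<open>R\<close>.\<close>

lemma sw_cong_R:
  assumes "r \<in> R" "bilin \<phi>" "bilin \<psi>" "\<And>a b. a \<in> R \<Longrightarrow> b \<in> R \<Longrightarrow> \<phi> a b = \<psi> a b"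
  shows "sw \<phi> r = sw \<psi> r"
proof -
  obtain f where f: "f \<in> free_on (words R 2)" "f \<in> free_on (words UNIV 2)" "\<Delta> r = tclass scale 2 f"
    using comult_R [OF assms(1)] .
  have "xs ! 0 \<in> R \<and> xs ! 1 \<in> R" if "xs \<in> Poly_Mapping.keys f" for xs
  proof -
    have "length xs = 2" "set xs \<subseteq> R" using f(1) that by (auto simp: free_on_def words_def)
    then show ?thesis using nth_mem [of 0 xs] nth_mem [of 1 xs] by auto
  qed
  then have "lin_ext (*) (\<lambda>xs. \<phi> (xs ! 0) (xs ! 1)) f = lin_ext (*) (\<lambda>xs. \<psi> (xs ! 0) (xs ! 1)) f"
    using assms(4) by (intro lin_ext_cong) blast
  then show ?thesis using sw_eqI [OF assms(2) f(3,2)] sw_eqI [OF assms(3) f(3,2)] by simp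
qed

section \<open>Functionals on \<open>Q\<close> and forms on words\<close>

text \<open>The dual of \<open>Q\<close>, kept as functionals on \<open>H\<close>. The rule for
  \<open>r * y\<close> is equivalent to vanishing on \<open>R^+ H\<close>, and it is the shape in
  which a leg from \<open>R\<close> is absorbed in a Sweedler sum.\<close>

definition Q_dual :: "('h \<Rightarrow> 'k) \<Rightarrow> bool"
  where "Q_dual f \<longleftrightarrow> lin f \<and> (\<forall>r\<in>R. \<forall>y. f (r * y) = \<epsilon> r * f y)"

lemma RplusH_subspace: "subspace (RplusH scale \<epsilon> R)"
  by (simp add: RplusH_def)

lemma Q_dual_iff: "Q_dual f \<longleftrightarrow> lin f \<and> (\<forall>x\<in>RplusH scale \<epsilon> R. f x = 0)"
proof
  assume f: "Q_dual f"
  have "f x = 0" if "x \<in> span {r * h | r h. r \<in> R \<and> \<epsilon> r = 0}" for x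
  proof -
    have "subspace {x. f x = 0}" using f by (auto simp: subspace_def Q_dual_def linD)
    from span_induct [OF that this] show ?thesis using f by (fastforce simp: Q_dual_def)
  qed
  with f show "lin f \<and> (\<forall>x\<in>RplusH scale \<epsilon> R. f x = 0)" by (simp add: Q_dual_def RplusH_def)
next
  assume f: "lin f \<and> (\<forall>x\<in>RplusH scale \<epsilon> R. f x = 0)"
  have "f (r * y) = \<epsilon> r * f y" if "r \<in> R" for r y
  proof -
    \<comment> \<open>Subtracting the scalar part moves \<open>r\<close> into the kernel of
      \<epsilon> without leaving \<open>R\<close>.\<close>
    have "\<epsilon> (r - scale (\<epsilon> r) 1) = 0" by (simp add: linD [OF lin_counit] counit_one)
    moreover have "r - scale (\<epsilon> r) 1 \<in> R"
      using that by (intro subspace_diff subspace_scale subspace_R one_R)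
    ultimately have "(r - scale (\<epsilon> r) 1) * y \<in> RplusH scale \<epsilon> R"
      unfolding RplusH_def by (intro span_base) auto
    with f have "f ((r - scale (\<epsilon> r) 1) * y) = 0" by blast
    then show ?thesis using f by (simp add: left_diff_distrib scale_mult_left linD)
  qed
  with f show "Q_dual f" by (simp add: Q_dual_def)
qed

lemma Q_dual_basis:
  obtains C d where "finite C" "\<And>c. c \<in> C \<Longrightarrow> Q_dual (d c)"
    "\<And>x. x - (\<Sum>c\<in>C. scale (d c x) c) \<in> RplusH scale \<epsilon> R"
    "\<And>f x. Q_dual f \<Longrightarrow> f x = (\<Sum>c\<in>C. d c x * f c)"
proof -
  obtain B where B: "finite B" "span B = UNIV" using fd by (auto simp: finite_dimensional_def)
  obtain C d where C: "finite C" "\<And>c. lin (d c)"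
    "\<And>c x. c \<in> C \<Longrightarrow> x \<in> RplusH scale \<epsilon> R \<Longrightarrow> d c x = 0"
    "\<And>x. x - (\<Sum>c\<in>C. scale (d c x) c) \<in> RplusH scale \<epsilon> R"
    using dual_basis_mod [OF B RplusH_subspace] by metis
  have "f x = (\<Sum>c\<in>C. d c x * f c)" if "Q_dual f" for f x
  proof -
    have "f (x - (\<Sum>c\<in>C. scale (d c x) c)) = 0" and "lin f"
      using that C(4) [of x] unfolding Q_dual_iff by blast+
    then show ?thesis by (simp add: linD)
  qed
  moreover have "Q_dual (d c)" if "c \<in> C" for c using C(2,3) that by (simp add: Q_dual_iff)
  ultimately show thesis using that C(1,4) by blast
qed

definition balanced :: "nat \<Rightarrow> ('h list \<Rightarrow> 'k) \<Rightarrow> bool"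
  where "balanced N g \<longleftrightarrow> (\<forall>xs a b a' ys. b \<in> R \<longrightarrow> length xs + length ys + 2 = N \<longrightarrow>
    g (xs @ (a * b) # a' # ys) = g (xs @ a # (b * a') # ys))"

definition left_inv :: "nat \<Rightarrow> ('h list \<Rightarrow> 'k) \<Rightarrow> bool"
  where "left_inv N g \<longleftrightarrow> (\<forall>h x xs. length xs + 1 = N \<longrightarrow> g ((h * x) # xs) = \<epsilon> h * g (x # xs))"

text \<open>\<open>inv_forms n\<close> is the dual of \<open>k \<otimes>\<^sub>H H\<^bsup>\<otimes>\<^sub>R(n+1)\<^esup>\<close>, which is isomorphic to \<open>Q\<^bsup>\<otimes>n\<^esup>\<close> as a right
  \<open>H\<close>-module, and \<open>inv_ann n\<close> is the annihilator of that module.\<close>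

definition inv_forms :: "nat \<Rightarrow> ('h list \<Rightarrow> 'k) set"
  where "inv_forms n = {g. multilin (*) (n + 1) g \<and> balanced (n + 1) g \<and> left_inv (n + 1) g}"

definition inv_ann :: "nat \<Rightarrow> 'h set"
  where "inv_ann n = {r. \<forall>g\<in>inv_forms n. \<forall>xs x. length xs = n \<longrightarrow> g (xs @ [x * r]) = 0}"

lemma multilinI:
  assumes "\<And>xs ys. length xs + length ys + 1 = N \<Longrightarrow> lin (\<lambda>a. g (xs @ a # ys))"
  shows "multilin (*) N g"
  using assms unfolding multilin_def lin_def by blast

lemma lin_slot:
  assumes "multilin (*) N g" "length xs + length ys + 1 = N"
  shows "lin (\<lambda>a. g (xs @ a # ys))"
  using assms unfolding multilin_def lin_def by blast

section \<open>Matrix coefficients of the tensor powers of \<open>Q\<close>\<close>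

text \<open>The matrix coefficient of \<open>r\<close>: the tensor of the first components, applied
  to the tensor of the second components after the diagonal action of \<open>r\<close>. Vectors of
  \<open>Q\<close> are represented by elements of \<open>H\<close>.\<close>

primrec coef :: "(('h \<Rightarrow> 'k) \<times> 'h) list \<Rightarrow> 'h \<Rightarrow> 'k"
  where
    "coef [] r = \<epsilon> r"
  | "coef (p # ps) r = sw (\<lambda>a b. fst p (snd p * a) * coef ps b) r"

definition Q_pairs :: "nat \<Rightarrow> (('h \<Rightarrow> 'k) \<times> 'h) list set"
  where "Q_pairs n = {ps. length ps = n \<and> (\<forall>p\<in>set ps. Q_dual (fst p))}"

definition coef_ann :: "nat \<Rightarrow> 'h set"
  where "coef_ann n = {r. \<forall>ps\<in>Q_pairs n. coef ps r = 0}"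

lemma Q_dualD: "Q_dual f \<Longrightarrow> lin f" "Q_dual f \<Longrightarrow> r \<in> R \<Longrightarrow> f (r * y) = \<epsilon> r * f y"
  by (simp_all add: Q_dual_def)

lemma lin_coef: "(\<And>p. p \<in> set ps \<Longrightarrow> Q_dual (fst p)) \<Longrightarrow> lin (coef ps)"
proof (induction ps)
  case Nil
  have "coef [] = \<epsilon>" by (simp add: fun_eq_iff)
  then show ?case using lin_counit by simp
next
  case (Cons p ps)
  have p: "lin (fst p)" using Cons.prems by (simp add: Q_dual_def)
  have ps: "lin (coef ps)" using Cons by simp
  have "lin (\<lambda>r. sw (\<lambda>a b. fst p (snd p * a) * coef ps b) r)"
    by (intro lin_intros lin_compose [OF p] lin_compose [OF ps])
  then show ?case by simp
qed

text \<open>One leg of \<open>\<Delta> r\<close> is contracted by a matrix coefficient of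
  \<open>Q\<close>; the result is kept in \<open>H\<close> so that its membership in an annihilator
  can be expressed.\<close>

definition contract_right :: "('h \<Rightarrow> 'k) \<Rightarrow> 'h \<Rightarrow> 'h \<Rightarrow> 'h"
  where "contract_right f h r = lin_ext scale (\<lambda>xs. scale (f (h * xs ! 1)) (xs ! 0)) (sweedler \<Delta> r)"

definition contract_left :: "('h \<Rightarrow> 'k) \<Rightarrow> 'h \<Rightarrow> 'h \<Rightarrow> 'h"
  where "contract_left f h r = lin_ext scale (\<lambda>xs. scale (f (h * xs ! 0)) (xs ! 1)) (sweedler \<Delta> r)"

lemma lin_contract_right: "lin \<phi> \<Longrightarrow> \<phi> (contract_right f h r) = sw (\<lambda>a b. f (h * b) * \<phi> a) r"
  by (simp add: contract_right_def lin_lin_ext linD(2) sw_def)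

lemma lin_contract_left: "lin \<phi> \<Longrightarrow> \<phi> (contract_left f h r) = sw (\<lambda>a b. f (h * a) * \<phi> b) r"
  by (simp add: contract_left_def lin_lin_ext linD(2) sw_def)

text \<open>On a representative of \<open>\<Delta> r\<close> with letters in \<open>R\<close> the
  sum visibly lies in \<open>R\<close>. The inclusion of annihilators that is to be propagated
  concerns elements of \<open>R\<close> only, so contractions have to stay there.\<close>

lemma contract_left_R:
  assumes "r \<in> R" "lin f"
  shows "contract_left f h r \<in> R"
proof -
  obtain t where t: "t \<in> free_on (words R 2)" "t \<in> free_on (words UNIV 2)" "\<Delta> r = tclass scale 2 t"
    using comult_R [OF assms(1)] .
  have "multilin scale 2 (\<lambda>xs. scale (f (h * xs ! 0)) (xs ! 1))"
  proof -
    have "(length xs = 0 \<and> length ys = 1) \<or> (length xs = 1 \<and> length ys = 0)"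
      if "length xs + length ys + 1 = 2" for xs ys :: "'h list"
      using that by arith
    then show ?thesis
      unfolding multilin_def using assms(2)
      by (fastforce simp: length_Suc_conv lin_def distrib_left scale_mult_right scale_left_distrib
          scale_right_distrib mult.commute)
  qed
  then have "contract_left f h r = lin_ext scale (\<lambda>xs. scale (f (h * xs ! 0)) (xs ! 1)) t"
    unfolding contract_left_def
    by (rule tclass_eqD [OF vector_space_axioms]) (simp_all add: t tclass_sweedler sweedler_free)
  also have "\<dots> \<in> R"
  proof (rule lin_ext_in_subspace [OF subspace_R])
    fix xs assume "xs \<in> Poly_Mapping.keys t"
    then have "length xs = 2" "set xs \<subseteq> R" using t(1) by (auto simp: free_on_def words_def)
    then have "xs ! 1 \<in> R" using nth_mem [of 1 xs] by auto
    then show "scale (f (h * xs ! 0)) (xs ! 1) \<in> R" by (rule subspace_scale [OF subspace_R])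
  qed
  finally show ?thesis .
qed

text \<open>\<open>coef\<close> splits off the first factor, while the tensor powers over
  \<open>R\<close> grow at the last one; by coassociativity the last factor can be split off as
  well.\<close>

lemma coef_snoc:
  assumes "\<And>p. p \<in> set ps \<Longrightarrow> Q_dual (fst p)" "lin f"
  shows "coef (ps @ [(f, h)]) r = sw (\<lambda>a b. f (h * b) * coef ps a) r"
  using assms(1)
proof (induction ps arbitrary: r)
  case Nil
  note intros = lin_intros lin_compose [OF assms(2)]
  have "sw (\<lambda>a b. \<epsilon> b * f (h * a)) r = f (h * r)" by (rule sw_counit_right) (intro intros)
  moreover have "sw (\<lambda>a b. \<epsilon> a * f (h * b)) r = f (h * r)" by (rule sw_counit_left) (intro intros)
  ultimately show ?case by (simp add: mult.commute)
next
  case (Cons p ps)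
  have p: "lin (fst p)" using Cons.prems by (simp add: Q_dual_def)
  have ps: "lin (coef ps)" using Cons.prems by (intro lin_coef) simp
  note intros = lin_intros lin_compose [OF assms(2)] lin_compose [OF p] lin_compose [OF ps]
  have "coef ((p # ps) @ [(f, h)]) r =
      sw (\<lambda>a b. sw (\<lambda>c e. fst p (snd p * a) * (f (h * e) * coef ps c)) b) r"
    using Cons by (simp add: sw_cmult)
  also have "\<dots> = sw (\<lambda>c' e. sw (\<lambda>a c. fst p (snd p * a) * (f (h * e) * coef ps c)) c') r"
    by (rule sw_coassoc [symmetric]) (intro intros)+
  also have "\<dots> = sw (\<lambda>a b. f (h * b) * coef (p # ps) a) r"
    by (simp add: sw_cmult [symmetric] mult_ac)
  finally show ?case .
qed

lemma coef_annD: "r \<in> coef_ann n \<Longrightarrow> ps \<in> Q_pairs n \<Longrightarrow> coef ps r = 0"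
  by (simp add: coef_ann_def)

lemma coef_annI: "(\<And>ps. ps \<in> Q_pairs n \<Longrightarrow> coef ps r = 0) \<Longrightarrow> r \<in> coef_ann n"
  by (simp add: coef_ann_def)

lemma coef_ann_0: "r \<in> coef_ann 0 \<longleftrightarrow> \<epsilon> r = 0"
  by (simp add: coef_ann_def Q_pairs_def)

text \<open>Made for the comparison with \<open>inv_ann\<close>, whose recursion contracts the
  second leg too; the version for the first leg drives the propagation to higher powers.\<close>

lemma coef_ann_Suc_right:
  "r \<in> coef_ann (Suc n) \<longleftrightarrow> (\<forall>f h. Q_dual f \<longrightarrow> contract_right f h r \<in> coef_ann n)"
proof -
  have eq: "coef (ps @ [(f, h)]) r = coef ps (contract_right f h r)"
    if "ps \<in> Q_pairs n" "Q_dual f" for ps f h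
    using that by (subst lin_contract_right [OF lin_coef]) (auto simp: Q_pairs_def Q_dual_def coef_snoc)
  have snoc: "ps @ [(f, h)] \<in> Q_pairs (Suc n) \<longleftrightarrow> ps \<in> Q_pairs n \<and> Q_dual f" for ps f h
    by (auto simp: Q_pairs_def)
  have ex: "\<exists>qs f h. ps = qs @ [(f, h)]" if "ps \<in> Q_pairs (Suc n)" for ps
    using that by (cases ps rule: rev_cases) (auto simp: Q_pairs_def)
  show ?thesis
  proof (intro iffI allI impI)
    fix f h assume r: "r \<in> coef_ann (Suc n)" "Q_dual f"
    have "coef ps (contract_right f h r) = 0" if "ps \<in> Q_pairs n" for ps
      using coef_annD [OF r(1), of "ps @ [(f, h)]"] eq [OF that, of f h] snoc [of ps f h] that r(2) by metis
    then show "contract_right f h r \<in> coef_ann n" by (rule coef_annI)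
  next
    assume r: "\<forall>f h. Q_dual f \<longrightarrow> contract_right f h r \<in> coef_ann n"
    have "coef ps r = 0" if ps_in: "ps \<in> Q_pairs (Suc n)" for ps
    proof -
      obtain qs f h where ps: "ps = qs @ [(f, h)]" using ex [OF ps_in] by blast
      then have "qs \<in> Q_pairs n" "Q_dual f" using snoc ps_in by blast+
      then show ?thesis using eq r ps coef_annD by metis
    qed
    then show "r \<in> coef_ann (Suc n)" by (rule coef_annI)
  qed
qed

lemma coef_ann_Suc_left:
  "r \<in> coef_ann (Suc n) \<longleftrightarrow> (\<forall>f h. Q_dual f \<longrightarrow> contract_left f h r \<in> coef_ann n)"
proof -
  have eq: "coef ((f, h) # ps) r = coef ps (contract_left f h r)"
    if "ps \<in> Q_pairs n" for ps f h
    using that by (subst lin_contract_left [OF lin_coef]) (auto simp: Q_pairs_def)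
  have Cons: "(f, h) # ps \<in> Q_pairs (Suc n) \<longleftrightarrow> ps \<in> Q_pairs n \<and> Q_dual f" for ps f h
    by (auto simp: Q_pairs_def)
  have ex: "\<exists>qs f h. ps = (f, h) # qs" if "ps \<in> Q_pairs (Suc n)" for ps
    using that by (cases ps) (auto simp: Q_pairs_def)
  show ?thesis
  proof (intro iffI allI impI)
    fix f h assume r: "r \<in> coef_ann (Suc n)" "Q_dual f"
    have "coef ps (contract_left f h r) = 0" if "ps \<in> Q_pairs n" for ps
      using coef_annD [OF r(1), of "(f, h) # ps"] eq [OF that, of f h] Cons [of f h ps] that r(2) by metis
    then show "contract_left f h r \<in> coef_ann n" by (rule coef_annI)
  next
    assume r: "\<forall>f h. Q_dual f \<longrightarrow> contract_left f h r \<in> coef_ann n"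
    have "coef ps r = 0" if ps_in: "ps \<in> Q_pairs (Suc n)" for ps
    proof -
      obtain qs f h where ps: "ps = (f, h) # qs" using ex [OF ps_in] by blast
      then have "qs \<in> Q_pairs n" "Q_dual f" using Cons ps_in by blast+
      then show ?thesis using eq r ps coef_annD by metis
    qed
    then show "r \<in> coef_ann (Suc n)" by (rule coef_annI)
  qed
qed

lemma coef_ann_mono_step:
  assumes "R \<inter> coef_ann n \<subseteq> coef_ann (Suc n)"
  shows "R \<inter> coef_ann (n + m) \<subseteq> coef_ann (Suc (n + m))"
proof (induction m)
  case (Suc m)
  show ?case
  proof clarify
    fix r assume r: "r \<in> R" "r \<in> coef_ann (n + Suc m)"
    then show "r \<in> coef_ann (Suc (n + Suc m))"
      using Suc contract_left_R [OF r(1)] coef_ann_Suc_left [of r "n + m"]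
        coef_ann_Suc_left [of r "Suc (n + m)"] by (auto simp: Q_dual_def)
  qed
qed (use assms in simp)

section \<open>The recursion for the annihilators of invariant forms\<close>

lemma inv_annD: "r \<in> inv_ann n \<Longrightarrow> g \<in> inv_forms n \<Longrightarrow> length xs = n \<Longrightarrow> g (xs @ [x * r]) = 0"
  by (simp add: inv_ann_def)

lemma inv_ann_0: "r \<in> inv_ann 0 \<longleftrightarrow> \<epsilon> r = 0"
proof
  assume r: "r \<in> inv_ann 0"
  \<comment> \<open>For \<open>n = 0\<close> the words have a single letter, so nothing has to be
    balanced, and \<epsilon> itself is the invariant form that detects \<open>r\<close>.\<close>
  have "(\<lambda>xs. \<epsilon> (hd xs)) \<in> inv_forms 0"
  proof -
    have "lin (\<lambda>a. \<epsilon> (hd (xs @ a # ys)))" if "length xs + length ys + 1 = 0 + 1" for xs ys :: "'h list"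
      using that lin_counit by simp
    then have "multilin (*) (0 + 1) (\<lambda>xs. \<epsilon> (hd xs))" by (intro multilinI)
    then show ?thesis by (simp add: inv_forms_def balanced_def left_inv_def counit_mult)
  qed
  from inv_annD [OF r this, of "[]" 1] show "\<epsilon> r = 0" by simp
next
  assume r: "\<epsilon> r = 0"
  have "g [x * r] = 0" if "g \<in> inv_forms 0" for g x
  proof -
    \<comment> \<open>The factor 1 is kept so that left invariance applies to the whole letter
      \<open>x * r\<close>.\<close>
    have "g [(x * r) * 1] = \<epsilon> (x * r) * g [1]"
      using that by (simp add: inv_forms_def left_inv_def del: mult_1_right)
    then show ?thesis by (simp add: r counit_mult)
  qed
  then show "r \<in> inv_ann 0" by (simp add: inv_ann_def)
qed

text \<open>The next two constructions are dual to the inverse isomorphisms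
  \<open>m \<otimes> y \<mapsto> m y\<^sub>1 \<otimes> y\<^sub>2\<close> and \<open>m \<otimes> h \<mapsto> m S(h\<^sub>1) \<otimes> h\<^sub>2\<close> between \<open>M \<otimes>\<^sub>R H\<close> and \<open>M \<otimes> Q\<close>.\<close>

lemma inv_forms_extend:
  assumes g: "g \<in> inv_forms n" and f: "Q_dual f"
  shows "(\<lambda>ws. sw (\<lambda>a b. g (butlast (butlast ws) @ [last (butlast ws) * a]) * f b) (last ws))
    \<in> inv_forms (Suc n)" (is "?g \<in> _")
proof -
  have ml: "multilin (*) (n + 1) g" and bal: "balanced (n + 1) g" and inv: "left_inv (n + 1) g"
    using g by (auto simp: inv_forms_def)
  have linf: "lin f" using f by (rule Q_dualD)
  have eq: "?g (us @ [z, y]) = sw (\<lambda>a b. g (us @ [z * a]) * f b) y" for us z y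
    by (simp add: butlast_append)
  have lin_last: "lin (\<lambda>a. g (us @ [a]))" if "length us = n" for us
    using that by (intro lin_slot [OF ml]) simp
  note intros = lin_intros lin_compose [OF linf] lin_compose [OF lin_last]
  have "multilin (*) (Suc n + 1) ?g"
  proof (rule multilinI)
    fix xs ys :: "'h list" assume len: "length xs + length ys + 1 = Suc n + 1"
    consider "ys = []" | y where "ys = [y]" | zs z y where "ys = zs @ [z, y]"
      by (rule snoc2_cases)
    then show "lin (\<lambda>a. ?g (xs @ a # ys))"
    proof cases
      case 1
      then obtain us z where us: "xs = us @ [z]" "length us = n"
        using len by (cases xs rule: rev_cases) auto
      have "lin (\<lambda>y. ?g (us @ [z, y]))" unfolding eq by (intro intros us)
      then show ?thesis using 1 us by simp
    next
      case 2
      then have "length xs = n" using len by simp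
      then have "lin (\<lambda>z. ?g (xs @ [z, y]))" unfolding eq by (intro intros)
      then show ?thesis using 2 by simp
    next
      case 3
      then have len': "length xs + length (zs @ [z * a]) + 1 = n + 1" for a using len by simp
      have "lin (\<lambda>c. sw (\<lambda>a b. g (xs @ c # zs @ [z * a]) * f b) y)"
        by (intro lin_sw_fun lin_mult_left lin_slot [OF ml len'])
      then show ?thesis using 3 eq [of "xs @ _ # zs" z y] by simp
    qed
  qed
  moreover have "balanced (Suc n + 1) ?g"
    unfolding balanced_def
  proof (intro allI impI)
    fix xs ys :: "'h list" and a b a'
    assume b: "b \<in> R" and len: "length xs + length ys + 2 = Suc n + 1"
    consider "ys = []" | y where "ys = [y]" | zs z y where "ys = zs @ [z, y]"
      by (rule snoc2_cases)
    then show "?g (xs @ (a * b) # a' # ys) = ?g (xs @ a # (b * a') # ys)"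
    proof cases
      case 1
      then have xs: "length xs = n" using len by simp
      note intros = intros xs
      have "sw (\<lambda>p q. g (xs @ [a * p]) * f q) (b * a') =
          sw (\<lambda>p q. sw (\<lambda>c e. g (xs @ [a * (p * c)]) * f (q * e)) a') b"
        by (rule sw_mult) (intro bilinI intros lin_compose [OF lin_last [OF xs]])
      \<comment> \<open>Balance at the new tensor sign: the second leg of \<open>b\<close> lies in
        \<open>R\<close> and is absorbed by \<open>f\<close> as a counit, which leaves
        \<open>b\<close> itself in front of the first leg of \<open>a'\<close>.\<close>
      also have "\<dots> = sw (\<lambda>p q. sw (\<lambda>c e. \<epsilon> q * (g (xs @ [a * (p * c)]) * f e)) a') b"
        by (rule sw_cong_R [OF b]) (intro bilinI intros | simp add: Q_dualD(2) [OF f] mult_ac)+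
      also have "\<dots> = sw (\<lambda>p q. \<epsilon> q * sw (\<lambda>c e. g (xs @ [a * (p * c)]) * f e) a') b"
        by (simp add: sw_cmult)
      also have "\<dots> = sw (\<lambda>c e. g (xs @ [a * (b * c)]) * f e) a'"
        by (rule sw_counit_right) (intro intros)
      finally show ?thesis using 1 eq [of xs "a * b" a'] eq [of xs a "b * a'"] by (simp add: mult.assoc)
    next
      case 2
      then have "length xs + length [] + 2 = n + 1" using len by simp
      then have "g (xs @ (a * b) # (a' * p) # []) = g (xs @ a # (b * (a' * p)) # [])" for p
        using bal b unfolding balanced_def by blast
      then show ?thesis
        using 2 eq [of "xs @ [a * b]" a' y] eq [of "xs @ [a]" "b * a'" y] by (simp add: mult.assoc)
    next
      case 3
      then have "length xs + length (zs @ [z * p]) + 2 = n + 1" for p using len by simp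
      then have "g (xs @ (a * b) # a' # zs @ [z * p]) = g (xs @ a # (b * a') # zs @ [z * p])" for p
        using bal b unfolding balanced_def by blast
      then show ?thesis
        using 3 eq [of "xs @ (a * b) # a' # zs" z y] eq [of "xs @ a # (b * a') # zs" z y] by simp
    qed
  qed
  moreover have "left_inv (Suc n + 1) ?g"
    unfolding left_inv_def
  proof (intro allI impI)
    fix h x and xs :: "'h list"
    assume len: "length xs + 1 = Suc n + 1"
    then obtain us y where us: "xs = us @ [y]" by (cases xs rule: rev_cases) auto
    have inv': "g ((h * c) # zs) = \<epsilon> h * g (c # zs)" if "length zs = n" for c zs
      using inv that by (simp add: left_inv_def)
    show "?g ((h * x) # xs) = \<epsilon> h * ?g (x # xs)"
    proof (cases us rule: rev_cases)
      case Nil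
      then show ?thesis
        using us len inv' [of "[]"] eq [of "[]" _ y] by (simp add: mult.assoc sw_cmult)
    next
      case (snoc vs z)
      then show ?thesis
        using us len inv' [of "vs @ [z * _]"] eq [of "_ # vs" z y] by (simp add: mult.assoc sw_cmult)
    qed
  qed
  ultimately show ?thesis by (simp add: inv_forms_def)
qed

lemma inv_forms_restrict:
  assumes g: "g \<in> inv_forms (Suc n)"
  shows "(\<lambda>ws. sw (\<lambda>p q. g (butlast ws @ [last ws * S p, q])) h) \<in> inv_forms n" (is "?g \<in> _")
proof -
  have ml: "multilin (*) (Suc n + 1) g" and bal: "balanced (Suc n + 1) g"
    and inv: "left_inv (Suc n + 1) g"
    using g by (auto simp: inv_forms_def)
  have eq: "?g (us @ [z]) = sw (\<lambda>p q. g (us @ [z * S p, q])) h" for us z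
    by simp
  have "multilin (*) (n + 1) ?g"
  proof (rule multilinI)
    fix xs ys :: "'h list" assume len: "length xs + length ys + 1 = n + 1"
    show "lin (\<lambda>a. ?g (xs @ a # ys))"
    proof (cases ys rule: rev_cases)
      case Nil
      then have "length xs + length [q] + 1 = Suc n + 1" for q using len by simp
      then have "lin (\<lambda>z. sw (\<lambda>p q. g (xs @ [z * S p, q])) h)"
        by (intro lin_sw_fun lin_compose [OF lin_slot [OF ml]] lin_endo_intros)
      then show ?thesis using Nil eq [of xs] by simp
    next
      case (snoc zs z)
      then have len': "length xs + length (zs @ [z * S p, q]) + 1 = Suc n + 1" for p q using len by simp
      have "lin (\<lambda>c. sw (\<lambda>p q. g (xs @ c # zs @ [z * S p, q])) h)"
        by (intro lin_sw_fun lin_slot [OF ml len'])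
      then show ?thesis using snoc eq [of "xs @ _ # zs" z] by simp
    qed
  qed
  moreover have "balanced (n + 1) ?g"
    unfolding balanced_def
  proof (intro allI impI)
    fix xs ys :: "'h list" and a b a'
    assume b: "b \<in> R" and len: "length xs + length ys + 2 = n + 1"
    have bal': "g (xs @ (a * b) # c # zs) = g (xs @ a # (b * c) # zs)" if "length zs = Suc (length ys)" for c zs
      using bal b that len by (simp add: balanced_def)
    show "?g (xs @ (a * b) # a' # ys) = ?g (xs @ a # (b * a') # ys)"
    proof (cases ys rule: rev_cases)
      case Nil
      then show ?thesis
        using eq [of "xs @ [a * b]" a'] eq [of "xs @ [a]" "b * a'"] bal' [of "[_]" "a' * S _"]
        by (simp add: mult.assoc)
    next
      case (snoc zs z)
      then show ?thesis
        using eq [of "xs @ (a * b) # a' # zs" z] eq [of "xs @ a # (b * a') # zs" z]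
          bal' [of "zs @ [z * S _, _]" a'] by simp
    qed
  qed
  moreover have "left_inv (n + 1) ?g"
    unfolding left_inv_def
  proof (intro allI impI)
    fix t x and xs :: "'h list"
    assume len: "length xs + 1 = n + 1"
    have inv': "g ((t * c) # zs) = \<epsilon> t * g (c # zs)" if "length zs = Suc n" for c zs
      using inv that by (simp add: left_inv_def)
    show "?g ((t * x) # xs) = \<epsilon> t * ?g (x # xs)"
    proof (cases xs rule: rev_cases)
      case Nil
      then show ?thesis
        using len eq [of "[]"] inv' [of "[_]"] by (simp add: mult.assoc sw_cmult)
    next
      case (snoc zs z)
      then show ?thesis
        using len eq [of "_ # zs" z] inv' [of "zs @ [z * S _, _]"] by (simp add: sw_cmult)
    qed
  qed
  ultimately show ?thesis by (simp add: inv_forms_def)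
qed

text \<open>Thus the restricted form depends on \<open>h\<close> only through its class in
  \<open>Q\<close>. For a product \<open>r * y\<close> the second leg of \<open>r\<close> lies in
  \<open>R\<close> and crosses the tensor sign, where it meets the antipode of the first leg and
  collapses.\<close>

lemma Q_dual_restrict:
  assumes g: "g \<in> inv_forms (Suc n)" and us: "length us = n"
  shows "Q_dual (\<lambda>h. sw (\<lambda>p q. g (us @ [z * S p, q])) h)"
  unfolding Q_dual_def
proof (intro conjI ballI allI)
  have ml: "multilin (*) (Suc n + 1) g" and bal: "balanced (Suc n + 1) g"
    using g by (auto simp: inv_forms_def)
  have l1: "lin (\<lambda>a. g (us @ [a, b]))" for b
    using lin_slot [OF ml, of us "[b]"] us by simp
  have l2: "lin (\<lambda>b. g (us @ [a, b]))" for a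
    using lin_slot [OF ml, of "us @ [a]" "[]"] us by simp
  note intros = lin_intros lin_compose [OF l1] lin_compose [OF l2]
  show "lin (\<lambda>h. sw (\<lambda>p q. g (us @ [z * S p, q])) h)" by (intro intros)
  fix r y assume r: "r \<in> R"
  have "sw (\<lambda>p q. g (us @ [z * S p, q])) (r * y) =
      sw (\<lambda>p q. sw (\<lambda>c e. g (us @ [z * S (p * c), q * e])) y) r"
    by (rule sw_mult) (intro bilinI intros)
  also have "\<dots> = sw (\<lambda>p q. sw (\<lambda>c e. g (us @ [z * S c * (S p * q), e])) y) r"
  proof (rule sw_cong_R [OF r])
    fix p q assume q: "q \<in> R"
    have "g (us @ [z * S c * S p, q * e]) = g (us @ [z * S c * S p * q, e])" for c e
      using bal q us unfolding balanced_def by simp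
    then show "sw (\<lambda>c e. g (us @ [z * S (p * c), q * e])) y =
        sw (\<lambda>c e. g (us @ [z * S c * (S p * q), e])) y"
      by (simp add: S_mult mult.assoc)
  qed (intro bilinI intros)+
  also have "\<dots> = sw (\<lambda>c e. sw (\<lambda>p q. g (us @ [z * S c * (S p * q), e])) r) y"
    by (rule sw_commute)
  also have "\<dots> = sw (\<lambda>c e. \<epsilon> r * g (us @ [z * S c * 1, e])) y"
    by (subst sw_antipode_left) (intro intros refl)+
  also have "\<dots> = \<epsilon> r * sw (\<lambda>p q. g (us @ [z * S p, q])) y"
    by (simp add: sw_cmult)
  finally show "sw (\<lambda>p q. g (us @ [z * S p, q])) (r * y) = \<epsilon> r * sw (\<lambda>p q. g (us @ [z * S p, q])) y" .
qed

text \<open>The dual form of M \<otimes>_R H \<cong> M \<otimes> Q, where \<open>r\<close> acts on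
  the right side by m r1 \<otimes> q r2: annihilating it means that every contraction of
  \<open>r\<close> by a matrix coefficient of \<open>Q\<close> annihilates M.\<close>

lemma inv_ann_Suc:
  "r \<in> inv_ann (Suc n) \<longleftrightarrow> (\<forall>f h. Q_dual f \<longrightarrow> contract_right f h r \<in> inv_ann n)"
proof -
  have contract: "g (us @ [x * contract_right f h r]) = sw (\<lambda>a b. f (h * b) * g (us @ [x * a])) r"
    if "g \<in> inv_forms n" "length us = n" for g us x f h
  proof -
    have "lin (\<lambda>a. g (us @ [a]))"
      using that by (intro lin_slot [of "n + 1"]) (auto simp: inv_forms_def)
    then have "lin (\<lambda>a. g (us @ [x * a]))" by (rule lin_compose) (intro lin_endo_intros)
    then show ?thesis by (rule lin_contract_right)
  qed
  show ?thesis
  proof (intro iffI allI impI)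
    fix f h assume r: "r \<in> inv_ann (Suc n)" and f: "Q_dual f"
    have "g (us @ [x * contract_right f h r]) = 0" if g: "g \<in> inv_forms n" and us: "length us = n" for g us x
    proof -
      have lin_last: "lin (\<lambda>a. g (us @ [a]))"
        using g us by (intro lin_slot [of "n + 1"]) (auto simp: inv_forms_def)
      note intros = lin_intros lin_compose [OF Q_dualD(1) [OF f]] lin_compose [OF lin_last]
      have zero: "sw (\<lambda>a b. g (us @ [z * a]) * f b) (y * r) = 0" for z y
      proof -
        from inv_annD [OF r inv_forms_extend [OF g f], of "us @ [z]" y] us
        have "(\<lambda>ws. sw (\<lambda>a b. g (butlast (butlast ws) @ [last (butlast ws) * a]) * f b) (last ws))
            ((us @ [z]) @ [y * r]) = 0"
          by (simp only: length_append_singleton)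
        then show ?thesis by (simp add: butlast_append)
      qed
      \<comment> \<open>Fact \<open>zero\<close> is used at \<open>z = x * S p\<close> and
        \<open>y = w\<close>, with \<open>p\<close> and \<open>w\<close> the legs of
        \<open>h\<close>. The antipode cancels the leg of \<open>h\<close> that appears in front of
        \<open>a\<close>, and \<open>h\<close> survives only inside \<open>f\<close>.\<close>
      have "0 = sw (\<lambda>p w. sw (\<lambda>a b. g (us @ [x * S p * a]) * f b) (w * r)) h"
        by (simp add: zero)
      also have "\<dots> = sw (\<lambda>p w. sw (\<lambda>c e. sw (\<lambda>a b. g (us @ [x * S p * (c * a)]) * f (e * b)) r) w) h"
        by (subst sw_mult) (intro bilinI intros refl)+
      also have "\<dots> = sw (\<lambda>w e. sw (\<lambda>p c. sw (\<lambda>a b. g (us @ [x * S p * (c * a)]) * f (e * b)) r) w) h"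
        by (rule sw_coassoc [symmetric]) (intro intros)+
      also have "\<dots> = sw (\<lambda>w e. sw (\<lambda>a b. sw (\<lambda>p c. g (us @ [x * (S p * c) * a]) * f (e * b)) w) r) h"
        by (subst sw_commute) (simp add: mult.assoc)
      also have "\<dots> = sw (\<lambda>w e. sw (\<lambda>a b. \<epsilon> w * (g (us @ [x * 1 * a]) * f (e * b))) r) h"
        by (subst sw_antipode_left) (intro intros refl)+
      also have "\<dots> = sw (\<lambda>w e. \<epsilon> w * sw (\<lambda>a b. g (us @ [x * a]) * f (e * b)) r) h"
        by (simp add: sw_cmult)
      also have "\<dots> = sw (\<lambda>a b. g (us @ [x * a]) * f (h * b)) r"
        by (rule sw_counit_left) (intro intros)
      finally show ?thesis by (simp add: contract [OF g us] mult.commute)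
    qed
    then show "contract_right f h r \<in> inv_ann n" by (simp add: inv_ann_def)
  next
    assume r: "\<forall>f h. Q_dual f \<longrightarrow> contract_right f h r \<in> inv_ann n"
    have zero: "sw (\<lambda>a b. f (h * b) * g (us @ [x * a])) r = 0"
      if "g \<in> inv_forms n" "length us = n" "Q_dual f" for g us x f h
      using inv_annD [OF r [rule_format, OF that(3)] that(1,2)] contract [OF that(1,2)] by simp
    obtain C d where C: "finite C" "\<And>c. c \<in> C \<Longrightarrow> Q_dual (d c)"
      and expand: "\<And>f x. Q_dual f \<Longrightarrow> f x = (\<Sum>c\<in>C. d c x * f c)"
      using Q_dual_basis by metis
    have "g (us @ [z, y * r]) = 0" if g: "g \<in> inv_forms (Suc n)" and us: "length us = n" for g us z y
    proof -
      have ml: "multilin (*) (Suc n + 1) g"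
        using g by (auto simp: inv_forms_def)
      have l1: "lin (\<lambda>a. g (us @ [a, b]))" for b
        using lin_slot [OF ml, of us "[b]"] us by simp
      have l2: "lin (\<lambda>b. g (us @ [a, b]))" for a
        using lin_slot [OF ml, of "us @ [a]" "[]"] us by simp
      note intros = lin_intros lin_compose [OF l1] lin_compose [OF l2]
      let ?\<Gamma> = "\<lambda>h z. sw (\<lambda>p q. g (us @ [z * S p, q])) h"
      \<comment> \<open>\<open>g\<close> is recovered from its restrictions, since
        \<open>a * S p\<close> collapses over the legs of \<open>w\<close>. Expanding
        \<open>?\<Gamma>\<close> in the dual of \<open>Q\<close> then fixes its index, so that
        \<open>zero\<close> applies to each term.\<close>
      have "g (us @ [z, w]) = sw (\<lambda>a b. ?\<Gamma> b (z * a)) w" for w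
      proof -
        have "sw (\<lambda>a b. ?\<Gamma> b (z * a)) w = sw (\<lambda>c q. sw (\<lambda>a p. g (us @ [z * (a * S p), q])) c) w"
          by (subst sw_coassoc) (intro intros | simp add: mult.assoc)+
        also have "\<dots> = sw (\<lambda>c q. \<epsilon> c * g (us @ [z * 1, q])) w"
          by (subst sw_antipode_right) (intro intros refl)+
        also have "\<dots> = g (us @ [z * 1, w])"
          by (rule sw_counit_left) (intro intros)
        finally show ?thesis by simp
      qed
      then have "g (us @ [z, y * r]) = sw (\<lambda>a b. \<Sum>c\<in>C. d c b * ?\<Gamma> c (z * a)) (y * r)"
        by (simp add: expand [OF Q_dual_restrict [OF g us], symmetric])
      also have "\<dots> = (\<Sum>c\<in>C. sw (\<lambda>a b. d c b * ?\<Gamma> c (z * a)) (y * r))"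
        by (rule sw_sum)
      also have "\<dots> = (\<Sum>c\<in>C. 0)"
      proof (rule sum.cong [OF refl])
        fix c assume c: "c \<in> C"
        have lind: "lin (d c)" using C(2) [OF c] by (rule Q_dualD)
        have zero': "sw (\<lambda>p q. d c (b * q) * ?\<Gamma> c (z' * p)) r = 0" for b z'
          using zero [OF inv_forms_restrict [OF g, of c] us C(2) [OF c], of b z'] by simp
        have "sw (\<lambda>a b. d c b * ?\<Gamma> c (z * a)) (y * r) =
            sw (\<lambda>a b. sw (\<lambda>p q. d c (b * q) * ?\<Gamma> c (z * (a * p))) r) y"
          by (rule sw_mult) (intro bilinI intros lind)
        also have "\<dots> = 0" using zero' [of _ "z * _"] by (simp add: mult.assoc)
        finally show "sw (\<lambda>a b. d c b * ?\<Gamma> c (z * a)) (y * r) = 0" .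
      qed
      finally show ?thesis by simp
    qed
    then show "r \<in> inv_ann (Suc n)"
      unfolding inv_ann_def by (auto simp: length_Suc_conv_rev)
  qed
qed

text \<open>The same value at 0 and the same recursion: this is the part of the isomorphism with the
  tensor powers of \<open>Q\<close> that the argument relies on.\<close>

lemma inv_ann_eq_coef_ann: "inv_ann n = coef_ann n"
proof (induction n)
  case 0
  show ?case by (auto simp: inv_ann_0 coef_ann_0)
next
  case (Suc n)
  then show ?case by (auto simp: inv_ann_Suc coef_ann_Suc_right)
qed

end

section \<open>The annihilator of a tensor power of \<open>Q\<close>\<close>

context hopf_subalgebra_pair
begin

abbreviation "RpH \<equiv> RplusH scale \<epsilon> R"
abbreviation "Qc \<equiv> Q_carrier scale \<epsilon> R"
abbreviation "qc \<equiv> Q_class scale \<epsilon> R"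
abbreviation "Qadd \<equiv> Q_add scale \<epsilon> R"
abbreviation "Qscale \<equiv> Q_scale scale \<epsilon> R"
abbreviation "Qact \<equiv> Q_act scale \<epsilon> R"

definition rep :: "'h set \<Rightarrow> 'h"
  where "rep q = (SOME h. h \<in> q)"

lemma cq_Q: "coset_quotient UNIV RpH"
  by unfold_locales (auto intro: subspace_0 subspace_add subspace_neg RplusH_subspace)

lemma qc_eq_iff: "qc x = qc y \<longleftrightarrow> x - y \<in> RpH"
  unfolding Q_class_def by (rule coset_quotient.qclass_eq_iff [OF cq_Q]) simp_all

lemma qc_in [simp]: "qc x \<in> Qc"
  unfolding Q_class_def Q_carrier_def by (rule coset_quotient.qclass_in [OF cq_Q]) simp

lemma qc_rep [simp]: "q \<in> Qc \<Longrightarrow> qc (rep q) = q"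
proof -
  assume "q \<in> Qc"
  then obtain x where x: "q = qc x"
    unfolding Q_class_def Q_carrier_def by (rule coset_quotient.quotient_cases [OF cq_Q])
  have "x - rep q \<in> RpH"
    unfolding x rep_def Q_class_def by (rule coset_quotient.some_qclass [OF cq_Q]) simp
  then show ?thesis unfolding x by (metis qc_eq_iff x)
qed

lemma Q_dual_rep: "Q_dual f \<Longrightarrow> f (rep (qc x)) = f x"
proof -
  assume f: "Q_dual f"
  have "rep (qc x) - x \<in> RpH" by (simp add: qc_eq_iff [symmetric])
  with f have "f (rep (qc x) - x) = 0" unfolding Q_dual_iff by blast
  then show ?thesis using Q_dualD(1) [OF f] by (simp add: linD(5))
qed

lemma RpH_mult: "x \<in> RpH \<Longrightarrow> x * h \<in> RpH"
proof -
  assume "x \<in> RpH"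
  moreover have "subspace {x. x * h \<in> RpH}"
    using RplusH_subspace by (auto simp: subspace_def distrib_right scale_mult_left)
  moreover have "x * h \<in> RpH" if x: "x \<in> {r * h | r h. r \<in> R \<and> \<epsilon> r = 0}" for x
  proof -
    obtain r y where "x = r * y" "r \<in> R" "\<epsilon> r = 0" using x by blast
    then have "x * h = r * (y * h)" by (simp add: mult.assoc)
    then show ?thesis unfolding RplusH_def using \<open>r \<in> R\<close> \<open>\<epsilon> r = 0\<close> by (intro span_base) blast
  qed
  ultimately show ?thesis
    unfolding RplusH_def [of scale \<epsilon> R] by (rule span_induct [of _ _ "\<lambda>x. x * h \<in> RpH", unfolded RplusH_def]) auto
qed

lemma Qact_qc: "Qact (qc x) h = qc (x * h)"
proof -
  have "(\<Union>y\<in>qclass UNIV RpH x. qc (y * h)) = qc (x * h)"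
  proof (rule coset_quotient.UN_qclass [OF cq_Q])
    fix y assume "x - y \<in> RpH"
    then have "(x - y) * h \<in> RpH" by (rule RpH_mult)
    then show "qc (y * h) = qc (x * h)" by (metis left_diff_distrib qc_eq_iff)
  qed simp
  then show ?thesis by (simp only: Q_act_def Q_class_def)
qed

lemma Qscale_qc: "Qscale c (qc x) = qc (scale c x)"
proof -
  have "(\<Union>y\<in>qclass UNIV RpH x. qc (scale c y)) = qc (scale c x)"
  proof (rule coset_quotient.UN_qclass [OF cq_Q])
    fix y assume "x - y \<in> RpH"
    then have "scale c (x - y) \<in> RpH" by (rule subspace_scale [OF RplusH_subspace])
    then show "qc (scale c y) = qc (scale c x)" by (metis scale_right_diff_distrib qc_eq_iff)
  qed simp
  then show ?thesis by (simp only: Q_scale_def Q_class_def)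
qed

lemma Qadd_qc: "Qadd (qc x) (qc y) = qc (x + y)"
proof -
  have eq: "qc (x' + y') = qc (x + y)" if "x - x' \<in> RpH" "y - y' \<in> RpH" for x' y'
  proof -
    have "(x + y) - (x' + y') = (x - x') + (y - y')" by simp
    also have "\<dots> \<in> RpH" using that by (rule subspace_add [OF RplusH_subspace])
    finally show ?thesis by (metis qc_eq_iff)
  qed
  have mem: "x' \<in> qc x \<longleftrightarrow> x - x' \<in> RpH" for x x'
    unfolding Q_class_def by (subst coset_quotient.mem_qclass_iff [OF cq_Q]) simp_all
  have "x \<in> qc x" "y \<in> qc y" using subspace_0 [OF RplusH_subspace] by (simp_all add: mem)
  then show ?thesis unfolding Q_add_def using eq mem by blast
qed

lemma Q_cases:
  assumes "q \<in> Qc"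
  obtains x where "q = qc x"
  using qc_rep [OF assms] by metis

section \<open>Pure tensors of functionals on \<open>Q\<close>\<close>

text \<open>Representatives are harmless here because the functionals in \<open>Q_dual\<close> are
  constant on cosets.\<close>

definition qform :: "('h \<Rightarrow> 'k) list \<Rightarrow> 'h set list \<Rightarrow> 'k"
  where "qform fs qs = prod_list (map2 (\<lambda>f q. f (rep q)) fs qs)"

lemma qform_simps [simp]: "qform [] qs = 1" "qform (f # fs) (q # qs) = f (rep q) * qform fs qs"
  by (simp_all add: qform_def)

lemma qform_add:
  assumes "a \<in> Qc" "b \<in> Qc" "\<And>f. f \<in> set fs \<Longrightarrow> Q_dual f" "length fs = length xs + length ys + 1"
  shows "qform fs (xs @ Qadd a b # ys) = qform fs (xs @ a # ys) + qform fs (xs @ b # ys)"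
  using assms(3,4)
proof (induction xs arbitrary: fs)
  case Nil
  then obtain f fs' where fs: "fs = f # fs'" by (cases fs) auto
  obtain x y where "a = qc x" "b = qc y" using assms(1,2) Q_cases by metis
  then have "f (rep (Qadd a b)) = f (rep a) + f (rep b)"
    using Nil fs by (simp add: Qadd_qc Q_dual_rep linD(1) Q_dualD)
  then show ?case by (simp add: fs distrib_right)
next
  case (Cons z xs)
  then obtain f fs' where fs: "fs = f # fs'" by (cases fs) auto
  then show ?case using Cons by (simp add: distrib_left)
qed

lemma qform_scale:
  assumes "a \<in> Qc" "\<And>f. f \<in> set fs \<Longrightarrow> Q_dual f" "length fs = length xs + length ys + 1"
  shows "qform fs (xs @ Qscale c a # ys) = c * qform fs (xs @ a # ys)"
  using assms(2,3)
proof (induction xs arbitrary: fs)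
  case Nil
  then obtain f fs' where fs: "fs = f # fs'" by (cases fs) auto
  obtain x where "a = qc x" using assms(1) Q_cases by metis
  then have "f (rep (Qscale c a)) = c * f (rep a)"
    using Nil fs by (simp add: Qscale_qc Q_dual_rep linD(2) Q_dualD)
  then show ?case by (simp add: fs mult.assoc)
next
  case (Cons z xs)
  then obtain f fs' where fs: "fs = f # fs'" by (cases fs) auto
  then show ?case using Cons by (simp add: mult.left_commute)
qed

lemma qform_rel:
  assumes "\<And>f. f \<in> set fs \<Longrightarrow> Q_dual f" "length fs = n" "t \<in> Qpow_rel scale \<epsilon> R n"
  shows "lin_ext (*) (qform fs) t = 0"
proof -
  have "lin_ext (*) (qform fs) t \<in> {0}"
  proof (rule base_field.lin_ext_span_zero)
    show "t \<in> module.span pscale (multilin_rels Qc Qadd Qscale n)"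
      using assms(3) by (simp add: Qpow_rel_def)
    fix t assume "t \<in> multilin_rels Qc Qadd Qscale n"
    then show "lin_ext (*) (qform fs) t \<in> {0}"
      unfolding multilin_rels_def words_def
      using assms(1,2) by (auto simp: base_field.lin_ext_diff qform_add qform_scale)
  qed (simp add: base_field.subspace_def)
  then show ?thesis by simp
qed

lemma diag_act_free:
  "set qs \<subseteq> Qc \<Longrightarrow> diag_act scale \<Delta> \<epsilon> R qs r \<in> free_on (words Qc (length qs))"
proof (induction qs arbitrary: r)
  case Nil
  show ?case by (simp add: words_def single_in_free_on)
next
  case (Cons q qs)
  obtain x where x: "q = qc x" using Cons.prems Q_cases by (metis list.set_intros(1) subsetD)
  show ?case
    unfolding diag_act.simps
  proof (rule pm.lin_ext_in_subspace [OF free_on_subspace])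
    fix xs
    let ?t = "diag_act scale \<Delta> \<epsilon> R qs (xs ! 1)"
    have t: "?t \<in> free_on (words Qc (length qs))" using Cons by simp
    have "lin_ext pscale (\<lambda>ys. Poly_Mapping.single ([Qact q (xs ! 0)] @ ys) (1 :: 'k)) ?t
        \<in> free_on (words Qc (length (q # qs)))"
    proof (rule pm.lin_ext_in_subspace [OF free_on_subspace])
      fix ys assume "ys \<in> Poly_Mapping.keys ?t"
      then have "ys \<in> words Qc (length qs)" using t by (auto simp: free_on_def)
      then show "Poly_Mapping.single ([Qact q (xs ! 0)] @ ys) (1 :: 'k) \<in> free_on (words Qc (length (q # qs)))"
        by (intro single_in_free_on) (simp add: words_def x Qact_qc)
    qed
    then show "tconc (Poly_Mapping.single [Qact q (xs ! 0)] 1) ?t \<in> free_on (words Qc (length (q # qs)))"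
      by (simp add: tconc_def)
  qed
qed

lemma qform_diag_act:
  assumes "set qs \<subseteq> Qc" "\<And>f. f \<in> set fs \<Longrightarrow> Q_dual f" "length fs = length qs"
  shows "lin_ext (*) (qform fs) (diag_act scale \<Delta> \<epsilon> R qs r) = coef (zip fs (map rep qs)) r"
  using assms
proof (induction qs arbitrary: fs r)
  case Nil
  then show ?case by simp
next
  case (Cons q qs)
  then obtain f fs' where fs: "fs = f # fs'" by (cases fs) auto
  have f: "Q_dual f" using Cons.prems fs by simp
  have IH: "lin_ext (*) (qform fs') (diag_act scale \<Delta> \<epsilon> R qs r) = coef (zip fs' (map rep qs)) r" for r
    using Cons fs by simp
  have act: "f (rep (Qact q a)) = f (rep q * a)" for a
    using Qact_qc [of "rep q" a] Cons.prems(1) Q_dual_rep [OF f] by simp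
  have "lin_ext (*) (qform fs) (tconc (Poly_Mapping.single [Qact q a] 1) t) =
      f (rep q * a) * lin_ext (*) (qform fs') t" for a t
    by (simp add: tconc_def base_field.lin_ext_lin_ext fs act, simp add: lin_ext_def sum_distrib_left mult.left_commute)
  then show ?case
    by (simp add: base_field.lin_ext_lin_ext IH fs sw_def)
qed

lemma Qpow_rel_subspace: "module.subspace pscale (Qpow_rel scale \<epsilon> R n)"
  by (simp add: Qpow_rel_def)

text \<open>Induction on the index set, with one additivity and one homogeneity relation for each
  summand.\<close>

lemma slot_expand:
  assumes "finite C" "set xs \<subseteq> Qc" "set ys \<subseteq> Qc" "length xs + length ys + 1 = n"
  shows "Poly_Mapping.single (xs @ qc (\<Sum>c\<in>C. scale (\<kappa> c) c) # ys) (1 :: 'k)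
    - (\<Sum>c\<in>C. Poly_Mapping.single (xs @ qc c # ys) (\<kappa> c)) \<in> Qpow_rel scale \<epsilon> R n"
  using assms(1)
proof (induction C)
  case empty
  have w: "xs @ qc 0 # ys \<in> words Qc n" using assms by (auto simp: words_def)
  \<comment> \<open>The empty sum is the zero vector, written as 0 times itself to match a
    homogeneity relation.\<close>
  have "Poly_Mapping.single (xs @ Qscale 0 (qc 0) # ys) (1 :: 'k) - Poly_Mapping.single (xs @ qc 0 # ys) 0
      \<in> multilin_rels Qc Qadd Qscale n"
    unfolding multilin_rels_def using w by blast
  then show ?case unfolding Qpow_rel_def by (auto simp: Qscale_qc intro: pm.span_base)
next
  case (insert c C)
  let ?s = "\<Sum>c\<in>C. scale (\<kappa> c) c"
  have w: "xs @ qc x # ys \<in> words Qc n" for x using assms by (auto simp: words_def)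
  have "Poly_Mapping.single (xs @ Qadd (qc (scale (\<kappa> c) c)) (qc ?s) # ys) (1 :: 'k)
      - Poly_Mapping.single (xs @ qc (scale (\<kappa> c) c) # ys) 1 - Poly_Mapping.single (xs @ qc ?s # ys) 1
      \<in> multilin_rels Qc Qadd Qscale n"
    unfolding multilin_rels_def using w qc_in by blast
  then have 1: "Poly_Mapping.single (xs @ qc (scale (\<kappa> c) c + ?s) # ys) (1 :: 'k)
      - Poly_Mapping.single (xs @ qc (scale (\<kappa> c) c) # ys) 1 - Poly_Mapping.single (xs @ qc ?s # ys) 1
      \<in> Qpow_rel scale \<epsilon> R n"
    unfolding Qpow_rel_def by (auto simp: Qadd_qc intro: pm.span_base)
  have "Poly_Mapping.single (xs @ Qscale (\<kappa> c) (qc c) # ys) (1 :: 'k) - Poly_Mapping.single (xs @ qc c # ys) (\<kappa> c)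
      \<in> multilin_rels Qc Qadd Qscale n"
    unfolding multilin_rels_def using w by blast
  then have 2: "Poly_Mapping.single (xs @ qc (scale (\<kappa> c) c) # ys) (1 :: 'k) - Poly_Mapping.single (xs @ qc c # ys) (\<kappa> c)
      \<in> Qpow_rel scale \<epsilon> R n"
    unfolding Qpow_rel_def by (auto simp: Qscale_qc intro: pm.span_base)
  from pm.subspace_add [OF Qpow_rel_subspace pm.subspace_add [OF Qpow_rel_subspace 1 2] insert.IH]
  show ?case using insert.hyps by (simp add: algebra_simps)
qed

definition lists_of :: "'x set \<Rightarrow> nat \<Rightarrow> 'x list set"
  where "lists_of C n = {cs. set cs \<subseteq> C \<and> length cs = n}"

lemma sum_lists_of_Suc:
  "(\<Sum>cs\<in>lists_of C (Suc n). F cs) = (\<Sum>c\<in>C. \<Sum>cs\<in>lists_of C n. F (c # cs))"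
proof -
  have "lists_of C (Suc n) = (\<lambda>(c, cs). c # cs) ` (C \<times> lists_of C n)"
    by (auto simp: lists_of_def length_Suc_conv image_iff)
  moreover have "inj_on (\<lambda>(c, cs). c # cs) (C \<times> lists_of C n)" by (auto simp: inj_on_def)
  ultimately have "(\<Sum>cs\<in>lists_of C (Suc n). F cs) = (\<Sum>p\<in>C \<times> lists_of C n. F (case p of (c, cs) \<Rightarrow> c # cs))"
    by (simp only: sum.reindex comp_def)
  then show ?thesis by (simp add: sum.cartesian_product case_prod_unfold)
qed

text \<open>Slot by slot, each coset is replaced by its expansion in the lifted basis. The prefix
  \<open>xs\<close> collects the finished slots, so it has to be arbitrary in the induction on
  \<open>qs\<close>.\<close>

lemma word_expand:
  assumes C: "finite C" "\<And>x. x - (\<Sum>c\<in>C. scale (d c x) c) \<in> RpH"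
    and "set xs \<subseteq> Qc" "set qs \<subseteq> Qc" "length xs + length qs = n"
  shows "Poly_Mapping.single (xs @ qs) (1 :: 'k)
      - (\<Sum>cs\<in>lists_of C (length qs). Poly_Mapping.single (xs @ map qc cs) (qform (map d cs) qs))
    \<in> Qpow_rel scale \<epsilon> R n"
  using assms(3-)
proof (induction qs arbitrary: xs)
  case Nil
  have "lists_of C 0 = {[]}" by (auto simp: lists_of_def)
  then show ?case by (simp add: pm.subspace_0 [OF Qpow_rel_subspace])
next
  case (Cons q qs)
  let ?rel = "Qpow_rel scale \<epsilon> R n"
  let ?F = "\<lambda>c cs. Poly_Mapping.single (xs @ qc c # map qc cs) (qform (map d cs) qs)"
  have q: "q = qc (\<Sum>c\<in>C. scale (d c (rep q)) c)"
    using C(2) [of "rep q"] Cons.prems(2) qc_rep [of q] qc_eq_iff by (metis list.set_intros(1) subsetD)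
  have 1: "Poly_Mapping.single (xs @ q # qs) (1 :: 'k)
      - (\<Sum>c\<in>C. Poly_Mapping.single (xs @ qc c # qs) (d c (rep q))) \<in> ?rel"
    by (subst (1) q) (rule slot_expand, use C Cons.prems in auto)
  have "pscale (d c (rep q)) (Poly_Mapping.single (xs @ qc c # qs) 1 - (\<Sum>cs\<in>lists_of C (length qs). ?F c cs)) \<in> ?rel" for c
    using Cons.IH [of "xs @ [qc c]"] Cons.prems by (intro pm.subspace_scale [OF Qpow_rel_subspace]) simp
  then have "(\<Sum>c\<in>C. pscale (d c (rep q)) (Poly_Mapping.single (xs @ qc c # qs) 1 - (\<Sum>cs\<in>lists_of C (length qs). ?F c cs))) \<in> ?rel"
    by (intro pm.subspace_sum [OF Qpow_rel_subspace])
  from pm.subspace_add [OF Qpow_rel_subspace 1 this]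
  show ?case
    by (simp add: sum_lists_of_Suc pm.scale_right_diff_distrib pm.scale_sum_right pscale_single sum_subtractf)
qed

text \<open>Pure tensors of functionals separate the points of a tensor power of \<open>Q\<close>:
  after \<open>word_expand\<close>, the coefficient of each basis word in \<open>t\<close> is the
  value of such a functional on \<open>t\<close>, hence zero.\<close>

lemma qform_separates:
  assumes t: "t \<in> free_on (words Qc n)"
    and zero: "\<And>fs. (\<And>f. f \<in> set fs \<Longrightarrow> Q_dual f) \<Longrightarrow> length fs = n \<Longrightarrow> lin_ext (*) (qform fs) t = 0"
  shows "t \<in> Qpow_rel scale \<epsilon> R n"
proof -
  obtain C d where C: "finite C" "\<And>c. c \<in> C \<Longrightarrow> Q_dual (d c)"
      "\<And>x. x - (\<Sum>c\<in>C. scale (d c x) c) \<in> RpH"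
    using Q_dual_basis by metis
  let ?rel = "Qpow_rel scale \<epsilon> R n" and ?l = "Poly_Mapping.lookup t"
  have "pscale (?l qs) (Poly_Mapping.single qs 1
      - (\<Sum>cs\<in>lists_of C n. Poly_Mapping.single (map qc cs) (qform (map d cs) qs))) \<in> ?rel"
    if qs: "qs \<in> Poly_Mapping.keys t" for qs
  proof -
    have "set qs \<subseteq> Qc" "length qs = n" using t qs by (auto simp: free_on_def words_def)
    then show ?thesis
      using word_expand [OF C(1,3), of "[]" qs n] by (intro pm.subspace_scale [OF Qpow_rel_subspace]) simp
  qed
  then have "(\<Sum>qs\<in>Poly_Mapping.keys t. pscale (?l qs) (Poly_Mapping.single qs 1
      - (\<Sum>cs\<in>lists_of C n. Poly_Mapping.single (map qc cs) (qform (map d cs) qs)))) \<in> ?rel"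
    by (intro pm.subspace_sum [OF Qpow_rel_subspace])
  moreover have "(\<Sum>qs\<in>Poly_Mapping.keys t. \<Sum>cs\<in>lists_of C n.
      Poly_Mapping.single (map qc cs) (?l qs * qform (map d cs) qs)) = 0"
  proof -
    have "(\<Sum>qs\<in>Poly_Mapping.keys t. Poly_Mapping.single (map qc cs) (?l qs * qform (map d cs) qs)) = 0"
      if cs: "cs \<in> lists_of C n" for cs
    proof -
      have "(\<Sum>qs\<in>Poly_Mapping.keys t. Poly_Mapping.single (map qc cs) (?l qs * qform (map d cs) qs)) =
          Poly_Mapping.single (map qc cs) (lin_ext (*) (qform (map d cs)) t)"
        by (rule poly_mapping_eqI) (simp add: lookup_sum_apply lookup_single when_def lin_ext_def)
      also have "lin_ext (*) (qform (map d cs)) t = 0"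
        using cs C(2) by (intro zero) (auto simp: lists_of_def)
      finally show ?thesis by simp
    qed
    then show ?thesis by (subst sum.swap) simp
  qed
  ultimately show ?thesis
    by (simp add: pm.scale_right_diff_distrib pm.scale_sum_right pscale_single sum_subtractf
        poly_mapping_eq_sum [symmetric])
qed

text \<open>In one direction pure tensors of functionals vanish on the relations, in the other they
  separate points; on a diagonal action they evaluate to \<open>coef\<close>.\<close>

lemma Ann_Qpow_eq: "Ann_Qpow scale \<Delta> \<epsilon> R n = R \<inter> coef_ann n"
proof -
  let ?U = "free_on (words Qc n) :: ('h set list \<Rightarrow>\<^sub>0 'k) set" and ?rel = "Qpow_rel scale \<epsilon> R n"
  let ?cl = "Qpow_class scale \<epsilon> R n" and ?act = "Qpow_act scale \<Delta> \<epsilon> R n"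
  interpret cq: coset_quotient ?U ?rel
    unfolding Qpow_rel_def by (rule coset_quotient_free)
  have 0: "0 \<in> ?U" by (rule pm.subspace_0 [OF free_on_subspace])
  have class_0: "t \<in> ?rel \<longleftrightarrow> ?cl t = ?cl 0" if "t \<in> ?U" for t
    unfolding Qpow_class_def using cq.qclass_eq_iff [OF that 0] by simp
  have diag: "(\<forall>qs\<in>words Qc n. diag_act scale \<Delta> \<epsilon> R qs r \<in> ?rel) \<longleftrightarrow> r \<in> coef_ann n" for r
  proof
    assume rel: "\<forall>qs\<in>words Qc n. diag_act scale \<Delta> \<epsilon> R qs r \<in> ?rel"
    show "r \<in> coef_ann n"
    proof (rule coef_annI)
      fix ps assume ps: "ps \<in> Q_pairs n"
      let ?qs = "map (\<lambda>p. qc (snd p)) ps"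
      have "?qs \<in> words Qc n" using ps by (auto simp: words_def Q_pairs_def)
      then have "lin_ext (*) (qform (map fst ps)) (diag_act scale \<Delta> \<epsilon> R ?qs r) = 0"
        using rel ps by (intro qform_rel [of _ n]) (auto simp: Q_pairs_def)
      then have "coef (zip (map fst ps) (map rep ?qs)) r = 0"
        using ps by (subst (asm) qform_diag_act) (auto simp: Q_pairs_def)
      \<comment> \<open>Passing through cosets has replaced each \<open>snd p\<close> by the element
        chosen from its coset; functionals on \<open>Q\<close> do not see the change.\<close>
      moreover have "coef (zip (map fst ps) (map rep (map (\<lambda>p. qc (snd p)) ps))) r = coef ps r"
        if "\<And>p. p \<in> set ps \<Longrightarrow> Q_dual (fst p)" for ps r
        using that
      proof (induction ps arbitrary: r)
        case (Cons p ps)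
        have p: "Q_dual (fst p)" using Cons.prems by simp
        have "fst p (rep (qc (snd p)) * a) = fst p (snd p * a)" for a
        proof -
          have "qc (rep (qc (snd p)) * a) = qc (snd p * a)"
            using Qact_qc [of "rep (qc (snd p))" a] Qact_qc [of "snd p" a] by simp
          then show ?thesis using Q_dual_rep [OF p] by metis
        qed
        moreover have "coef (zip (map fst ps) (map rep (map (\<lambda>p. qc (snd p)) ps))) b = coef ps b" for b
          using Cons by (intro Cons.IH) simp
        ultimately show ?case by simp
      qed simp
      ultimately show "coef ps r = 0" using ps by (simp add: Q_pairs_def)
    qed
  next
    assume r: "r \<in> coef_ann n"
    show "\<forall>qs\<in>words Qc n. diag_act scale \<Delta> \<epsilon> R qs r \<in> ?rel"
    proof
      fix qs assume qs: "qs \<in> words Qc n"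
      then have len: "length qs = n" "set qs \<subseteq> Qc" by (auto simp: words_def)
      show "diag_act scale \<Delta> \<epsilon> R qs r \<in> ?rel"
      proof (rule qform_separates)
        show "diag_act scale \<Delta> \<epsilon> R qs r \<in> ?U" using diag_act_free [OF len(2)] len by simp
        fix fs assume fs: "\<And>f. f \<in> set fs \<Longrightarrow> Q_dual f" "length fs = n"
        have "zip fs (map rep qs) \<in> Q_pairs n"
          using fs len by (auto simp: Q_pairs_def dest: set_zip_leftD)
        with coef_annD [OF r] show "lin_ext (*) (qform fs) (diag_act scale \<Delta> \<epsilon> R qs r) = 0"
          using fs len by (subst qform_diag_act) auto
      qed
    qed
  qed
  have "(\<forall>W\<in>Qpow_carrier scale \<epsilon> R n. ?act W r = ?cl 0) \<longleftrightarrow>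
      (\<forall>qs\<in>words Qc n. diag_act scale \<Delta> \<epsilon> R qs r \<in> ?rel)" for r
  proof
    assume ann: "\<forall>W\<in>Qpow_carrier scale \<epsilon> R n. ?act W r = ?cl 0"
    show "\<forall>qs\<in>words Qc n. diag_act scale \<Delta> \<epsilon> R qs r \<in> ?rel"
    proof
      fix qs assume qs: "qs \<in> words Qc n"
      let ?s = "Poly_Mapping.single qs (1 :: 'k)" and ?t = "diag_act scale \<Delta> \<epsilon> R qs r"
      have s: "?s \<in> ?U" using qs by (rule single_in_free_on)
      have t: "?t \<in> ?U" using diag_act_free [of qs r] qs by (auto simp: words_def)
      have "?act (?cl ?s) r = ?cl 0"
        using ann cq.qclass_in [OF s] by (simp add: Qpow_carrier_def Qpow_class_def)
      \<comment> \<open>The action on a coset is a union over its elements, and the element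
        \<open>?s\<close> contributes the coset of \<open>?t\<close>.\<close>
      moreover have "?cl ?t \<subseteq> ?act (?cl ?s) r"
      proof -
        have "?s \<in> ?cl ?s" unfolding Qpow_class_def by (rule cq.qclass_self [OF s])
        then show ?thesis unfolding Qpow_act_def by (rule UN_upper [THEN order_trans [rotated]]) simp
      qed
      ultimately have "?t \<in> ?cl 0" using cq.qclass_self [OF t] by (auto simp: Qpow_class_def)
      then have "0 - ?t \<in> ?rel" unfolding Qpow_class_def by (subst (asm) cq.mem_qclass_iff [OF 0]) simp
      then show "?t \<in> ?rel" using cq.N_minus [of "0 - ?t"] by simp
    qed
  next
    assume rel: "\<forall>qs\<in>words Qc n. diag_act scale \<Delta> \<epsilon> R qs r \<in> ?rel"
    show "\<forall>W\<in>Qpow_carrier scale \<epsilon> R n. ?act W r = ?cl 0"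
    proof
      fix W assume "W \<in> Qpow_carrier scale \<epsilon> R n"
      then obtain f where f: "f \<in> ?U" "W = ?cl f"
        unfolding Qpow_carrier_def Qpow_class_def by (rule cq.quotient_cases)
      have "?cl (lin_ext pscale (\<lambda>qs. diag_act scale \<Delta> \<epsilon> R qs r) f') = ?cl 0" if "f' \<in> W" for f'
      proof -
        have f': "f' \<in> ?U" using that f(1) unfolding f(2) Qpow_class_def by (simp add: cq.mem_qclass_iff)
        have keys: "qs \<in> words Qc n" if "qs \<in> Poly_Mapping.keys f'" for qs
          using f' that by (auto simp: free_on_def)
        have "lin_ext pscale (\<lambda>qs. diag_act scale \<Delta> \<epsilon> R qs r) f' \<in> ?rel"
          using rel keys by (intro pm.lin_ext_in_subspace [OF Qpow_rel_subspace]) blast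
        moreover have "lin_ext pscale (\<lambda>qs. diag_act scale \<Delta> \<epsilon> R qs r) f' \<in> ?U"
        proof (rule pm.lin_ext_in_subspace [OF free_on_subspace])
          fix qs assume "qs \<in> Poly_Mapping.keys f'"
          then have "length qs = n" "set qs \<subseteq> Qc" using keys [of qs] by (auto simp: words_def)
          then show "diag_act scale \<Delta> \<epsilon> R qs r \<in> ?U" using diag_act_free by metis
        qed
        ultimately show ?thesis using class_0 by blast
      qed
      moreover have "f \<in> W" unfolding f(2) Qpow_class_def by (rule cq.qclass_self [OF f(1)])
      ultimately show "?act W r = ?cl 0" unfolding Qpow_act_def by blast
    qed
  qed
  then show ?thesis by (auto simp: Ann_Qpow_def diag)
qed

end

section \<open>Direct summands of bimodules\<close>

text \<open>The additive facts used in splitting off a summand. The record has no negation;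
  \<open>ex_neg\<close> supplies it as the action of an element of \<open>L\<close>, which is
  \<open>scale (- 1) 1\<close> for the tensor powers.\<close>

locale additive_bimodule =
  fixes L R :: "'a set" and M :: "('a, 'm) bimod"
  assumes zero_closed: "bzero M \<in> bcarrier M"
    and add_closed: "x \<in> bcarrier M \<Longrightarrow> y \<in> bcarrier M \<Longrightarrow> badd M x y \<in> bcarrier M"
    and lact_closed: "a \<in> L \<Longrightarrow> x \<in> bcarrier M \<Longrightarrow> blact M a x \<in> bcarrier M"
    and ract_closed: "a \<in> R \<Longrightarrow> x \<in> bcarrier M \<Longrightarrow> bract M x a \<in> bcarrier M"
    and add_assoc: "x \<in> bcarrier M \<Longrightarrow> y \<in> bcarrier M \<Longrightarrow> z \<in> bcarrier M \<Longrightarrow>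
      badd M (badd M x y) z = badd M x (badd M y z)"
    and add_commute: "x \<in> bcarrier M \<Longrightarrow> y \<in> bcarrier M \<Longrightarrow> badd M x y = badd M y x"
    and add_zero: "x \<in> bcarrier M \<Longrightarrow> badd M x (bzero M) = x"
    and lact_add: "a \<in> L \<Longrightarrow> x \<in> bcarrier M \<Longrightarrow> y \<in> bcarrier M \<Longrightarrow>
      blact M a (badd M x y) = badd M (blact M a x) (blact M a y)"
    and ract_add: "a \<in> R \<Longrightarrow> x \<in> bcarrier M \<Longrightarrow> y \<in> bcarrier M \<Longrightarrow>
      bract M (badd M x y) a = badd M (bract M x a) (bract M y a)"
    and lact_zero: "a \<in> L \<Longrightarrow> blact M a (bzero M) = bzero M"
    and ract_zero: "a \<in> R \<Longrightarrow> bract M (bzero M) a = bzero M"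
    and ex_neg: "\<exists>m\<in>L. \<forall>x\<in>bcarrier M. badd M x (blact M m x) = bzero M"
begin

lemma zero_add: "x \<in> bcarrier M \<Longrightarrow> badd M (bzero M) x = x"
  using add_zero add_commute zero_closed by metis

lemma copies: "additive_bimodule L R (copies q M)"
proof
  obtain m where m: "m \<in> L" "\<forall>x\<in>bcarrier M. badd M x (blact M m x) = bzero M"
    using ex_neg by blast
  have nth: "x ! i \<in> bcarrier M" if "x \<in> words (bcarrier M) q" "i < q" for x i
    using that by (auto simp: words_def)
  have wordsI: "x \<in> words (bcarrier M) q" if "length x = q" "\<And>i. i < q \<Longrightarrow> x ! i \<in> bcarrier M" for x
    using that by (auto simp: words_def set_conv_nth)
  have len: "length x = q" if "x \<in> words (bcarrier M) q" for x
    using that by (simp add: words_def)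
  note defs = copies_def bimod.simps
  show "bzero (copies q M) \<in> bcarrier (copies q M)"
    unfolding defs by (rule wordsI) (simp_all add: zero_closed)
  show "badd (copies q M) x y \<in> bcarrier (copies q M)"
    if "x \<in> bcarrier (copies q M)" "y \<in> bcarrier (copies q M)" for x y
    using that unfolding defs by (intro wordsI) (simp_all add: len nth add_closed)
  show "blact (copies q M) a x \<in> bcarrier (copies q M)"
    if "a \<in> L" "x \<in> bcarrier (copies q M)" for a x
    using that unfolding defs by (intro wordsI) (simp_all add: len nth lact_closed)
  show "bract (copies q M) x a \<in> bcarrier (copies q M)"
    if "a \<in> R" "x \<in> bcarrier (copies q M)" for a x
    using that unfolding defs by (intro wordsI) (simp_all add: len nth ract_closed)
  show "badd (copies q M) (badd (copies q M) x y) z = badd (copies q M) x (badd (copies q M) y z)"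
    if "x \<in> bcarrier (copies q M)" "y \<in> bcarrier (copies q M)" "z \<in> bcarrier (copies q M)" for x y z
    using that unfolding defs by (intro nth_equalityI) (simp_all add: len nth add_assoc)
  show "badd (copies q M) x y = badd (copies q M) y x"
    if "x \<in> bcarrier (copies q M)" "y \<in> bcarrier (copies q M)" for x y
    using that unfolding defs by (intro nth_equalityI) (simp_all add: len nth add_commute)
  show "badd (copies q M) x (bzero (copies q M)) = x"
    if "x \<in> bcarrier (copies q M)" for x
    using that unfolding defs by (intro nth_equalityI) (simp_all add: len nth add_zero)
  show "blact (copies q M) a (badd (copies q M) x y) =
      badd (copies q M) (blact (copies q M) a x) (blact (copies q M) a y)"
    if "a \<in> L" "x \<in> bcarrier (copies q M)" "y \<in> bcarrier (copies q M)" for a x y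
    using that unfolding defs by (intro nth_equalityI) (simp_all add: len nth lact_add)
  show "bract (copies q M) (badd (copies q M) x y) a =
      badd (copies q M) (bract (copies q M) x a) (bract (copies q M) y a)"
    if "a \<in> R" "x \<in> bcarrier (copies q M)" "y \<in> bcarrier (copies q M)" for a x y
    using that unfolding defs by (intro nth_equalityI) (simp_all add: len nth ract_add)
  show "blact (copies q M) a (bzero (copies q M)) = bzero (copies q M)" if "a \<in> L" for a
    using that unfolding defs by (simp add: lact_zero)
  show "bract (copies q M) (bzero (copies q M)) a = bzero (copies q M)" if "a \<in> R" for a
    using that unfolding defs by (simp add: ract_zero)
  have "badd (copies q M) x (blact (copies q M) m x) = bzero (copies q M)"
    if "x \<in> bcarrier (copies q M)" for x
    using that unfolding defs by (intro nth_equalityI) (simp_all add: len nth m)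
  with m(1) show "\<exists>m\<in>L. \<forall>x\<in>bcarrier (copies q M).
      badd (copies q M) x (blact (copies q M) m x) = bzero (copies q M)"
    by blast
qed

text \<open>The difference u - u' = w' - w lies in both submodules. It is formed with the element of
  \<open>L\<close> that acts as negation, under which both are closed.\<close>

lemma decomposition_unique:
  assumes U: "subbimod L R M U" and W: "subbimod L R M W" and UW: "U \<inter> W = {bzero M}"
    and mem: "u \<in> U" "u' \<in> U" "w \<in> W" "w' \<in> W" and eq: "badd M u w = badd M u' w'"
  shows "u = u'"
proof -
  obtain m where m: "m \<in> L" "\<And>x. x \<in> bcarrier M \<Longrightarrow> badd M x (blact M m x) = bzero M"
    using ex_neg by blast
  let ?n = "blact M m"
  have c: "u \<in> bcarrier M" "u' \<in> bcarrier M" "w \<in> bcarrier M" "w' \<in> bcarrier M"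
    using U W mem unfolding subbimod_def by blast+
  have nc: "?n x \<in> bcarrier M" if "x \<in> bcarrier M" for x using that m(1) by (rule lact_closed [rotated])
  let ?d = "badd M u (?n u')"
  have dU: "?d \<in> U" using U mem m(1) unfolding subbimod_def by blast
  have dW: "badd M w' (?n w) \<in> W" using W mem m(1) unfolding subbimod_def by blast
  have "?d = badd M ?d (badd M w (?n w))"
    using c nc by (simp add: m(2) add_zero add_closed)
  also have "\<dots> = badd M (badd M (badd M u w) (?n u')) (?n w)"
    using c nc by (smt (verit, ccfv_SIG) add_assoc add_closed add_commute)
  also have "\<dots> = badd M (badd M (badd M u' w') (?n u')) (?n w)" by (simp add: eq)
  also have "\<dots> = badd M (badd M (badd M u' (?n u')) w') (?n w)"
    using c nc by (smt (verit, ccfv_SIG) add_assoc add_closed add_commute)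
  also have "\<dots> = badd M w' (?n w)"
    using c nc by (metis m(2) add_zero add_commute zero_closed)
  finally have "?d = bzero M" using dU dW UW by auto
  then have "badd M (badd M u (?n u')) u' = u'"
    using c by (metis add_zero add_commute zero_closed)
  moreover have "badd M (badd M u (?n u')) u' = u"
    using c nc by (metis add_assoc add_commute m(2) add_zero)
  ultimately show ?thesis by simp
qed

end

text \<open>The maps \<phi> are the coordinates of the embedding, the maps \<psi> include one copy
  and project it onto the summand, and their composites add up to the identity of \<open>X\<close>.
  This is stated after an additive functional, so that the sum is taken in an ordinary
  group.\<close>

lemma iso_direct_summand_copies_split:
  fixes X :: "('a, 'm) bimod" and Y :: "('a, 'n) bimod"
  assumes X: "additive_bimodule L R X" and Y: "additive_bimodule L R Y"
    and iso: "iso_direct_summand L R X (copies q Y)"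
  obtains \<phi> \<psi> where "\<And>i. i < q \<Longrightarrow> bimod_hom L R X Y (\<phi> i)" "\<And>i. i < q \<Longrightarrow> bimod_hom L R Y X (\<psi> i)"
    "\<And>(\<gamma> :: 'm \<Rightarrow> 'k::ab_group_add) x.
      \<forall>x\<in>bcarrier X. \<forall>y\<in>bcarrier X. \<gamma> (badd X x y) = \<gamma> x + \<gamma> y \<Longrightarrow>
      x \<in> bcarrier X \<Longrightarrow> \<gamma> x = (\<Sum>i<q. \<gamma> (\<psi> i (\<phi> i x)))"
proof -
  interpret X: additive_bimodule L R X by fact
  interpret Y: additive_bimodule L R Y by fact
  let ?Z = "copies q Y"
  interpret Z: additive_bimodule L R ?Z by (rule Y.copies)
  obtain U W f where U: "subbimod L R ?Z U" and W: "subbimod L R ?Z W"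
    and UW: "U \<inter> W = {bzero ?Z}" and dec: "{badd ?Z u w | u w. u \<in> U \<and> w \<in> W} = bcarrier ?Z"
    and f: "bimod_hom L R X ?Z f" and bij: "bij_betw f (bcarrier X) U"
    using iso unfolding iso_direct_summand_def by blast
  have UZ: "u \<in> bcarrier ?Z" if "u \<in> U" for u using U that unfolding subbimod_def by blast
  have WZ: "u \<in> bcarrier ?Z" if "u \<in> W" for u using W that unfolding subbimod_def by blast
  \<comment> \<open>Projection onto \<open>U\<close> along \<open>W\<close>; uniqueness of the
    decomposition makes it compatible with sums and with both actions.\<close>
  define pr where "pr = (\<lambda>z. SOME u. u \<in> U \<and> (\<exists>w\<in>W. z = badd ?Z u w))"
  have pr_eq: "pr (badd ?Z u w) = u" if uw: "u \<in> U" "w \<in> W" for u w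
    unfolding pr_def
  proof (rule some_equality)
    fix v assume "v \<in> U \<and> (\<exists>w'\<in>W. badd ?Z u w = badd ?Z v w')"
    then show "v = u" using Z.decomposition_unique [OF U W UW] uw by metis
  qed (use uw in blast)
  have decE: "\<exists>u w. u \<in> U \<and> w \<in> W \<and> z = badd ?Z u w" if "z \<in> bcarrier ?Z" for z
    using that dec by blast
  have pr_U: "pr z \<in> U" if "z \<in> bcarrier ?Z" for z using decE [OF that] pr_eq by metis
  have pr_id: "pr u = u" if "u \<in> U" for u
    using pr_eq [OF that, of "bzero ?Z"] W that UZ Z.add_zero unfolding subbimod_def by metis
  have pr_add: "pr (badd ?Z y z) = badd ?Z (pr y) (pr z)"
    if yz: "y \<in> bcarrier ?Z" "z \<in> bcarrier ?Z" for y z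
  proof -
    obtain u w u' w' where 1: "u \<in> U" "w \<in> W" "y = badd ?Z u w" "u' \<in> U" "w' \<in> W" "z = badd ?Z u' w'"
      using yz decE by metis
    have c: "u \<in> bcarrier ?Z" "w \<in> bcarrier ?Z" "u' \<in> bcarrier ?Z" "w' \<in> bcarrier ?Z"
      using 1 UZ WZ by blast+
    have "badd ?Z y z = badd ?Z (badd ?Z u u') (badd ?Z w w')"
      unfolding 1 using c by (smt (verit, ccfv_SIG) Z.add_assoc Z.add_closed Z.add_commute)
    moreover have "badd ?Z u u' \<in> U" "badd ?Z w w' \<in> W"
      using 1 U W unfolding subbimod_def by blast+
    ultimately show ?thesis using pr_eq 1 by metis
  qed
  have pr_lact: "pr (blact ?Z a z) = blact ?Z a (pr z)" if az: "a \<in> L" "z \<in> bcarrier ?Z" for a z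
  proof -
    obtain u w where 1: "u \<in> U" "w \<in> W" "z = badd ?Z u w" using az decE by metis
    moreover have "blact ?Z a u \<in> U" "blact ?Z a w \<in> W"
      using 1 az U W unfolding subbimod_def by blast+
    ultimately show ?thesis using pr_eq az UZ WZ Z.lact_add by metis
  qed
  have pr_ract: "pr (bract ?Z z a) = bract ?Z (pr z) a" if az: "a \<in> R" "z \<in> bcarrier ?Z" for a z
  proof -
    obtain u w where 1: "u \<in> U" "w \<in> W" "z = badd ?Z u w" using az decE by metis
    moreover have "bract ?Z u a \<in> U" "bract ?Z w a \<in> W"
      using 1 az U W unfolding subbimod_def by blast+
    ultimately show ?thesis using pr_eq az UZ WZ Z.ract_add by metis
  qed
  define g where "g = inv_into (bcarrier X) f"
  have gX: "g u \<in> bcarrier X" and fg: "f (g u) = u" if "u \<in> U" for u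
    using bij that unfolding g_def bij_betw_def by (auto intro: inv_into_into f_inv_into_f)
  have gf: "g (f x) = x" if "x \<in> bcarrier X" for x
    using bij that unfolding g_def bij_betw_def by (auto intro: inv_into_f_f)
  have fU: "f x \<in> U" if "x \<in> bcarrier X" for x using bij that unfolding bij_betw_def by blast
  have g_add: "g (badd ?Z u v) = badd X (g u) (g v)" if "u \<in> U" "v \<in> U" for u v
    using that f gX fg gf X.add_closed unfolding bimod_hom_def by metis
  have g_lact: "g (blact ?Z a u) = blact X a (g u)" if "a \<in> L" "u \<in> U" for a u
    using that f gX fg gf X.lact_closed unfolding bimod_hom_def by metis
  have g_ract: "g (bract ?Z u a) = bract X (g u) a" if "a \<in> R" "u \<in> U" for a u
    using that f gX fg gf X.ract_closed unfolding bimod_hom_def by metis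
  define unit where "unit = (\<lambda>i y. (replicate q (bzero Y))[i := y])"
  have Zmem: "z \<in> bcarrier ?Z \<longleftrightarrow> length z = q \<and> (\<forall>i<q. z ! i \<in> bcarrier Y)" for z
    by (auto simp: copies_def words_def set_conv_nth)
  have unit_nth: "unit i y ! j = (if j = i then y else bzero Y)" if "j < q" for i j y
    using that by (cases "j = i") (simp_all add: unit_def)
  have unit_len: "length (unit i y) = q" for i y by (simp add: unit_def)
  have unit_Z: "unit i y \<in> bcarrier ?Z" if "y \<in> bcarrier Y" for i y
    unfolding Zmem using that Y.zero_closed by (simp add: unit_nth unit_len)
  have unit_add: "unit i (badd Y y y') = badd ?Z (unit i y) (unit i y')"
    if "y \<in> bcarrier Y" "y' \<in> bcarrier Y" for i y y'
    unfolding copies_def using that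
    by (intro nth_equalityI) (simp_all add: unit_nth unit_len Y.add_zero Y.zero_closed)
  have unit_lact: "unit i (blact Y a y) = blact ?Z a (unit i y)" if "a \<in> L" for i a y
    unfolding copies_def using that
    by (intro nth_equalityI) (simp_all add: unit_nth unit_len Y.lact_zero)
  have unit_ract: "unit i (bract Y y a) = bract ?Z (unit i y) a" if "a \<in> R" for i a y
    unfolding copies_def using that
    by (intro nth_equalityI) (simp_all add: unit_nth unit_len Y.ract_zero)
  define \<phi> where "\<phi> = (\<lambda>i x. f x ! i)"
  define \<psi> where "\<psi> = (\<lambda>i y. g (pr (unit i y)))"
  show thesis
  proof
    fix i assume i: "i < q"
    have len: "length (f x) = q" and nth: "f x ! i \<in> bcarrier Y" if "x \<in> bcarrier X" for x
      using UZ [OF fU [OF that]] i unfolding Zmem by auto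
    have "f (badd X x y) ! i = badd Y (f x ! i) (f y ! i)" if "x \<in> bcarrier X" "y \<in> bcarrier X" for x y
    proof -
      have "f (badd X x y) = badd ?Z (f x) (f y)" using f that unfolding bimod_hom_def by blast
      then show ?thesis using i len that by (simp add: copies_def)
    qed
    moreover have "f (blact X a x) ! i = blact Y a (f x ! i)" if "a \<in> L" "x \<in> bcarrier X" for a x
    proof -
      have "f (blact X a x) = blact ?Z a (f x)" using f that unfolding bimod_hom_def by blast
      then show ?thesis using i len that by (simp add: copies_def)
    qed
    moreover have "f (bract X x a) ! i = bract Y (f x ! i) a" if "a \<in> R" "x \<in> bcarrier X" for a x
    proof -
      have "f (bract X x a) = bract ?Z (f x) a" using f that unfolding bimod_hom_def by blast
      then show ?thesis using i len that by (simp add: copies_def)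
    qed
    ultimately show "bimod_hom L R X Y (\<phi> i)"
      unfolding bimod_hom_def \<phi>_def using nth by auto
    show "bimod_hom L R Y X (\<psi> i)"
      unfolding bimod_hom_def \<psi>_def
      using gX pr_U unit_Z unit_add unit_lact unit_ract pr_add pr_lact pr_ract g_add g_lact g_ract
      by auto
  next
    fix \<gamma> :: "'m \<Rightarrow> 'k::ab_group_add" and x
    assume \<gamma>: "\<forall>x\<in>bcarrier X. \<forall>y\<in>bcarrier X. \<gamma> (badd X x y) = \<gamma> x + \<gamma> y"
      and x: "x \<in> bcarrier X"
    define \<Gamma> where "\<Gamma> = (\<lambda>z. \<gamma> (g (pr z)))"
    have \<Gamma>_add: "\<Gamma> (badd ?Z y z) = \<Gamma> y + \<Gamma> z" if "y \<in> bcarrier ?Z" "z \<in> bcarrier ?Z" for y z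
      using that \<gamma> gX pr_U by (simp add: \<Gamma>_def pr_add g_add)
    have \<Gamma>_0: "\<Gamma> (bzero ?Z) = 0"
      using \<Gamma>_add [OF Z.zero_closed Z.zero_closed] Z.add_zero [OF Z.zero_closed] by simp
    define z where "z = f x"
    have z: "length z = q" "\<And>i. i < q \<Longrightarrow> z ! i \<in> bcarrier Y" "z \<in> bcarrier ?Z"
      using UZ [OF fU [OF x]] unfolding z_def Zmem by auto
    \<comment> \<open>Truncations of \<open>z\<close>, padded by zeros: \<open>badd\<close> being
      binary, the coordinates are added up one at a time.\<close>
    define part where "part = (\<lambda>k. take k z @ replicate (q - k) (bzero Y))"
    have part_nth: "part k ! i = (if i < k then z ! i else bzero Y)" if "k \<le> q" "i < q" for k i
      using that z(1) by (auto simp: part_def nth_append)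
    have part_len: "length (part k) = q" if "k \<le> q" for k using that z(1) by (simp add: part_def)
    have part_Z: "part k \<in> bcarrier ?Z" if "k \<le> q" for k
      unfolding Zmem using that part_len part_nth z(2) Y.zero_closed by simp
    have "\<Gamma> (part k) = (\<Sum>i<k. \<Gamma> (unit i (z ! i)))" if "k \<le> q" for k
      using that
    proof (induction k)
      case 0
      have "part 0 = bzero ?Z" by (simp add: part_def copies_def)
      then show ?case by (simp add: \<Gamma>_0)
    next
      case (Suc k)
      have "part (Suc k) = badd ?Z (part k) (unit k (z ! k))"
      proof (rule nth_equalityI)
        fix i assume "i < length (part (Suc k))"
        then have i: "i < q" using part_len Suc.prems by simp
        then show "part (Suc k) ! i = badd ?Z (part k) (unit k (z ! k)) ! i"
          using Suc.prems part_len [of k] z(2) [of i] Y.add_zero Y.zero_add Y.zero_closed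
          by (auto simp: copies_def part_nth unit_nth unit_len less_Suc_eq)
      qed (use Suc.prems part_len in \<open>simp add: copies_def unit_len\<close>)
      then show ?case using Suc \<Gamma>_add part_Z unit_Z z(2) by simp
    qed
    from this [of q] have "\<Gamma> z = (\<Sum>i<q. \<Gamma> (unit i (z ! i)))" using z(1) by (simp add: part_def)
    moreover have "\<Gamma> z = \<gamma> x" using x fU by (simp add: \<Gamma>_def z_def pr_id gf)
    ultimately show "\<gamma> x = (\<Sum>i<q. \<gamma> (\<psi> i (\<phi> i x)))" by (simp add: \<Gamma>_def \<psi>_def \<phi>_def z_def)
  qed
qed

section \<open>Invariant functionals and direct summands\<close>

text \<open>With \<open>A = UNIV\<close> and \<open>A'\<close> empty these are the functionals on k
  \<otimes>_H M, with the roles exchanged those on M \<otimes>_H k. Homogeneity over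
  \<open>k\<close> is contained in the invariance under multiples of 1, as \<epsilon>(c 1) =
  c.\<close>

definition inv_functional :: "('a \<Rightarrow> 'k::field) \<Rightarrow> 'a set \<Rightarrow> 'a set \<Rightarrow> ('a, 'm) bimod \<Rightarrow> ('m \<Rightarrow> 'k) \<Rightarrow> bool"
  where "inv_functional \<epsilon> A A' M \<gamma> \<longleftrightarrow>
    (\<forall>x\<in>bcarrier M. \<forall>y\<in>bcarrier M. \<gamma> (badd M x y) = \<gamma> x + \<gamma> y) \<and>
    (\<forall>a\<in>A. \<forall>x\<in>bcarrier M. \<gamma> (blact M a x) = \<epsilon> a * \<gamma> x) \<and>
    (\<forall>a\<in>A'. \<forall>x\<in>bcarrier M. \<gamma> (bract M x a) = \<epsilon> a * \<gamma> x)"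

lemma inv_functional_comp:
  assumes "inv_functional \<epsilon> A A' X \<gamma>" "bimod_hom L R Y X \<psi>" "A \<subseteq> L" "A' \<subseteq> R"
  shows "inv_functional \<epsilon> A A' Y (\<lambda>y. \<gamma> (\<psi> y))"
proof -
  have im: "\<psi> y \<in> bcarrier X" if "y \<in> bcarrier Y" for y
    using assms(2) that unfolding bimod_hom_def by blast
  have "\<psi> (badd Y x y) = badd X (\<psi> x) (\<psi> y)" if "x \<in> bcarrier Y" "y \<in> bcarrier Y" for x y
    using assms(2) that unfolding bimod_hom_def by blast
  moreover have "\<psi> (blact Y a x) = blact X a (\<psi> x)" if "a \<in> A" "x \<in> bcarrier Y" for a x
    using assms(2,3) that unfolding bimod_hom_def by blast
  moreover have "\<psi> (bract Y x a) = bract X (\<psi> x) a" if "a \<in> A'" "x \<in> bcarrier Y" for a x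
    using assms(2,4) that unfolding bimod_hom_def by blast
  ultimately show ?thesis
    using assms(1) im by (simp add: inv_functional_def)
qed

text \<open>\<gamma> is the sum of the maps \<gamma> \<psi>_i \<phi>_i, each \<gamma> \<psi>_i is
  invariant on \<open>Y\<close>, and \<phi>_i commutes with the action of \<open>r\<close>. The two
  parts treat \<open>r\<close> acting on the right and on the left.\<close>

lemma inv_functional_vanish_summand:
  fixes \<epsilon> :: "'a \<Rightarrow> 'k::field"
  assumes "additive_bimodule L R X" "additive_bimodule L R Y" "iso_direct_summand L R X (copies q Y)"
    and "A \<subseteq> L" "A' \<subseteq> R"
  shows "r \<in> R \<Longrightarrow> (\<And>\<gamma> y. inv_functional \<epsilon> A A' Y \<gamma> \<Longrightarrow> y \<in> bcarrier Y \<Longrightarrow> \<gamma> (bract Y y r) = 0) \<Longrightarrow>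
      inv_functional \<epsilon> A A' X \<gamma> \<Longrightarrow> x \<in> bcarrier X \<Longrightarrow> \<gamma> (bract X x r) = 0"
    and "r \<in> L \<Longrightarrow> (\<And>\<gamma> y. inv_functional \<epsilon> A A' Y \<gamma> \<Longrightarrow> y \<in> bcarrier Y \<Longrightarrow> \<gamma> (blact Y r y) = 0) \<Longrightarrow>
      inv_functional \<epsilon> A A' X \<gamma> \<Longrightarrow> x \<in> bcarrier X \<Longrightarrow> \<gamma> (blact X r x) = 0"
proof -
  interpret X: additive_bimodule L R X by fact
  obtain \<phi> \<psi> where \<phi>: "\<And>i. i < q \<Longrightarrow> bimod_hom L R X Y (\<phi> i)"
    and \<psi>: "\<And>i. i < q \<Longrightarrow> bimod_hom L R Y X (\<psi> i)"
    and split: "\<And>(\<gamma> :: _ \<Rightarrow> 'k) x.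
      \<forall>x\<in>bcarrier X. \<forall>y\<in>bcarrier X. \<gamma> (badd X x y) = \<gamma> x + \<gamma> y \<Longrightarrow>
      x \<in> bcarrier X \<Longrightarrow> \<gamma> x = (\<Sum>i<q. \<gamma> (\<psi> i (\<phi> i x)))"
  proof (rule iso_direct_summand_copies_split [OF assms(1-3), where ?'k = 'k], goal_cases)
    case (1 \<phi> \<psi>)
    show ?case by (rule that) (fact 1)+
  qed
  have im: "\<phi> i x \<in> bcarrier Y" if "i < q" "x \<in> bcarrier X" for i x
    using \<phi> [OF that(1)] that(2) unfolding bimod_hom_def by blast
  have inv: "inv_functional \<epsilon> A A' Y (\<lambda>y. \<gamma> (\<psi> i y))" if "inv_functional \<epsilon> A A' X \<gamma>" "i < q" for \<gamma> i
    using that(1) \<psi> [OF that(2)] assms(4,5) by (rule inv_functional_comp)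
  show "\<gamma> (bract X x r) = 0"
    if "r \<in> R" "\<And>\<gamma> y. inv_functional \<epsilon> A A' Y \<gamma> \<Longrightarrow> y \<in> bcarrier Y \<Longrightarrow> \<gamma> (bract Y y r) = 0"
      "inv_functional \<epsilon> A A' X \<gamma>" "x \<in> bcarrier X"
  proof -
    have "\<gamma> (bract X x r) = (\<Sum>i<q. \<gamma> (\<psi> i (\<phi> i (bract X x r))))"
      using that(3) X.ract_closed [OF that(1,4)] by (intro split) (auto simp: inv_functional_def)
    also have "\<dots> = (\<Sum>i<q. \<gamma> (\<psi> i (bract Y (\<phi> i x) r)))"
      using \<phi> that(1,4) by (intro sum.cong refl) (simp add: bimod_hom_def)
    also have "\<dots> = 0"
      using that(2) [OF inv [OF that(3)]] im that(4) by (intro sum.neutral) blast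
    finally show ?thesis .
  qed
  show "\<gamma> (blact X r x) = 0"
    if "r \<in> L" "\<And>\<gamma> y. inv_functional \<epsilon> A A' Y \<gamma> \<Longrightarrow> y \<in> bcarrier Y \<Longrightarrow> \<gamma> (blact Y r y) = 0"
      "inv_functional \<epsilon> A A' X \<gamma>" "x \<in> bcarrier X"
  proof -
    have "\<gamma> (blact X r x) = (\<Sum>i<q. \<gamma> (\<psi> i (\<phi> i (blact X r x))))"
      using that(3) X.lact_closed [OF that(1,4)] by (intro split) (auto simp: inv_functional_def)
    also have "\<dots> = (\<Sum>i<q. \<gamma> (\<psi> i (blact Y r (\<phi> i x))))"
      using \<phi> that(1,4) by (intro sum.cong refl) (simp add: bimod_hom_def)
    also have "\<dots> = 0"
      using that(2) [OF inv [OF that(3)]] im that(4) by (intro sum.neutral) blast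
    finally show ?thesis .
  qed
qed

section \<open>Tensor powers over \<open>R\<close> and the theorem\<close>

context hopf_subalgebra_pair
begin

abbreviation "tpowR \<equiv> tover scale R"
abbreviation "trel \<equiv> tover_rel scale R"
abbreviation "tcl \<equiv> tover_class scale R"
abbreviation wfree :: "nat \<Rightarrow> ('h list \<Rightarrow>\<^sub>0 'k) set"
  where "wfree N \<equiv> free_on (words UNIV N)"

definition lact :: "'h \<Rightarrow> ('h list \<Rightarrow>\<^sub>0 'k) \<Rightarrow> ('h list \<Rightarrow>\<^sub>0 'k)"
  where "lact a = lin_ext pscale (\<lambda>xs. Poly_Mapping.single ((a * hd xs) # tl xs) 1)"

definition ract :: "'h \<Rightarrow> ('h list \<Rightarrow>\<^sub>0 'k) \<Rightarrow> ('h list \<Rightarrow>\<^sub>0 'k)"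
  where "ract a = lin_ext pscale (\<lambda>xs. Poly_Mapping.single (butlast xs @ [last xs * a]) 1)"

lemma coset_quotient_tover: "coset_quotient (wfree N) (trel N)"
  unfolding tover_rel_def by (rule coset_quotient_free)

lemma trel_subspace: "pm.subspace (trel N)"
  by (simp add: tover_rel_def)

lemma tcl_eq_iff: "f \<in> wfree N \<Longrightarrow> g \<in> wfree N \<Longrightarrow> tcl N f = tcl N g \<longleftrightarrow> f - g \<in> trel N"
  unfolding tover_class_def by (rule coset_quotient.qclass_eq_iff [OF coset_quotient_tover])

lemma tcl_in: "f \<in> wfree N \<Longrightarrow> tcl N f \<in> bcarrier (tpowR N)"
  unfolding tover_class_def tover_def by (simp add: coset_quotient.qclass_in [OF coset_quotient_tover])

lemma tover_cases:
  assumes "X \<in> bcarrier (tpowR N)"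
  obtains f where "f \<in> wfree N" "X = tcl N f"
proof -
  have "X \<in> wfree N // modrel (wfree N) (trel N)" using assms by (simp add: tover_def)
  then show thesis
    by (rule coset_quotient.quotient_cases [OF coset_quotient_tover]) (use that in \<open>simp add: tover_class_def\<close>)
qed

lemma trel_add: "Poly_Mapping.single (xs @ (a + b) # ys) (1 :: 'k) - Poly_Mapping.single (xs @ a # ys) 1
    - Poly_Mapping.single (xs @ b # ys) 1 \<in> trel N"
  if "length xs + length ys + 1 = N"
proof -
  have "xs @ a # ys \<in> words UNIV N" using that by (simp add: words_def)
  then show ?thesis unfolding tover_rel_def multilin_rels_def by (intro pm.span_base) blast
qed

lemma trel_scale: "Poly_Mapping.single (xs @ scale c a # ys) (1 :: 'k) - Poly_Mapping.single (xs @ a # ys) c \<in> trel N"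
  if "length xs + length ys + 1 = N"
proof -
  have "xs @ a # ys \<in> words UNIV N" using that by (simp add: words_def)
  then show ?thesis unfolding tover_rel_def multilin_rels_def by (intro pm.span_base) blast
qed

lemma trel_balanced: "Poly_Mapping.single (xs @ (a * b) # a' # ys) (1 :: 'k)
    - Poly_Mapping.single (xs @ a # (b * a') # ys) 1 \<in> trel N"
  if "b \<in> R" "length xs + length ys + 2 = N"
proof -
  have "xs @ a # a' # ys \<in> words UNIV N" using that by (simp add: words_def)
  then show ?thesis using that(1) unfolding tover_rel_def balanced_rels_def by (intro pm.span_base) blast
qed

text \<open>Reduces a linear condition on the relations to the three kinds of generators.
  \<open>V\<close> is the relation space itself when an action is to descend to cosets, and {0} when
  a form is.\<close>

lemma trel_induct:
  assumes "t \<in> trel N" "vector_space sc" "module.subspace sc V"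
    and add: "\<And>xs a b ys. length xs + length ys + 1 = N \<Longrightarrow>
      \<Phi> (xs @ (a + b) # ys) - \<Phi> (xs @ a # ys) - \<Phi> (xs @ b # ys) \<in> V"
    and scl: "\<And>xs c a ys. length xs + length ys + 1 = N \<Longrightarrow>
      \<Phi> (xs @ scale c a # ys) - sc c (\<Phi> (xs @ a # ys)) \<in> V"
    and bal: "\<And>xs a b a' ys. b \<in> R \<Longrightarrow> length xs + length ys + 2 = N \<Longrightarrow>
      \<Phi> (xs @ (a * b) # a' # ys) - \<Phi> (xs @ a # (b * a') # ys) \<in> V"
  shows "lin_ext sc \<Phi> t \<in> V"
proof -
  interpret V: vector_space sc by fact
  show ?thesis
  proof (rule V.lin_ext_span_zero [OF assms(1) [unfolded tover_rel_def] _ assms(3)])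
    fix t :: "'h list \<Rightarrow>\<^sub>0 'k" assume "t \<in> multilin_rels UNIV (+) scale N \<union> balanced_rels R N"
    then show "lin_ext sc \<Phi> t \<in> V"
      unfolding multilin_rels_def balanced_rels_def words_def
      by (auto simp: V.lin_ext_diff add scl bal)
  qed
qed

lemma lact_free: "N \<ge> 1 \<Longrightarrow> f \<in> wfree N \<Longrightarrow> lact a f \<in> wfree N"
  unfolding lact_def
  by (intro pm.lin_ext_in_subspace [OF free_on_subspace] single_in_free_on)
    (auto simp: free_on_def words_def)

lemma ract_free: "N \<ge> 1 \<Longrightarrow> f \<in> wfree N \<Longrightarrow> ract a f \<in> wfree N"
  unfolding ract_def
  by (intro pm.lin_ext_in_subspace [OF free_on_subspace] single_in_free_on)
    (auto simp: free_on_def words_def)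

lemma lact_rel:
  assumes "t \<in> trel N"
  shows "lact a t \<in> trel N"
  unfolding lact_def
proof (rule trel_induct [OF assms vector_space_pscale trel_subspace])
  fix xs ys :: "'h list" and x y assume "length xs + length ys + 1 = N"
  then show "Poly_Mapping.single ((a * hd (xs @ (x + y) # ys)) # tl (xs @ (x + y) # ys)) (1 :: 'k)
      - Poly_Mapping.single ((a * hd (xs @ x # ys)) # tl (xs @ x # ys)) 1
      - Poly_Mapping.single ((a * hd (xs @ y # ys)) # tl (xs @ y # ys)) 1 \<in> trel N"
    \<comment> \<open>If the slot is the first letter, \<open>a\<close> merges with it; otherwise
      \<open>a\<close> changes only the prefix.\<close>
    using trel_add [of "[]" ys N "a * x" "a * y"] trel_add [of "(a * hd xs) # tl xs" ys N x y]
    by (cases xs) (simp_all add: distrib_left)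
next
  fix xs ys :: "'h list" and c x assume "length xs + length ys + 1 = N"
  then show "Poly_Mapping.single ((a * hd (xs @ scale c x # ys)) # tl (xs @ scale c x # ys)) (1 :: 'k)
      - pscale c (Poly_Mapping.single ((a * hd (xs @ x # ys)) # tl (xs @ x # ys)) 1) \<in> trel N"
    using trel_scale [of "[]" ys N c "a * x"] trel_scale [of "(a * hd xs) # tl xs" ys N c x]
    by (cases xs) (simp_all add: scale_mult_right pscale_single)
next
  fix xs ys :: "'h list" and x b y assume "b \<in> R" "length xs + length ys + 2 = N"
  then show "Poly_Mapping.single ((a * hd (xs @ (x * b) # y # ys)) # tl (xs @ (x * b) # y # ys)) (1 :: 'k)
      - Poly_Mapping.single ((a * hd (xs @ x # (b * y) # ys)) # tl (xs @ x # (b * y) # ys)) 1 \<in> trel N"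
    using trel_balanced [of b "[]" ys N "a * x" y] trel_balanced [of b "(a * hd xs) # tl xs" ys N x y]
    by (cases xs) (simp_all add: mult.assoc)
qed

lemma ract_rel:
  assumes "t \<in> trel N"
  shows "ract a t \<in> trel N"
  unfolding ract_def
proof (rule trel_induct [OF assms vector_space_pscale trel_subspace])
  fix xs ys :: "'h list" and x y assume "length xs + length ys + 1 = N"
  then show "Poly_Mapping.single (butlast (xs @ (x + y) # ys) @ [last (xs @ (x + y) # ys) * a]) (1 :: 'k)
      - Poly_Mapping.single (butlast (xs @ x # ys) @ [last (xs @ x # ys) * a]) 1
      - Poly_Mapping.single (butlast (xs @ y # ys) @ [last (xs @ y # ys) * a]) 1 \<in> trel N"
    using trel_add [of xs "[]" N "x * a" "y * a"] trel_add [of xs "butlast ys @ [last ys * a]" N x y]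
    by (cases ys rule: rev_cases) (simp_all add: distrib_right butlast_append)
next
  fix xs ys :: "'h list" and c x assume "length xs + length ys + 1 = N"
  then show "Poly_Mapping.single (butlast (xs @ scale c x # ys) @ [last (xs @ scale c x # ys) * a]) (1 :: 'k)
      - pscale c (Poly_Mapping.single (butlast (xs @ x # ys) @ [last (xs @ x # ys) * a]) 1) \<in> trel N"
    using trel_scale [of xs "[]" N c "x * a"] trel_scale [of xs "butlast ys @ [last ys * a]" N c x]
    by (cases ys rule: rev_cases) (simp_all add: scale_mult_left pscale_single butlast_append)
next
  fix xs ys :: "'h list" and x b y assume "b \<in> R" "length xs + length ys + 2 = N"
  then show "Poly_Mapping.single (butlast (xs @ (x * b) # y # ys) @ [last (xs @ (x * b) # y # ys) * a]) (1 :: 'k)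
      - Poly_Mapping.single (butlast (xs @ x # (b * y) # ys) @ [last (xs @ x # (b * y) # ys) * a]) 1 \<in> trel N"
    using trel_balanced [of b xs "[]" N x "y * a"] trel_balanced [of b xs "butlast ys @ [last ys * a]" N x y]
    by (cases ys rule: rev_cases) (simp_all add: mult.assoc butlast_append)
qed

lemma badd_tcl:
  assumes "f \<in> wfree N" "g \<in> wfree N"
  shows "badd (tpowR N) (tcl N f) (tcl N g) = tcl N (f + g)"
proof -
  have eq: "tcl N (f' + g') = tcl N (f + g)"
    if "f' \<in> wfree N" "f - f' \<in> trel N" "g' \<in> wfree N" "g - g' \<in> trel N" for f' g'
  proof -
    have "(f + g) - (f' + g') = (f - f') + (g - g')" by simp
    also have "\<dots> \<in> trel N" using that by (intro pm.subspace_add [OF trel_subspace])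
    finally show ?thesis
      using that assms by (subst eq_commute) (simp add: tcl_eq_iff pm.subspace_add [OF free_on_subspace])
  qed
  have mem: "f' \<in> tcl N f \<longleftrightarrow> f' \<in> wfree N \<and> f - f' \<in> trel N" if "f \<in> wfree N" for f f'
    unfolding tover_class_def by (rule coset_quotient.mem_qclass_iff [OF coset_quotient_tover that])
  have "f \<in> tcl N f" "g \<in> tcl N g"
    using assms pm.subspace_0 [OF trel_subspace] by (simp_all add: mem)
  moreover have "badd (tpowR N) (tcl N f) (tcl N g) = (\<Union>f'\<in>tcl N f. \<Union>g'\<in>tcl N g. tcl N (f' + g'))"
    by (simp add: tover_def)
  ultimately show ?thesis using eq mem assms by blast
qed

lemma lact_diff: "lact a (f - g) = lact a f - lact a g"
  and ract_diff: "ract a (f - g) = ract a f - ract a g"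
  and lact_add: "lact a (f + g) = lact a f + lact a g"
  and ract_add: "ract a (f + g) = ract a f + ract a g"
  by (simp_all add: lact_def ract_def pm.lin_ext_diff pm.lin_ext_add)

lemma blact_tcl:
  assumes "N \<ge> 1" "f \<in> wfree N"
  shows "blact (tpowR N) a (tcl N f) = tcl N (lact a f)"
proof -
  have "(\<Union>g\<in>qclass (wfree N) (trel N) f. tcl N (lact a g)) = tcl N (lact a f)"
  proof (rule coset_quotient.UN_qclass [OF coset_quotient_tover assms(2)])
    fix g assume g: "g \<in> wfree N" "f - g \<in> trel N"
    then have "lact a f - lact a g \<in> trel N" using lact_rel by (metis lact_diff)
    then show "tcl N (lact a g) = tcl N (lact a f)"
      using g assms by (subst eq_commute) (simp add: tcl_eq_iff lact_free)
  qed
  then show ?thesis by (simp add: tover_def tover_class_def lact_def)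
qed

lemma bract_tcl:
  assumes "N \<ge> 1" "f \<in> wfree N"
  shows "bract (tpowR N) (tcl N f) a = tcl N (ract a f)"
proof -
  have "(\<Union>g\<in>qclass (wfree N) (trel N) f. tcl N (ract a g)) = tcl N (ract a f)"
  proof (rule coset_quotient.UN_qclass [OF coset_quotient_tover assms(2)])
    fix g assume g: "g \<in> wfree N" "f - g \<in> trel N"
    then have "ract a f - ract a g \<in> trel N" using ract_rel by (metis ract_diff)
    then show "tcl N (ract a g) = tcl N (ract a f)"
      using g assms by (subst eq_commute) (simp add: tcl_eq_iff ract_free)
  qed
  then show ?thesis by (simp add: tover_def tover_class_def ract_def)
qed

lemma lin_ext_single_self: "lin_ext pscale (\<lambda>xs. Poly_Mapping.single xs 1) f = (f :: 'x \<Rightarrow>\<^sub>0 'k)"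
  using poly_mapping_eq_sum [of f] by (simp add: lin_ext_def pscale_single)

text \<open>The record of a bimodule carries no scalar multiplication. Here it is recovered from the
  action of c 1, which gives the homogeneity of invariant functionals and the negation in
  \<open>additive_bimodule\<close>.\<close>

lemma lact_scale_one:
  assumes "N \<ge> 1" "f \<in> wfree N"
  shows "lact (scale c 1) f - pscale c f \<in> trel N"
proof -
  have "lact (scale c 1) f - pscale c f = lin_ext pscale
      (\<lambda>xs. Poly_Mapping.single (scale c (hd xs) # tl xs) 1 - Poly_Mapping.single xs c) f"
    by (subst (2) lin_ext_single_self [symmetric])
      (simp add: lact_def lin_ext_def scale_mult_left pm.scale_right_diff_distrib sum_subtractf
        pm.scale_sum_right pscale_single mult.commute)
  also have "\<dots> \<in> trel N"
  proof (rule pm.lin_ext_in_subspace [OF trel_subspace])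
    fix xs assume "xs \<in> Poly_Mapping.keys f"
    then have "length xs = N" using assms(2) by (auto simp: free_on_def words_def)
    with assms(1) show "Poly_Mapping.single (scale c (hd xs) # tl xs) 1 - Poly_Mapping.single xs c \<in> trel N"
      using trel_scale [of "[]" "tl xs" N c "hd xs"] by (cases xs) simp_all
  qed
  finally show ?thesis .
qed

lemma ract_scale_one:
  assumes "N \<ge> 1" "f \<in> wfree N"
  shows "ract (scale c 1) f - pscale c f \<in> trel N"
proof -
  have "ract (scale c 1) f - pscale c f = lin_ext pscale
      (\<lambda>xs. Poly_Mapping.single (butlast xs @ [scale c (last xs)]) 1 - Poly_Mapping.single xs c) f"
    by (subst (2) lin_ext_single_self [symmetric])
      (simp add: ract_def lin_ext_def scale_mult_right pm.scale_right_diff_distrib sum_subtractf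
        pm.scale_sum_right pscale_single mult.commute)
  also have "\<dots> \<in> trel N"
  proof (rule pm.lin_ext_in_subspace [OF trel_subspace])
    fix xs assume "xs \<in> Poly_Mapping.keys f"
    then have "length xs = N" using assms(2) by (auto simp: free_on_def words_def)
    with assms(1) show "Poly_Mapping.single (butlast xs @ [scale c (last xs)]) 1 - Poly_Mapping.single xs c \<in> trel N"
      using trel_scale [of "butlast xs" "[]" N c "last xs"] by (cases xs rule: rev_cases) simp_all
  qed
  finally show ?thesis .
qed

lemma tcl_pscale:
  assumes "N \<ge> 1" "f \<in> wfree N"
  shows "tcl N (pscale c f) = blact (tpowR N) (scale c 1) (tcl N f)"
    and "tcl N (pscale c f) = bract (tpowR N) (tcl N f) (scale c 1)"
  using assms lact_scale_one ract_scale_one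
  by (simp_all add: blact_tcl bract_tcl eq_commute [of "tcl N (pscale c f)"] tcl_eq_iff lact_free ract_free
      pm.subspace_scale [OF free_on_subspace])

lemma additive_bimodule_tover:
  assumes N: "N \<ge> 1" and L: "scale (- 1) 1 \<in> L"
  shows "additive_bimodule L R' (tpowR N)"
proof
  note simps = badd_tcl blact_tcl [OF N] bract_tcl [OF N] pm.subspace_add [OF free_on_subspace]
    lact_free [OF N] ract_free [OF N]
  have z: "bzero (tpowR N) = tcl N 0" "0 \<in> wfree N"
    by (simp_all add: tover_def pm.subspace_0 [OF free_on_subspace])
  show "bzero (tpowR N) \<in> bcarrier (tpowR N)" using z tcl_in by simp
  show "badd (tpowR N) x y \<in> bcarrier (tpowR N)"
    if "x \<in> bcarrier (tpowR N)" "y \<in> bcarrier (tpowR N)" for x y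
    using that by (elim tover_cases) (simp add: simps tcl_in)
  show "blact (tpowR N) a x \<in> bcarrier (tpowR N)" if "x \<in> bcarrier (tpowR N)" for a x
    using that by (elim tover_cases) (simp add: simps tcl_in)
  show "bract (tpowR N) x a \<in> bcarrier (tpowR N)" if "x \<in> bcarrier (tpowR N)" for a x
    using that by (elim tover_cases) (simp add: simps tcl_in)
  show "badd (tpowR N) (badd (tpowR N) x y) z = badd (tpowR N) x (badd (tpowR N) y z)"
    if "x \<in> bcarrier (tpowR N)" "y \<in> bcarrier (tpowR N)" "z \<in> bcarrier (tpowR N)" for x y z
    using that by (elim tover_cases) (simp add: simps add.assoc)
  show "badd (tpowR N) x y = badd (tpowR N) y x"
    if "x \<in> bcarrier (tpowR N)" "y \<in> bcarrier (tpowR N)" for x y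
    using that by (elim tover_cases) (simp add: simps add.commute)
  show "badd (tpowR N) x (bzero (tpowR N)) = x" if "x \<in> bcarrier (tpowR N)" for x
    using that by (elim tover_cases) (simp add: simps z)
  show "blact (tpowR N) a (badd (tpowR N) x y) = badd (tpowR N) (blact (tpowR N) a x) (blact (tpowR N) a y)"
    if "x \<in> bcarrier (tpowR N)" "y \<in> bcarrier (tpowR N)" for a x y
    using that by (elim tover_cases) (simp add: simps lact_add)
  show "bract (tpowR N) (badd (tpowR N) x y) a = badd (tpowR N) (bract (tpowR N) x a) (bract (tpowR N) y a)"
    if "x \<in> bcarrier (tpowR N)" "y \<in> bcarrier (tpowR N)" for a x y
    using that by (elim tover_cases) (simp add: simps ract_add)
  show "blact (tpowR N) a (bzero (tpowR N)) = bzero (tpowR N)" for a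
    by (simp add: z(1) blact_tcl [OF N z(2)] lact_def)
  show "bract (tpowR N) (bzero (tpowR N)) a = bzero (tpowR N)" for a
    by (simp add: z(1) bract_tcl [OF N z(2)] ract_def)
  have "badd (tpowR N) x (blact (tpowR N) (scale (- 1) 1) x) = bzero (tpowR N)"
    if x: "x \<in> bcarrier (tpowR N)" for x
  proof -
    obtain f where f: "f \<in> wfree N" "x = tcl N f" using x by (rule tover_cases)
    have *: "blact (tpowR N) (scale (- 1) 1) (tcl N f) = tcl N (- f)"
      using tcl_pscale(1) [OF N f(1), of "- 1"] by (simp only: pm.scale_minus_left pm.scale_one)
    show ?thesis
      unfolding f(2) * using f(1) by (simp add: badd_tcl z(1) pm.subspace_neg [OF free_on_subspace])
  qed
  with L show "\<exists>m\<in>L. \<forall>x\<in>bcarrier (tpowR N). badd (tpowR N) x (blact (tpowR N) m x) = bzero (tpowR N)"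
    by blast
qed

section \<open>Forms on words and functionals on tensor powers over \<open>R\<close>\<close>

definition right_inv :: "nat \<Rightarrow> ('h list \<Rightarrow> 'k) \<Rightarrow> bool"
  where "right_inv N g \<longleftrightarrow> (\<forall>h x xs. length xs + 1 = N \<longrightarrow> g (xs @ [x * h]) = \<epsilon> h * g (xs @ [x]))"

text \<open>A functional is recorded by its values on words. One of \<open>A\<close> and
  \<open>A'\<close> is all of \<open>H\<close>, so that invariance under \<open>scale c 1\<close>
  yields homogeneity.\<close>

lemma forms_of_functional:
  assumes N: "N \<ge> 1" and \<gamma>: "inv_functional \<epsilon> A A' (tpowR N) \<gamma>" and A: "A = UNIV \<or> A' = UNIV"
  defines "g \<equiv> \<lambda>w. \<gamma> (tcl N (Poly_Mapping.single w 1))"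
  shows "multilin (*) N g" "balanced N g" "A = UNIV \<Longrightarrow> left_inv N g" "A' = UNIV \<Longrightarrow> right_inv N g"
    "f \<in> wfree N \<Longrightarrow> \<gamma> (tcl N f) = lin_ext (*) g f"
proof -
  have single: "Poly_Mapping.single w c \<in> wfree N" if "length w = N" for w :: "'h list" and c :: 'k
    using that by (intro single_in_free_on) (simp add: words_def)
  have add: "\<gamma> (tcl N (f + h)) = \<gamma> (tcl N f) + \<gamma> (tcl N h)" if "f \<in> wfree N" "h \<in> wfree N" for f h
    using \<gamma> that tcl_in unfolding inv_functional_def by (metis badd_tcl)
  have scl: "\<gamma> (tcl N (pscale c f)) = c * \<gamma> (tcl N f)" if f: "f \<in> wfree N" for c f
  proof -
    have "\<epsilon> (scale c 1) = c" by (simp add: linD(2) [OF lin_counit] counit_one)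
    moreover have "\<gamma> (tcl N (pscale c f)) = \<epsilon> (scale c 1) * \<gamma> (tcl N f)"
      using A
    proof
      assume "A = UNIV"
      then show ?thesis
        unfolding tcl_pscale(1) [OF N f] using \<gamma> tcl_in [OF f] by (simp add: inv_functional_def)
    next
      assume "A' = UNIV"
      then show ?thesis
        unfolding tcl_pscale(2) [OF N f] using \<gamma> tcl_in [OF f] by (simp add: inv_functional_def)
    qed
    ultimately show ?thesis by simp
  qed
  have rel: "\<gamma> (tcl N f) = \<gamma> (tcl N h)" if "f - h \<in> trel N" "f \<in> wfree N" "h \<in> wfree N" for f h
    using that tcl_eq_iff by metis
  have lact: "\<gamma> (tcl N (lact a f)) = \<epsilon> a * \<gamma> (tcl N f)" if "A = UNIV" "f \<in> wfree N" for a f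
    using that \<gamma> tcl_in blact_tcl [OF N that(2)] unfolding inv_functional_def by (metis UNIV_I)
  have ract: "\<gamma> (tcl N (ract a f)) = \<epsilon> a * \<gamma> (tcl N f)" if "A' = UNIV" "f \<in> wfree N" for a f
    using that \<gamma> tcl_in bract_tcl [OF N that(2)] unfolding inv_functional_def by (metis UNIV_I)
  show "multilin (*) N g"
    unfolding multilin_def g_def
  proof (intro conjI allI impI)
    fix xs ys :: "'h list" and a b assume len: "length xs + length ys + 1 = N"
    show "\<gamma> (tcl N (Poly_Mapping.single (xs @ (a + b) # ys) 1)) =
        \<gamma> (tcl N (Poly_Mapping.single (xs @ a # ys) 1)) + \<gamma> (tcl N (Poly_Mapping.single (xs @ b # ys) 1))"
    proof -
      have s: "Poly_Mapping.single (xs @ c # ys) (1 :: 'k) \<in> wfree N" for c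
        using len by (intro single) simp
      have "Poly_Mapping.single (xs @ (a + b) # ys) (1 :: 'k)
          - (Poly_Mapping.single (xs @ a # ys) 1 + Poly_Mapping.single (xs @ b # ys) 1) \<in> trel N"
        using trel_add [OF len, of a b] by (simp add: diff_diff_eq)
      from rel [OF this s pm.subspace_add [OF free_on_subspace s s]] show ?thesis
        by (simp add: add s)
    qed
  next
    fix xs ys :: "'h list" and c a assume len: "length xs + length ys + 1 = N"
    show "\<gamma> (tcl N (Poly_Mapping.single (xs @ scale c a # ys) 1)) =
        c * \<gamma> (tcl N (Poly_Mapping.single (xs @ a # ys) 1))"
    proof -
      have s: "Poly_Mapping.single (xs @ x # ys) c \<in> wfree N" for x and c :: 'k
        using len by (intro single) simp
      have "\<gamma> (tcl N (pscale c (Poly_Mapping.single (xs @ a # ys) 1))) =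
          c * \<gamma> (tcl N (Poly_Mapping.single (xs @ a # ys) 1))"
        by (rule scl [OF s])
      then show ?thesis
        using rel [OF trel_scale [OF len, of c a] s s] by (simp add: pscale_single)
    qed
  qed
  show "balanced N g"
    unfolding balanced_def g_def
  proof (intro allI impI)
    fix xs ys :: "'h list" and a b a' assume b: "b \<in> R" and len: "length xs + length ys + 2 = N"
    show "\<gamma> (tcl N (Poly_Mapping.single (xs @ (a * b) # a' # ys) 1)) =
        \<gamma> (tcl N (Poly_Mapping.single (xs @ a # (b * a') # ys) 1))"
      by (rule rel [OF trel_balanced [OF b len]]; rule single) (use len in simp_all)
  qed
  show "left_inv N g" if "A = UNIV"
    unfolding left_inv_def g_def
  proof (intro allI impI)
    fix h x and xs :: "'h list" assume "length xs + 1 = N"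
    then show "\<gamma> (tcl N (Poly_Mapping.single ((h * x) # xs) 1)) = \<epsilon> h * \<gamma> (tcl N (Poly_Mapping.single (x # xs) 1))"
      using lact [OF that single [of "x # xs" 1], of h] by (simp add: lact_def)
  qed
  show "right_inv N g" if "A' = UNIV"
    unfolding right_inv_def g_def
  proof (intro allI impI)
    fix h x and xs :: "'h list" assume "length xs + 1 = N"
    then show "\<gamma> (tcl N (Poly_Mapping.single (xs @ [x * h]) 1)) = \<epsilon> h * \<gamma> (tcl N (Poly_Mapping.single (xs @ [x]) 1))"
      using ract [OF that single [of "xs @ [x]" 1], of h] by (simp add: ract_def)
  qed
  show "\<gamma> (tcl N f) = lin_ext (*) g f" if f: "f \<in> wfree N"
  proof -
    have zero: "\<gamma> (tcl N 0) = 0"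
      using scl [OF pm.subspace_0 [OF free_on_subspace], of 0] by simp
    have "\<gamma> (tcl N (\<Sum>w\<in>K. Poly_Mapping.single w (Poly_Mapping.lookup f w))) =
        (\<Sum>w\<in>K. Poly_Mapping.lookup f w * g w)" if "finite K" "K \<subseteq> Poly_Mapping.keys f" for K
      using that
    proof (induction K rule: finite_induct)
      case (insert w K)
      have len: "length v = N" if "v \<in> insert w K" for v
        using f insert.prems that by (auto simp: free_on_def words_def)
      have "\<gamma> (tcl N (Poly_Mapping.single w (Poly_Mapping.lookup f w))) = Poly_Mapping.lookup f w * g w"
        using scl [OF single [of w 1], of "Poly_Mapping.lookup f w"] len by (simp add: pscale_single g_def)
      moreover have "(\<Sum>w\<in>K. Poly_Mapping.single w (Poly_Mapping.lookup f w)) \<in> wfree N"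
        using len by (intro pm.subspace_sum [OF free_on_subspace] single) simp
      ultimately show ?case using insert len by (simp add: add single)
    qed (simp add: zero)
    from this [OF finite_keys order_refl] show ?thesis
      by (simp add: poly_mapping_eq_sum [symmetric] lin_ext_def)
  qed
qed

text \<open>The converse passage. Invariance of the form is asked for only on a side whose set of
  acting elements is nonempty, so both one-sided cases are covered at once.\<close>

lemma functional_of_form:
  assumes N: "N \<ge> 1" and ml: "multilin (*) N g" and bal: "balanced N g"
    and A: "A \<noteq> {} \<Longrightarrow> left_inv N g" and A': "A' \<noteq> {} \<Longrightarrow> right_inv N g"
  obtains \<gamma> where "inv_functional \<epsilon> A A' (tpowR N) \<gamma>"
    "\<And>f. f \<in> wfree N \<Longrightarrow> \<gamma> (tcl N f) = lin_ext (*) g f"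
proof -
  have rel: "lin_ext (*) g t = 0" if "t \<in> trel N" for t
  proof -
    have "lin_ext (*) g t \<in> {0}"
      by (rule trel_induct [OF that vector_space_mult])
        (use ml bal in \<open>auto simp: base_field.subspace_def multilin_def balanced_def\<close>)
    then show ?thesis by simp
  qed
  \<comment> \<open>Any element of the coset may be chosen, since the form vanishes on the relations
    by \<open>rel\<close>.\<close>
  define \<gamma> where "\<gamma> = (\<lambda>X. lin_ext (*) g (SOME f. f \<in> X))"
  have \<gamma>: "\<gamma> (tcl N f) = lin_ext (*) g f" if f: "f \<in> wfree N" for f
  proof -
    have "f - (SOME h. h \<in> tcl N f) \<in> trel N"
      unfolding tover_class_def by (rule coset_quotient.some_qclass [OF coset_quotient_tover f])
    from rel [OF this] show ?thesis by (simp add: \<gamma>_def base_field.lin_ext_diff)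
  qed
  have keys: "length xs = N" if "f \<in> wfree N" "xs \<in> Poly_Mapping.keys f" for f xs
    using that by (auto simp: free_on_def words_def)
  have lact: "lin_ext (*) g (lact a f) = \<epsilon> a * lin_ext (*) g f" if "A \<noteq> {}" "f \<in> wfree N" for a f
  proof -
    have "g ((a * hd xs) # tl xs) = \<epsilon> a * g xs" if "xs \<in> Poly_Mapping.keys f" for xs
      using keys [OF \<open>f \<in> wfree N\<close> that] N A [OF \<open>A \<noteq> {}\<close>] by (cases xs) (auto simp: left_inv_def)
    then show ?thesis
      by (simp add: lact_def base_field.lin_ext_lin_ext) (simp add: lin_ext_def sum_distrib_left mult.left_commute)
  qed
  have ract: "lin_ext (*) g (ract a f) = \<epsilon> a * lin_ext (*) g f" if "A' \<noteq> {}" "f \<in> wfree N" for a f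
  proof -
    have "g (butlast xs @ [last xs * a]) = \<epsilon> a * g xs" if "xs \<in> Poly_Mapping.keys f" for xs
      using keys [OF \<open>f \<in> wfree N\<close> that] N A' [OF \<open>A' \<noteq> {}\<close>] by (cases xs rule: rev_cases) (auto simp: right_inv_def)
    then show ?thesis
      by (simp add: ract_def base_field.lin_ext_lin_ext) (simp add: lin_ext_def sum_distrib_left mult.left_commute)
  qed
  have "inv_functional \<epsilon> A A' (tpowR N) \<gamma>"
    unfolding inv_functional_def
  proof (intro conjI ballI)
    fix x y assume "x \<in> bcarrier (tpowR N)" "y \<in> bcarrier (tpowR N)"
    then show "\<gamma> (badd (tpowR N) x y) = \<gamma> x + \<gamma> y"
      by (elim tover_cases) (simp add: badd_tcl \<gamma> base_field.lin_ext_add pm.subspace_add [OF free_on_subspace])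
  next
    fix a x assume a: "a \<in> A" "x \<in> bcarrier (tpowR N)"
    then have "A \<noteq> {}" by blast
    with a show "\<gamma> (blact (tpowR N) a x) = \<epsilon> a * \<gamma> x"
      using N by (elim tover_cases) (auto simp: blact_tcl \<gamma> lact lact_free)
  next
    fix a x assume a: "a \<in> A'" "x \<in> bcarrier (tpowR N)"
    then have "A' \<noteq> {}" by blast
    with a show "\<gamma> (bract (tpowR N) x a) = \<epsilon> a * \<gamma> x"
      using N by (elim tover_cases) (auto simp: bract_tcl \<gamma> ract ract_free)
  qed
  with \<gamma> that show thesis by blast
qed

text \<open>Restates the condition on forms for the bimodule \<open>tover\<close>, to which
  similarity refers. There are \<open>n + 1\<close> factors because k \<otimes>_H uses up one of
  them.\<close>

lemma inv_ann_iff_right: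
  "r \<in> inv_ann n \<longleftrightarrow> (\<forall>\<gamma> y. inv_functional \<epsilon> UNIV {} (tpowR (n + 1)) \<gamma> \<longrightarrow>
    y \<in> bcarrier (tpowR (n + 1)) \<longrightarrow> \<gamma> (bract (tpowR (n + 1)) y r) = 0)"
proof (intro iffI allI impI)
  fix \<gamma> y assume r: "r \<in> inv_ann n" and \<gamma>: "inv_functional \<epsilon> UNIV {} (tpowR (n + 1)) \<gamma>"
    and y: "y \<in> bcarrier (tpowR (n + 1))"
  obtain f where f: "f \<in> wfree (n + 1)" "y = tcl (n + 1) f" using y by (rule tover_cases)
  let ?g = "\<lambda>w. \<gamma> (tcl (n + 1) (Poly_Mapping.single w 1))"
  note g = forms_of_functional [OF le_add2 \<gamma> disjI1 [OF refl]]
  have g_in: "?g \<in> inv_forms n" using g(1-3) by (simp add: inv_forms_def)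
  have "?g (butlast w @ [last w * r]) = 0" if "w \<in> Poly_Mapping.keys f" for w
    using inv_annD [OF r g_in, of "butlast w" "last w"] f(1) that by (auto simp: free_on_def words_def)
  then have "lin_ext (*) ?g (ract r f) = 0"
    by (simp add: ract_def base_field.lin_ext_lin_ext) (simp add: lin_ext_def)
  then show "\<gamma> (bract (tpowR (n + 1)) y r) = 0"
    using f g(5) [OF ract_free [OF le_add2 f(1)]] by (simp add: bract_tcl)
next
  assume *: "\<forall>\<gamma> y. inv_functional \<epsilon> UNIV {} (tpowR (n + 1)) \<gamma> \<longrightarrow>
    y \<in> bcarrier (tpowR (n + 1)) \<longrightarrow> \<gamma> (bract (tpowR (n + 1)) y r) = 0"
  have "g (xs @ [x * r]) = 0" if g: "g \<in> inv_forms n" and xs: "length xs = n" for g xs x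
  proof -
    obtain \<gamma> where \<gamma>: "inv_functional \<epsilon> UNIV {} (tpowR (n + 1)) \<gamma>"
      "\<And>f. f \<in> wfree (n + 1) \<Longrightarrow> \<gamma> (tcl (n + 1) f) = lin_ext (*) g f"
      by (rule functional_of_form [of "n + 1" g UNIV "{}"]) (use g in \<open>auto simp: inv_forms_def\<close>)
    have s: "Poly_Mapping.single (xs @ [x]) (1 :: 'k) \<in> wfree (n + 1)"
      using xs by (intro single_in_free_on) (simp add: words_def)
    have "0 = \<gamma> (tcl (n + 1) (ract r (Poly_Mapping.single (xs @ [x]) 1)))"
      using * \<gamma>(1) tcl_in [OF s] bract_tcl [OF le_add2 s] by metis
    also have "\<dots> = g (xs @ [x * r])"
      by (subst \<gamma>(2) [OF ract_free [OF le_add2 s]]) (simp add: ract_def)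
    finally show ?thesis by simp
  qed
  then show "r \<in> inv_ann n" by (simp add: inv_ann_def)
qed

section \<open>Exchange of sides along the antipode\<close>

text \<open>Stated for a general antimultiplicative map because both \<open>S\<close> and its
  inverse occur, one for each direction of the exchange. Balance uses that \<open>R\<close> is
  preserved, invariance that \<epsilon> is.\<close>

lemma flip_forms:
  assumes T: "lin_endo T" "\<And>x y. T (x * y) = T y * T x" "T ` R \<subseteq> R" "\<And>x. \<epsilon> (T x) = \<epsilon> x"
  shows "multilin (*) N g \<Longrightarrow> multilin (*) N (\<lambda>w. g (rev (map T w)))"
    and "balanced N g \<Longrightarrow> balanced N (\<lambda>w. g (rev (map T w)))"
    and "left_inv N g \<Longrightarrow> right_inv N (\<lambda>w. g (rev (map T w)))"
    and "right_inv N g \<Longrightarrow> left_inv N (\<lambda>w. g (rev (map T w)))"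
proof -
  show "multilin (*) N (\<lambda>w. g (rev (map T w)))" if "multilin (*) N g"
  proof (rule multilinI)
    fix xs ys :: "'h list" assume "length xs + length ys + 1 = N"
    then have "lin (\<lambda>a. g (rev (map T ys) @ a # rev (map T xs)))"
      by (intro lin_slot [OF that]) simp
    from lin_compose [OF this T(1)] show "lin (\<lambda>a. g (rev (map T (xs @ a # ys))))" by simp
  qed
  show "balanced N (\<lambda>w. g (rev (map T w)))" if "balanced N g"
    unfolding balanced_def
  proof (intro allI impI)
    fix xs ys :: "'h list" and a b a' assume b: "b \<in> R" and len: "length xs + length ys + 2 = N"
    have "T b \<in> R" using T(3) b by blast
    then have "g (rev (map T ys) @ (T a' * T b) # T a # rev (map T xs)) =
        g (rev (map T ys) @ T a' # (T b * T a) # rev (map T xs))"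
      using that len unfolding balanced_def by simp
    then show "g (rev (map T (xs @ (a * b) # a' # ys))) = g (rev (map T (xs @ a # (b * a') # ys)))"
      by (simp add: T(2))
  qed
  show "right_inv N (\<lambda>w. g (rev (map T w)))" if "left_inv N g"
    using that by (simp add: left_inv_def right_inv_def T(2,4))
  show "left_inv N (\<lambda>w. g (rev (map T w)))" if "right_inv N g"
    using that by (simp add: left_inv_def right_inv_def T(2,4))
qed

text \<open>Reversing a word and applying \<open>S\<close> to its letters exchanges the two one-sided actions.\<close>

lemma inv_ann_iff_left:
  "S r \<in> inv_ann n \<longleftrightarrow> (\<forall>\<gamma> y. inv_functional \<epsilon> {} UNIV (tpowR (n + 1)) \<gamma> \<longrightarrow>
    y \<in> bcarrier (tpowR (n + 1)) \<longrightarrow> \<gamma> (blact (tpowR (n + 1)) r y) = 0)"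
proof -
  have surj: "surj S" using antipode_image_eq [OF subspace_UNIV] by simp
  define T where "T = inv S"
  have TS: "T (S x) = x" and ST: "S (T x) = x" for x
    using inj_antipode surj by (simp_all add: T_def surj_f_inv_f)
  have T: "lin_endo T" "T (x * y) = T y * T x" "T ` R \<subseteq> R" "\<epsilon> (T x) = \<epsilon> x" for x y
  proof -
    show "lin_endo T"
      using lin_endo_antipode TS ST unfolding lin_endo_def by metis
    show "T (x * y) = T y * T x" using TS ST S_mult by metis
    show "T ` R \<subseteq> R"
    proof
      fix y assume "y \<in> T ` R"
      then have "y \<in> T ` (S ` R)" by (simp add: S_R)
      then show "y \<in> R" using TS by auto
    qed
    show "\<epsilon> (T x) = \<epsilon> x" using counit_antipode ST by metis
  qed
  have S: "lin_endo S" "S (x * y) = S y * S x" "S ` R \<subseteq> R" "\<epsilon> (S x) = \<epsilon> x" for x y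
    using lin_endo_antipode S_mult S_R counit_antipode by auto
  show ?thesis
  proof (intro iffI allI impI)
    fix \<gamma> y assume r: "S r \<in> inv_ann n" and \<gamma>: "inv_functional \<epsilon> {} UNIV (tpowR (n + 1)) \<gamma>"
      and y: "y \<in> bcarrier (tpowR (n + 1))"
    obtain f where f: "f \<in> wfree (n + 1)" "y = tcl (n + 1) f" using y by (rule tover_cases)
    let ?g = "\<lambda>w. \<gamma> (tcl (n + 1) (Poly_Mapping.single w 1))"
    note g = forms_of_functional [OF le_add2 \<gamma> disjI2 [OF refl]]
    have g_in: "(\<lambda>w. ?g (rev (map T w))) \<in> inv_forms n"
      using flip_forms(1) [OF T g(1)] flip_forms(2) [OF T g(2)] flip_forms(4) [OF T g(4)]
      by (simp add: inv_forms_def)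
    have "?g ((r * hd w) # tl w) = 0" if "w \<in> Poly_Mapping.keys f" for w
    proof -
      have "length w = n + 1" using f(1) that by (auto simp: free_on_def words_def)
      then obtain x xs where w: "w = x # xs" "length xs = n" by (cases w) auto
      show ?thesis
        \<comment> \<open>Reversal and \<open>T\<close> turn the last letter
          \<open>S x * S r\<close> into the first letter \<open>r * x\<close>.\<close>
        using inv_annD [OF r g_in, of "rev (map S xs)" "S x"] w
        by (simp add: rev_map T(2) TS comp_def)
    qed
    then have "lin_ext (*) ?g (lact r f) = 0"
      by (simp add: lact_def base_field.lin_ext_lin_ext) (simp add: lin_ext_def)
    then show "\<gamma> (blact (tpowR (n + 1)) r y) = 0"
      using f g(5) [OF lact_free [OF le_add2 f(1)]] by (simp add: blact_tcl)
  next
    assume *: "\<forall>\<gamma> y. inv_functional \<epsilon> {} UNIV (tpowR (n + 1)) \<gamma> \<longrightarrow>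
      y \<in> bcarrier (tpowR (n + 1)) \<longrightarrow> \<gamma> (blact (tpowR (n + 1)) r y) = 0"
    have "g (xs @ [x * S r]) = 0" if g: "g \<in> inv_forms n" and xs: "length xs = n" for g xs x
    proof -
      let ?h = "\<lambda>w. g (rev (map S w))"
      obtain \<gamma> where \<gamma>: "inv_functional \<epsilon> {} UNIV (tpowR (n + 1)) \<gamma>"
        "\<And>f. f \<in> wfree (n + 1) \<Longrightarrow> \<gamma> (tcl (n + 1) f) = lin_ext (*) ?h f"
        by (rule functional_of_form [of "n + 1" ?h "{}" UNIV])
          (use g flip_forms [OF S] in \<open>auto simp: inv_forms_def\<close>)
      \<comment> \<open>The word that reversal and \<open>S\<close> send to \<open>xs @ [x]\<close>;
        a factor \<open>r\<close> on the left of its first letter becomes \<open>S r\<close> on the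
        right of the last.\<close>
      let ?s = "Poly_Mapping.single (T x # rev (map T xs)) (1 :: 'k)"
      have s: "?s \<in> wfree (n + 1)"
        using xs by (intro single_in_free_on) (simp add: words_def)
      have "0 = \<gamma> (tcl (n + 1) (lact r ?s))"
        using * \<gamma>(1) tcl_in [OF s] blact_tcl [OF le_add2 s] by metis
      also have "\<dots> = g (xs @ [x * S r])"
        by (subst \<gamma>(2) [OF lact_free [OF le_add2 s]]) (simp add: lact_def rev_map S(2) ST comp_def)
      finally show ?thesis by simp
    qed
    then show "S r \<in> inv_ann n" by (simp add: inv_ann_def)
  qed
qed

section \<open>The depth condition and its consequence for annihilators\<close>

text \<open>Elements of \<open>R\<close> act on the side of the bimodule where only \<open>R\<close>
  acts, and coinvariants are taken over \<open>H\<close> on the other side. For left depth that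
  makes \<open>R\<close> act on the left, which is why the antipode comes in.\<close>

lemma inv_ann_step:
  assumes "has_depth_even scale R (2 * n + 2)"
  shows "R \<inter> inv_ann n \<subseteq> inv_ann (Suc n)"
proof
  fix r assume r: "r \<in> R \<inter> inv_ann n"
  have minus_R: "scale (- 1) 1 \<in> R" by (intro subspace_scale subspace_R one_R)
  have bim: "additive_bimodule UNIV R (tpowR (Suc k))" "additive_bimodule R UNIV (tpowR (Suc k))" for k
    using minus_R by (auto intro: additive_bimodule_tover)
  consider "similar R UNIV (tpowR (Suc (Suc n))) (tpowR (Suc n))"
    | "similar UNIV R (tpowR (Suc (Suc n))) (tpowR (Suc n))"
  proof -
    obtain m where "2 * n + 2 = 2 * m"
      and sim: "similar R UNIV (tpowR (m + 1)) (tpowR m) \<or> similar UNIV R (tpowR (m + 1)) (tpowR m)"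
      using assms unfolding has_depth_even_def left_depth_even_def right_depth_even_def by blast
    \<comment> \<open>Depth 2m compares m + 1 with m factors; for 2m = 2n + 2 these are the
      bimodules behind \<open>inv_ann (Suc n)\<close> and \<open>inv_ann n\<close>.\<close>
    then have "m = Suc n" by simp
    with sim that show thesis by auto
  qed
  then show "r \<in> inv_ann (Suc n)"
  proof cases
    case 1
    then obtain q where iso: "iso_direct_summand R UNIV (tpowR (Suc (Suc n))) (copies q (tpowR (Suc n)))"
      by (auto simp: similar_def)
    \<comment> \<open>By \<open>S R = R\<close> the preimage can be taken in \<open>R\<close>; it is
      \<open>r'\<close> that acts on the left.\<close>
    obtain r' where r': "r' \<in> R" "r = S r'" using r S_R by blast
    have Y: "\<gamma> (blact (tpowR (Suc n)) r' y) = 0"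
      if "inv_functional \<epsilon> {} UNIV (tpowR (Suc n)) \<gamma>" "y \<in> bcarrier (tpowR (Suc n))" for \<gamma> y
      using r that inv_ann_iff_left [of r' n] unfolding r'(2) by simp
    have "\<gamma> (blact (tpowR (Suc (Suc n))) r' x) = 0"
      if "inv_functional \<epsilon> {} UNIV (tpowR (Suc (Suc n))) \<gamma>" "x \<in> bcarrier (tpowR (Suc (Suc n)))" for \<gamma> x
      by (rule inv_functional_vanish_summand(2)
        [OF bim(2) bim(2) iso empty_subsetI [of R] subset_UNIV [of UNIV] r'(1) _ that]) (rule Y)
    then show ?thesis using inv_ann_iff_left [of r' "Suc n"] unfolding r'(2) by simp
  next
    case 2
    then obtain q where iso: "iso_direct_summand UNIV R (tpowR (Suc (Suc n))) (copies q (tpowR (Suc n)))"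
      by (auto simp: similar_def)
    have Y: "\<gamma> (bract (tpowR (Suc n)) y r) = 0"
      if "inv_functional \<epsilon> UNIV {} (tpowR (Suc n)) \<gamma>" "y \<in> bcarrier (tpowR (Suc n))" for \<gamma> y
      using r that inv_ann_iff_right [of r n] by simp
    have "\<gamma> (bract (tpowR (Suc (Suc n))) x r) = 0"
      if "inv_functional \<epsilon> UNIV {} (tpowR (Suc (Suc n))) \<gamma>" "x \<in> bcarrier (tpowR (Suc (Suc n)))" for \<gamma> x
      by (rule inv_functional_vanish_summand(1)
        [OF bim(1) bim(1) iso subset_UNIV [of UNIV] empty_subsetI [of R] IntD1 [OF r] _ that]) (rule Y)
    then show ?thesis using inv_ann_iff_right [of r "Suc n"] by simp
  qed
qed

lemma Ann_Qpow_mono: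
  assumes "has_depth_even scale R (2 * n + 2)"
  shows "Ann_Qpow scale \<Delta> \<epsilon> R n \<subseteq> Ann_Qpow scale \<Delta> \<epsilon> R (n + m)"
proof -
  have step: "R \<inter> coef_ann (n + m) \<subseteq> coef_ann (Suc (n + m))" for m
    using inv_ann_step [OF assms] by (intro coef_ann_mono_step) (simp add: inv_ann_eq_coef_ann)
  have "R \<inter> coef_ann n \<subseteq> coef_ann (n + m)"
  proof (induction m)
    case (Suc m)
    then show ?case using step [of m] by auto
  qed simp
  then show ?thesis by (auto simp: Ann_Qpow_eq)
qed

end

theorem proposition4p3:
  fixes scale :: "'k::field \<Rightarrow> 'h::ring_1 \<Rightarrow> 'h"
    and \<Delta> :: "'h \<Rightarrow> ('h list \<Rightarrow>\<^sub>0 'k) set"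
    and \<epsilon> :: "'h \<Rightarrow> 'k"
    and S :: "'h \<Rightarrow> 'h"
    and R :: "'h set"
    and n :: nat
  assumes "hopf_algebra scale \<Delta> \<epsilon> S"
    and "finite_dimensional scale"
    and "hopf_subalgebra scale \<Delta> S R"
    and "has_depth_even scale R (2 * n + 2)"
  shows "\<forall>r::nat. Ann_Qpow scale \<Delta> \<epsilon> R n \<subseteq> Ann_Qpow scale \<Delta> \<epsilon> R (n + r)"
proof -
  interpret hopf_subalgebra_pair scale \<Delta> \<epsilon> S R
    using assms(1-3)
    by (intro hopf_subalgebra_pair.intro findim_hopf_algebra.intro
        findim_hopf_algebra_axioms.intro hopf_subalgebra_pair_axioms.intro)
  show ?thesis using Ann_Qpow_mono [OF assms(4)] by blast
qed

end
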